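(* Let $H_8$ be the unique nontrivial (neither commutative nor cocommutative) semisimple Hopf algebra of dimension $8$ over $k$ and let $D(H_8)$ be its Drinfeld double. Then: (i) $D(H_8)$ fits into an abelian central extension $0\to k^G\to D(H_8)\to kG\to1$, where $G=G(D(H_8)^* )\simeq\mathbb Z_2\times\mathbb Z_2\times\mathbb Z_2$. (ii) $D(H_8)$ is of type $(1,8;2,14)$ as an algebra, and as a coalgebra it is of type $(1,16;2,8;4,1)$.
   Context: $k$ is an algebraically closed field of characteristic zero. $H_8$ is generated as an algebra by $x,y,z$ with relations $x^2=y^2=1$, $xy=yx$, $zx=yz$, $zy=xz$, $z^2=\frac12(1+x+y-xy)$, and coalgebra structure $\Delta(x)=x\otimes x$, $\Delta(y)=y\otimes y$, $\Delta(z)=\frac12\left((1+y)\otimes1+(1-y)\otimes x\right)(z\otimes z)$, $\epsilon(x)=\epsilon(y)=\epsilon(z)=1$. $G(K)$ denotes the group of group-like elements of a Hopf algebra $K$; $k^G=(kG)^*$. An extension $0\to A\to D\to B\to1$ of finite dimensional Hopf algebras means that $A\to D$ is injective with normal image, $D\to B$ is surjective, and $B\simeq D/DA^+$ ($A^+=A\cap\ker\epsilon$). It is abelian if $A$ is commutative and $B$ is cocommutative, and central if the image of $A$ lies in the center of $D$. A semisimple Hopf algebra is of type $(1,n;d_1,n_1;\dots;d_r,n_r)$ as an algebra (respectively as a coalgebra) if it has exactly $n$ non-isomorphic one-dimensional representations (resp. corepresentations), exactly $n_i$ non-isomorphic irreducible representations (resp. corepresentations) of dimension $d_i$, and no others.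 *)

theory Defs
  imports
    "HOL-Library.Poly_Mapping"
    "HOL-Algebra.Elementary_Groups"
    "HOL-Computational_Algebra.Polynomial"
begin

section \<open>Free vector spaces and linear maps\<close>

text \<open>
  Every vector space over a field \<open>k\<close> has, after a choice of basis, the form \<open>k[I]\<close>: the finitely
  supported functions on a set \<open>I\<close>. We use \<open>'i \<Rightarrow>\<^sub>0 'k\<close> as the type of vectors, so that
  \<open>k[I] \<otimes> k[J] = k[I \<times> J]\<close>, and, for finite \<open>I\<close>, the dual of \<open>k[I]\<close> is again \<open>k[I]\<close> with respect to
  the dual basis.
\<close>

definition smul :: "'k::field \<Rightarrow> ('i \<Rightarrow>\<^sub>0 'k) \<Rightarrow> ('i \<Rightarrow>\<^sub>0 'k)"
  where "smul c v = Poly_Mapping.map ((*) c) v"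

lemma lookup_smul [simp]:
  "Poly_Mapping.lookup (smul c v) i = c * Poly_Mapping.lookup v i"
  by (auto simp: smul_def Poly_Mapping.map.rep_eq when_def)

global_interpretation pm: vector_space "smul :: 'k::field \<Rightarrow> ('i \<Rightarrow>\<^sub>0 'k) \<Rightarrow> ('i \<Rightarrow>\<^sub>0 'k)"
  by standard (auto intro!: poly_mapping_eqI simp: lookup_add algebra_simps)

definition vsp :: "'i set \<Rightarrow> ('i \<Rightarrow>\<^sub>0 'k::field) set"
  where "vsp I = {v. Poly_Mapping.keys v \<subseteq> I}"

abbreviation bv :: "'i \<Rightarrow> ('i \<Rightarrow>\<^sub>0 'k::field)"
  where "bv i \<equiv> Poly_Mapping.single i 1"

text \<open>Linear extension of a function (or scalar function) given on basis vectors.\<close>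

definition lin :: "('i \<Rightarrow> ('j \<Rightarrow>\<^sub>0 'k)) \<Rightarrow> ('i \<Rightarrow>\<^sub>0 'k::field) \<Rightarrow> ('j \<Rightarrow>\<^sub>0 'k)"
  where "lin f v = (\<Sum>i\<in>Poly_Mapping.keys v. smul (Poly_Mapping.lookup v i) (f i))"

definition lfun :: "('i \<Rightarrow> 'k) \<Rightarrow> ('i \<Rightarrow>\<^sub>0 'k::field) \<Rightarrow> 'k"
  where "lfun f v = (\<Sum>i\<in>Poly_Mapping.keys v. Poly_Mapping.lookup v i * f i)"

definition tens :: "('i \<Rightarrow>\<^sub>0 'k::field) \<Rightarrow> ('j \<Rightarrow>\<^sub>0 'k) \<Rightarrow> ('i \<times> 'j \<Rightarrow>\<^sub>0 'k)"
  where "tens u v = (\<Sum>i\<in>Poly_Mapping.keys u. \<Sum>j\<in>Poly_Mapping.keys v.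
           Poly_Mapping.single (i, j) (Poly_Mapping.lookup u i * Poly_Mapping.lookup v j))"

text \<open>The tensor product \<open>f \<otimes> g\<close> of linear maps, and the canonical isomorphism
  \<open>(U \<otimes> V) \<otimes> W \<cong> U \<otimes> (V \<otimes> W)\<close>.\<close>

definition tmap :: "(('i \<Rightarrow>\<^sub>0 'k::field) \<Rightarrow> ('a \<Rightarrow>\<^sub>0 'k)) \<Rightarrow> (('j \<Rightarrow>\<^sub>0 'k) \<Rightarrow> ('b \<Rightarrow>\<^sub>0 'k))
    \<Rightarrow> ('i \<times> 'j \<Rightarrow>\<^sub>0 'k) \<Rightarrow> ('a \<times> 'b \<Rightarrow>\<^sub>0 'k)"
  where "tmap f g = lin (\<lambda>(i, j). tens (f (bv i)) (g (bv j)))"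

definition reassoc :: "(('a \<times> 'b) \<times> 'c \<Rightarrow>\<^sub>0 'k::field) \<Rightarrow> ('a \<times> 'b \<times> 'c \<Rightarrow>\<^sub>0 'k)"
  where "reassoc = lin (\<lambda>((i, j), l). bv (i, j, l))"

definition flip :: "('a \<times> 'b \<Rightarrow>\<^sub>0 'k::field) \<Rightarrow> ('b \<times> 'a \<Rightarrow>\<^sub>0 'k)"
  where "flip = lin (\<lambda>(i, j). bv (j, i))"

text \<open>A linear map \<open>k[I] \<rightarrow> k[J]\<close>; values outside \<open>k[I]\<close> are immaterial, and a linear map given only
  on \<open>k[I]\<close> always extends.\<close>

definition lmap :: "'i set \<Rightarrow> 'j set \<Rightarrow> (('i \<Rightarrow>\<^sub>0 'k::field) \<Rightarrow> ('j \<Rightarrow>\<^sub>0 'k)) \<Rightarrow> bool"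
  where "lmap I J f \<longleftrightarrow> Vector_Spaces.linear smul smul f \<and> f ` vsp I \<subseteq> vsp J"


section \<open>Algebras and Hopf algebras\<close>

text \<open>The underlying space is \<open>k[basis]\<close>; the structure maps are recorded by their values on basis
  vectors and extended linearly below.\<close>

record (overloaded) ('i, 'k) alg =
  basis :: "'i set"
  bmult :: "'i \<Rightarrow> 'i \<Rightarrow> ('i \<Rightarrow>\<^sub>0 'k)"
  unt :: "'i \<Rightarrow>\<^sub>0 'k"

record (overloaded) ('i, 'k) hopf = "('i, 'k) alg" +
  bcomult :: "'i \<Rightarrow> ('i \<times> 'i \<Rightarrow>\<^sub>0 'k)"
  bcounit :: "'i \<Rightarrow> 'k"
  bantipode :: "'i \<Rightarrow> ('i \<Rightarrow>\<^sub>0 'k)"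

abbreviation space :: "('i, 'k::field, 'z) alg_scheme \<Rightarrow> ('i \<Rightarrow>\<^sub>0 'k) set"
  where "space A \<equiv> vsp (basis A)"

definition mul :: "('i, 'k::field, 'z) alg_scheme \<Rightarrow> ('i \<Rightarrow>\<^sub>0 'k) \<Rightarrow> ('i \<Rightarrow>\<^sub>0 'k) \<Rightarrow> ('i \<Rightarrow>\<^sub>0 'k)"
  where "mul A a b = lin (\<lambda>(i, j). bmult A i j) (tens a b)"

definition comult :: "('i, 'k::field) hopf \<Rightarrow> ('i \<Rightarrow>\<^sub>0 'k) \<Rightarrow> ('i \<times> 'i \<Rightarrow>\<^sub>0 'k)"
  where "comult H = lin (bcomult H)"

definition counit :: "('i, 'k::field) hopf \<Rightarrow> ('i \<Rightarrow>\<^sub>0 'k) \<Rightarrow> 'k"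
  where "counit H = lfun (bcounit H)"

definition antipode :: "('i, 'k::field) hopf \<Rightarrow> ('i \<Rightarrow>\<^sub>0 'k) \<Rightarrow> ('i \<Rightarrow>\<^sub>0 'k)"
  where "antipode H = lin (bantipode H)"

definition tensor_alg :: "('i, 'k::field, 'z) alg_scheme \<Rightarrow> ('j, 'k, 'y) alg_scheme \<Rightarrow> ('i \<times> 'j, 'k) alg"
  where "tensor_alg A B =
    \<lparr> basis = basis A \<times> basis B,
      bmult = (\<lambda>(i, j) (i', j'). tens (bmult A i i') (bmult B j j')),
      unt = tens (unt A) (unt B) \<rparr>"

definition is_algebra :: "('i, 'k::field, 'z) alg_scheme \<Rightarrow> bool"
  where "is_algebra A \<longleftrightarrow>
    (\<forall>i\<in>basis A. \<forall>j\<in>basis A. bmult A i j \<in> space A) \<and>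
    unt A \<in> space A \<and>
    (\<forall>a\<in>space A. \<forall>b\<in>space A. \<forall>c\<in>space A. mul A (mul A a b) c = mul A a (mul A b c)) \<and>
    (\<forall>a\<in>space A. mul A (unt A) a = a \<and> mul A a (unt A) = a)"

definition is_coalgebra :: "('i, 'k::field) hopf \<Rightarrow> bool"
  where "is_coalgebra H \<longleftrightarrow>
    (\<forall>i\<in>basis H. bcomult H i \<in> vsp (basis H \<times> basis H)) \<and>
    (\<forall>a\<in>space H. reassoc (tmap (comult H) id (comult H a)) = tmap id (comult H) (comult H a)) \<and>
    (\<forall>a\<in>space H. lin (\<lambda>(i, j). smul (bcounit H i) (bv j)) (comult H a) = a \<and>
                 lin (\<lambda>(i, j). smul (bcounit H j) (bv i)) (comult H a) = a)"

definition is_hopf_algebra :: "('i, 'k::field) hopf \<Rightarrow> bool"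
  where "is_hopf_algebra H \<longleftrightarrow>
    is_algebra H \<and> is_coalgebra H \<and>
    (\<forall>a\<in>space H. \<forall>b\<in>space H.
       comult H (mul H a b) = mul (tensor_alg H H) (comult H a) (comult H b)) \<and>
    comult H (unt H) = tens (unt H) (unt H) \<and>
    (\<forall>a\<in>space H. \<forall>b\<in>space H. counit H (mul H a b) = counit H a * counit H b) \<and>
    counit H (unt H) = 1 \<and>
    (\<forall>i\<in>basis H. bantipode H i \<in> space H) \<and>
    (\<forall>a\<in>space H.
       lin (\<lambda>(i, j). mul H (antipode H (bv i)) (bv j)) (comult H a) = smul (counit H a) (unt H) \<and>
       lin (\<lambda>(i, j). mul H (bv i) (antipode H (bv j))) (comult H a) = smul (counit H a) (unt H))"

definition is_fd_hopf_algebra :: "('i, 'k::field) hopf \<Rightarrow> bool"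
  where "is_fd_hopf_algebra H \<longleftrightarrow> is_hopf_algebra H \<and> finite (basis H)"

definition commutative_alg :: "('i, 'k::field, 'z) alg_scheme \<Rightarrow> bool"
  where "commutative_alg A \<longleftrightarrow> (\<forall>a\<in>space A. \<forall>b\<in>space A. mul A a b = mul A b a)"

definition cocommutative :: "('i, 'k::field) hopf \<Rightarrow> bool"
  where "cocommutative H \<longleftrightarrow> (\<forall>a\<in>space H. flip (comult H a) = comult H a)"

definition alg_center :: "('i, 'k::field, 'z) alg_scheme \<Rightarrow> ('i \<Rightarrow>\<^sub>0 'k) set"
  where "alg_center A = {c \<in> space A. \<forall>a\<in>space A. mul A c a = mul A a c}"

definition hopf_hom :: "('i, 'k::field) hopf \<Rightarrow> ('j, 'k) hopf \<Rightarrow> (('i \<Rightarrow>\<^sub>0 'k) \<Rightarrow> ('j \<Rightarrow>\<^sub>0 'k)) \<Rightarrow> bool"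
  where "hopf_hom A B f \<longleftrightarrow>
    lmap (basis A) (basis B) f \<and>
    (\<forall>a\<in>space A. \<forall>b\<in>space A. f (mul A a b) = mul B (f a) (f b)) \<and>
    f (unt A) = unt B \<and>
    (\<forall>a\<in>space A. comult B (f a) = tmap f f (comult A a)) \<and>
    (\<forall>a\<in>space A. counit B (f a) = counit A a) \<and>
    (\<forall>a\<in>space A. antipode B (f a) = f (antipode A a))"

text \<open>The dual of a finite dimensional Hopf algebra, on the dual basis:
  \<open>(p q)(a) = p(a\<^sub>1) q(a\<^sub>2)\<close>, \<open>p(a b) = p\<^sub>1(a) p\<^sub>2(b)\<close> and \<open>S(p) = p \<circ> S\<close>.\<close>

definition dual :: "('i, 'k::field) hopf \<Rightarrow> ('i, 'k) hopf"
  where "dual H =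
    \<lparr> basis = basis H,
      bmult = (\<lambda>i j. \<Sum>l\<in>basis H. Poly_Mapping.single l (Poly_Mapping.lookup (bcomult H l) (i, j))),
      unt = (\<Sum>l\<in>basis H. Poly_Mapping.single l (bcounit H l)),
      bcomult = (\<lambda>l. \<Sum>(i, j)\<in>basis H \<times> basis H.
                   Poly_Mapping.single (i, j) (Poly_Mapping.lookup (bmult H i j) l)),
      bcounit = (\<lambda>i. Poly_Mapping.lookup (unt H) i),
      bantipode = (\<lambda>i. \<Sum>j\<in>basis H.
                     Poly_Mapping.single j (Poly_Mapping.lookup (bantipode H j) i)) \<rparr>"

text \<open>The value \<open>p(a)\<close> of an element of the dual (in dual coordinates).\<close>

definition pairing :: "('i \<Rightarrow>\<^sub>0 'k::field) \<Rightarrow> ('i \<Rightarrow>\<^sub>0 'k) \<Rightarrow> 'k"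
  where "pairing p a = lfun (Poly_Mapping.lookup p) a"


section \<open>The Drinfeld double\<close>

text \<open>
  \<open>D(H) = H\<^sup>*\<^sup>c\<^sup>o\<^sup>p \<bowtie> H\<close>: as a coalgebra it is \<open>H\<^sup>*\<^sup>c\<^sup>o\<^sup>p \<otimes> H\<close>, with multiplication
  \<open>(p \<bowtie> h)(q \<bowtie> g) = p (h\<^sub>1 \<rightharpoonup> q \<leftharpoonup> S\<^sup>-\<^sup>1(h\<^sub>3)) \<bowtie> h\<^sub>2 g\<close>, where
  \<open>(h\<^sub>1 \<rightharpoonup> q \<leftharpoonup> S\<^sup>-\<^sup>1(h\<^sub>3))(t) = q(S\<^sup>-\<^sup>1(h\<^sub>3) t h\<^sub>1)\<close>.
  The basis vector \<open>(i, h)\<close> stands for (dual basis vector \<open>i\<close>) \<open>\<bowtie>\<close> (basis vector \<open>h\<close>).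
\<close>

definition antipode_inv :: "('i, 'k::field) hopf \<Rightarrow> ('i \<Rightarrow>\<^sub>0 'k) \<Rightarrow> ('i \<Rightarrow>\<^sub>0 'k)"
  where "antipode_inv H = inv_into (space H) (antipode H)"

definition coadj :: "('i, 'k::field) hopf \<Rightarrow> ('i \<Rightarrow>\<^sub>0 'k) \<Rightarrow> ('i \<Rightarrow>\<^sub>0 'k) \<Rightarrow> ('i \<Rightarrow>\<^sub>0 'k) \<Rightarrow> ('i \<Rightarrow>\<^sub>0 'k)"
  where "coadj H h1 q h3 =
    (\<Sum>t\<in>basis H. Poly_Mapping.single t (pairing q (mul H (mul H (antipode_inv H h3) (bv t)) h1)))"

definition double_alg :: "('i, 'k::field) hopf \<Rightarrow> ('i \<times> 'i, 'k) alg"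
  where "double_alg H =
    \<lparr> basis = basis H \<times> basis H,
      bmult = (\<lambda>(i, h) (j, g).
        lin (\<lambda>(h1, h2, h3). tens (mul (dual H) (bv i) (coadj H (bv h1) (bv j) (bv h3))) (bmult H h2 g))
          (tmap id (comult H) (comult H (bv h)))),
      unt = tens (unt (dual H)) (unt H) \<rparr>"

text \<open>\<open>\<Delta>(p \<bowtie> h) = (p\<^sub>2 \<bowtie> h\<^sub>1) \<otimes> (p\<^sub>1 \<bowtie> h\<^sub>2)\<close>, \<open>\<epsilon>(p \<bowtie> h) = p(1) \<epsilon>(h)\<close> and
  \<open>S(p \<bowtie> h) = (\<epsilon> \<bowtie> S(h)) (p \<circ> S\<^sup>-\<^sup>1 \<bowtie> 1)\<close>.\<close>

definition drinfeld_double :: "('i, 'k::field) hopf \<Rightarrow> ('i \<times> 'i, 'k) hopf"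
  where "drinfeld_double H =
    \<lparr> basis = basis (double_alg H),
      bmult = bmult (double_alg H),
      unt = unt (double_alg H),
      bcomult = (\<lambda>(i, h).
        lin (\<lambda>((p1, p2), (h1, h2)). bv ((p2, h1), (p1, h2)))
          (tens (bcomult (dual H) i) (bcomult H h))),
      bcounit = (\<lambda>(i, h). bcounit (dual H) i * bcounit H h),
      bantipode = (\<lambda>(i, h).
        mul (double_alg H)
          (tens (unt (dual H)) (bantipode H h))
          (tens (\<Sum>t\<in>basis H. Poly_Mapping.single t (pairing (bv i) (antipode_inv H (bv t)))) (unt H))) \<rparr>"


section \<open>Group-likes, group algebras, extensions\<close>

definition group_likes :: "('i, 'k::field) hopf \<Rightarrow> ('i \<Rightarrow>\<^sub>0 'k) monoid"
  where "group_likes H =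
    \<lparr> carrier = {g \<in> space H. comult H g = tens g g \<and> counit H g = 1},
      monoid.mult = mul H, one = unt H \<rparr>"

definition group_algebra :: "('g, 'm) monoid_scheme \<Rightarrow> ('g, 'k::field) hopf"
  where "group_algebra G =
    \<lparr> basis = carrier G,
      bmult = (\<lambda>g h. bv (g \<otimes>\<^bsub>G\<^esub> h)),
      unt = bv \<one>\<^bsub>G\<^esub>,
      bcomult = (\<lambda>g. bv (g, g)),
      bcounit = (\<lambda>g. 1),
      bantipode = (\<lambda>g. bv (inv\<^bsub>G\<^esub> g)) \<rparr>"

definition function_algebra :: "('g, 'm) monoid_scheme \<Rightarrow> ('g, 'k::field) hopf"
  where "function_algebra G = dual (group_algebra G)"

text \<open>Stability under the left and the right adjoint action.\<close>

definition normal_in :: "('i, 'k::field) hopf \<Rightarrow> ('i \<Rightarrow>\<^sub>0 'k) set \<Rightarrow> bool"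
  where "normal_in D K \<longleftrightarrow>
    (\<forall>h\<in>space D. \<forall>a\<in>K.
       lin (\<lambda>(i, j). mul D (mul D (bv i) a) (antipode D (bv j))) (comult D h) \<in> K \<and>
       lin (\<lambda>(i, j). mul D (mul D (antipode D (bv i)) a) (bv j)) (comult D h) \<in> K)"

text \<open>\<open>D A\<^sup>+\<close>, the span of the products \<open>d a\<close> with \<open>a \<in> A \<inter> ker \<epsilon>\<close>.\<close>

definition augmentation_left_ideal :: "('i, 'k::field) hopf \<Rightarrow> ('i \<Rightarrow>\<^sub>0 'k) set \<Rightarrow> ('i \<Rightarrow>\<^sub>0 'k) set"
  where "augmentation_left_ideal D K = pm.span {mul D d a | d a. d \<in> space D \<and> a \<in> K \<and> counit D a = 0}"

text \<open>The extension \<open>0 \<rightarrow> A \<rightarrow> D \<rightarrow> B \<rightarrow> 1\<close>; the last clause says that \<open>\<pi>\<close> induces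
  \<open>D / D A\<^sup>+ \<cong> B\<close>.\<close>

definition hopf_extension ::
  "('a, 'k::field) hopf \<Rightarrow> (('a \<Rightarrow>\<^sub>0 'k) \<Rightarrow> ('d \<Rightarrow>\<^sub>0 'k)) \<Rightarrow> ('d, 'k) hopf \<Rightarrow>
   (('d \<Rightarrow>\<^sub>0 'k) \<Rightarrow> ('b \<Rightarrow>\<^sub>0 'k)) \<Rightarrow> ('b, 'k) hopf \<Rightarrow> bool"
  where "hopf_extension A \<iota> D \<pi> B \<longleftrightarrow>
    is_fd_hopf_algebra A \<and> is_fd_hopf_algebra D \<and> is_fd_hopf_algebra B \<and>
    hopf_hom A D \<iota> \<and> hopf_hom D B \<pi> \<and>
    inj_on \<iota> (space A) \<and> normal_in D (\<iota> ` space A) \<and>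
    \<pi> ` space D = space B \<and>
    {d \<in> space D. \<pi> d = 0} = augmentation_left_ideal D (\<iota> ` space A)"

definition abelian_extension ::
  "('a, 'k::field) hopf \<Rightarrow> (('a \<Rightarrow>\<^sub>0 'k) \<Rightarrow> ('d \<Rightarrow>\<^sub>0 'k)) \<Rightarrow> ('d, 'k) hopf \<Rightarrow>
   (('d \<Rightarrow>\<^sub>0 'k) \<Rightarrow> ('b \<Rightarrow>\<^sub>0 'k)) \<Rightarrow> ('b, 'k) hopf \<Rightarrow> bool"
  where "abelian_extension A \<iota> D \<pi> B \<longleftrightarrow>
    hopf_extension A \<iota> D \<pi> B \<and> commutative_alg A \<and> cocommutative B"

definition central_extension ::
  "('a, 'k::field) hopf \<Rightarrow> (('a \<Rightarrow>\<^sub>0 'k) \<Rightarrow> ('d \<Rightarrow>\<^sub>0 'k)) \<Rightarrow> ('d, 'k) hopf \<Rightarrow>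
   (('d \<Rightarrow>\<^sub>0 'k) \<Rightarrow> ('b \<Rightarrow>\<^sub>0 'k)) \<Rightarrow> ('b, 'k) hopf \<Rightarrow> bool"
  where "central_extension A \<iota> D \<pi> B \<longleftrightarrow>
    hopf_extension A \<iota> D \<pi> B \<and> \<iota> ` space A \<subseteq> alg_center D"


section \<open>Representations, corepresentations and types\<close>

text \<open>An \<open>n\<close>-dimensional representation is a left module structure
  \<open>\<alpha> : A \<otimes> k\<^sup>n \<rightarrow> k\<^sup>n\<close>, with \<open>k\<^sup>n = vsp {..<n}\<close>.\<close>

definition is_rep :: "('i, 'k::field, 'z) alg_scheme \<Rightarrow> nat \<Rightarrow> (('i \<times> nat \<Rightarrow>\<^sub>0 'k) \<Rightarrow> (nat \<Rightarrow>\<^sub>0 'k)) \<Rightarrow> bool"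
  where "is_rep A n \<alpha> \<longleftrightarrow>
    lmap (basis A \<times> {..<n}) {..<n} \<alpha> \<and>
    (\<forall>v\<in>vsp {..<n}. \<alpha> (tens (unt A) v) = v) \<and>
    (\<forall>a\<in>space A. \<forall>b\<in>space A. \<forall>v\<in>vsp {..<n}. \<alpha> (tens (mul A a b) v) = \<alpha> (tens a (\<alpha> (tens b v))))"

definition irreducible_rep :: "('i, 'k::field, 'z) alg_scheme \<Rightarrow> nat \<Rightarrow> (('i \<times> nat \<Rightarrow>\<^sub>0 'k) \<Rightarrow> (nat \<Rightarrow>\<^sub>0 'k)) \<Rightarrow> bool"
  where "irreducible_rep A n \<alpha> \<longleftrightarrow>
    is_rep A n \<alpha> \<and> n > 0 \<and>
    (\<forall>W. pm.subspace W \<and> W \<subseteq> vsp {..<n} \<and> (\<forall>a\<in>space A. \<forall>w\<in>W. \<alpha> (tens a w) \<in> W)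
       \<longrightarrow> W = {0} \<or> W = vsp {..<n})"

definition rep_iso :: "('i, 'k::field, 'z) alg_scheme \<Rightarrow> nat \<Rightarrow>
    (('i \<times> nat \<Rightarrow>\<^sub>0 'k) \<Rightarrow> (nat \<Rightarrow>\<^sub>0 'k)) \<Rightarrow> (('i \<times> nat \<Rightarrow>\<^sub>0 'k) \<Rightarrow> (nat \<Rightarrow>\<^sub>0 'k)) \<Rightarrow> bool"
  where "rep_iso A n \<alpha> \<beta> \<longleftrightarrow>
    (\<exists>\<phi>. lmap {..<n} {..<n} \<phi> \<and> bij_betw \<phi> (vsp {..<n}) (vsp {..<n}) \<and>
      (\<forall>a\<in>space A. \<forall>v\<in>vsp {..<n}. \<phi> (\<alpha> (tens a v)) = \<beta> (tens a (\<phi> v))))"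

definition irrep_classes :: "('i, 'k::field, 'z) alg_scheme \<Rightarrow> nat \<Rightarrow> (('i \<times> nat \<Rightarrow>\<^sub>0 'k) \<Rightarrow> (nat \<Rightarrow>\<^sub>0 'k)) set set"
  where "irrep_classes A n =
    {\<alpha>. irreducible_rep A n \<alpha>} //
    {(\<alpha>, \<beta>). irreducible_rep A n \<alpha> \<and> irreducible_rep A n \<beta> \<and> rep_iso A n \<alpha> \<beta>}"

text \<open>An \<open>n\<close>-dimensional corepresentation is a right comodule structure
  \<open>\<delta> : k\<^sup>n \<rightarrow> k\<^sup>n \<otimes> H\<close>.\<close>

definition is_corep :: "('i, 'k::field) hopf \<Rightarrow> nat \<Rightarrow> ((nat \<Rightarrow>\<^sub>0 'k) \<Rightarrow> (nat \<times> 'i \<Rightarrow>\<^sub>0 'k)) \<Rightarrow> bool"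
  where "is_corep H n \<delta> \<longleftrightarrow>
    lmap {..<n} ({..<n} \<times> basis H) \<delta> \<and>
    (\<forall>v\<in>vsp {..<n}. reassoc (tmap \<delta> id (\<delta> v)) = tmap id (comult H) (\<delta> v)) \<and>
    (\<forall>v\<in>vsp {..<n}. lin (\<lambda>(m, i). smul (bcounit H i) (bv m)) (\<delta> v) = v)"

definition irreducible_corep :: "('i, 'k::field) hopf \<Rightarrow> nat \<Rightarrow> ((nat \<Rightarrow>\<^sub>0 'k) \<Rightarrow> (nat \<times> 'i \<Rightarrow>\<^sub>0 'k)) \<Rightarrow> bool"
  where "irreducible_corep H n \<delta> \<longleftrightarrow>
    is_corep H n \<delta> \<and> n > 0 \<and>
    (\<forall>W. pm.subspace W \<and> W \<subseteq> vsp {..<n} \<and>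
         \<delta> ` W \<subseteq> pm.span {tens w h | w h. w \<in> W \<and> h \<in> space H}
       \<longrightarrow> W = {0} \<or> W = vsp {..<n})"

definition corep_iso :: "('i, 'k::field) hopf \<Rightarrow> nat \<Rightarrow>
    ((nat \<Rightarrow>\<^sub>0 'k) \<Rightarrow> (nat \<times> 'i \<Rightarrow>\<^sub>0 'k)) \<Rightarrow> ((nat \<Rightarrow>\<^sub>0 'k) \<Rightarrow> (nat \<times> 'i \<Rightarrow>\<^sub>0 'k)) \<Rightarrow> bool"
  where "corep_iso H n \<delta> \<gamma> \<longleftrightarrow>
    (\<exists>\<phi>. lmap {..<n} {..<n} \<phi> \<and> bij_betw \<phi> (vsp {..<n}) (vsp {..<n}) \<and>
      (\<forall>v\<in>vsp {..<n}. tmap \<phi> id (\<delta> v) = \<gamma> (\<phi> v)))"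

definition irred_corep_classes :: "('i, 'k::field) hopf \<Rightarrow> nat \<Rightarrow> ((nat \<Rightarrow>\<^sub>0 'k) \<Rightarrow> (nat \<times> 'i \<Rightarrow>\<^sub>0 'k)) set set"
  where "irred_corep_classes H n =
    {\<delta>. irreducible_corep H n \<delta>} //
    {(\<delta>, \<gamma>). irreducible_corep H n \<delta> \<and> irreducible_corep H n \<gamma> \<and> corep_iso H n \<delta> \<gamma>}"

text \<open>Semisimplicity: the left regular module is completely reducible.\<close>

definition is_left_ideal :: "('i, 'k::field, 'z) alg_scheme \<Rightarrow> ('i \<Rightarrow>\<^sub>0 'k) set \<Rightarrow> bool"
  where "is_left_ideal A L \<longleftrightarrow>
    pm.subspace L \<and> L \<subseteq> space A \<and> (\<forall>a\<in>space A. \<forall>l\<in>L. mul A a l \<in> L)"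

definition semisimple_alg :: "('i, 'k::field, 'z) alg_scheme \<Rightarrow> bool"
  where "semisimple_alg A \<longleftrightarrow>
    (\<forall>L. is_left_ideal A L \<longrightarrow>
      (\<exists>M. is_left_ideal A M \<and> L \<inter> M = {0} \<and> {l + m | l m. l \<in> L \<and> m \<in> M} = space A))"

text \<open>The type is given as the list of pairs (dimension, multiplicity). Irreducible modules and
  comodules of a finite dimensional Hopf algebra are finite dimensional.\<close>

definition of_algebra_type :: "('i, 'k::field) hopf \<Rightarrow> (nat \<times> nat) list \<Rightarrow> bool"
  where "of_algebra_type H T \<longleftrightarrow>
    is_fd_hopf_algebra H \<and> semisimple_alg H \<and>
    (\<forall>(d, n)\<in>set T. finite (irrep_classes H d) \<and> card (irrep_classes H d) = n) \<and>
    (\<forall>d \<alpha>. irreducible_rep H d \<alpha> \<longrightarrow> d \<in> fst ` set T)"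

definition of_coalgebra_type :: "('i, 'k::field) hopf \<Rightarrow> (nat \<times> nat) list \<Rightarrow> bool"
  where "of_coalgebra_type H T \<longleftrightarrow>
    is_fd_hopf_algebra H \<and> semisimple_alg H \<and>
    (\<forall>(d, n)\<in>set T. finite (irred_corep_classes H d) \<and> card (irred_corep_classes H d) = n) \<and>
    (\<forall>d \<delta>. irreducible_corep H d \<delta> \<longrightarrow> d \<in> fst ` set T)"


section \<open>Presentations and \<open>H\<^sub>8\<close>\<close>

definition free_alg :: "('g list, 'k::field) alg"
  where "free_alg = \<lparr> basis = UNIV, bmult = (\<lambda>u v. bv (u @ v)), unt = bv [] \<rparr>"

text \<open>The algebra map from the free algebra determined by the images \<open>f\<close> of the generators.\<close>

definition free_eval :: "('i, 'k::field, 'z) alg_scheme \<Rightarrow> ('g \<Rightarrow> ('i \<Rightarrow>\<^sub>0 'k)) \<Rightarrow> ('g list \<Rightarrow>\<^sub>0 'k) \<Rightarrow> ('i \<Rightarrow>\<^sub>0 'k)"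
  where "free_eval A f = lin (\<lambda>w. foldr (\<lambda>g a. mul A (f g) a) w (unt A))"

definition ideal_generated :: "('i, 'k::field, 'z) alg_scheme \<Rightarrow> ('i \<Rightarrow>\<^sub>0 'k) set \<Rightarrow> ('i \<Rightarrow>\<^sub>0 'k) set"
  where "ideal_generated A R = pm.span {mul A (mul A a r) b | a r b. a \<in> space A \<and> r \<in> R \<and> b \<in> space A}"

text \<open>\<open>A\<close> is generated by the family \<open>f\<close> subject to the relations \<open>r = 0\<close>, \<open>r \<in> R\<close>: evaluation
  induces an isomorphism from the free algebra modulo the ideal generated by \<open>R\<close>.\<close>

definition presented_by :: "('i, 'k::field, 'z) alg_scheme \<Rightarrow> ('g \<Rightarrow> ('i \<Rightarrow>\<^sub>0 'k)) \<Rightarrow> ('g list \<Rightarrow>\<^sub>0 'k) set \<Rightarrow> bool"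
  where "presented_by A f R \<longleftrightarrow>
    range f \<subseteq> space A \<and>
    range (free_eval A f) = space A \<and>
    {p. free_eval A f p = 0} = ideal_generated free_alg R"

datatype gen8 = GX | GY | GZ

definition H8_relations :: "(gen8 list \<Rightarrow>\<^sub>0 'k::field) set"
  where "H8_relations =
    { bv [GX, GX] - bv [],
      bv [GY, GY] - bv [],
      bv [GX, GY] - bv [GY, GX],
      bv [GZ, GX] - bv [GY, GZ],
      bv [GZ, GY] - bv [GX, GZ],
      bv [GZ, GZ] - smul (1/2) (bv [] + bv [GX] + bv [GY] - bv [GX, GY]) }"

definition is_H8 :: "('i, 'k::field) hopf \<Rightarrow> ('i \<Rightarrow>\<^sub>0 'k) \<Rightarrow> ('i \<Rightarrow>\<^sub>0 'k) \<Rightarrow> ('i \<Rightarrow>\<^sub>0 'k) \<Rightarrow> bool"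
  where "is_H8 H x y z \<longleftrightarrow>
    is_fd_hopf_algebra H \<and>
    presented_by H (case_gen8 x y z) H8_relations \<and>
    comult H x = tens x x \<and>
    comult H y = tens y y \<and>
    comult H z = mul (tensor_alg H H)
      (smul (1/2) (tens (unt H + y) (unt H) + tens (unt H - y) x)) (tens z z) \<and>
    counit H x = 1 \<and> counit H y = 1 \<and> counit H z = 1"

end

theory Submission
  imports Defs "HOL-Library.Z2" "HOL-Library.Product_Plus"
begin

text \<open>
  Fix \<open>i\<close> with \<open>i\<^sup>2 = -1\<close>. The element \<open>u = ((1 + i) z + (1 - i) x z) / 2\<close> and the idempotents
  \<open>e\<^sub>\<alpha> = (1 + (-1)\<^sup>\<alpha> x y) / 2\<close> give a basis \<open>x\<^sup>m e\<^sub>\<alpha> u\<^sup>c\<close> of \<open>H\<^sub>8\<close>, indexed by three bits, on which all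
  structure maps are given by powers of \<open>i\<close> and translations of the indices. The products \<open>F\<close> of the dual
  basis with this one form a basis of the double, indexed by six bits, with the same property, so identities
  in \<open>D(H\<^sub>8)\<close> become identities between exponents.

  The matrix coefficients of eight characters and fourteen monomial two-dimensional representations form a
  basis of \<open>D(H\<^sub>8)\<^sup>*\<close>, so \<open>D(H\<^sub>8)\<close> is a product of matrix algebras and has no other irreducible
  representations. As a coalgebra \<open>D(H\<^sub>8)\<close> is \<open>H\<^sub>8\<^sup>*\<close> (with opposite coproduct) tensor \<open>H\<^sub>8\<close>. Both factors
  have four one-dimensional irreducible corepresentations and one of dimension two, and the products of
  their matrix coefficients form a basis of \<open>D(H\<^sub>8)\<close>.

  The eight characters form the group \<open>G\<close>. Eight orthogonal central idempotents \<open>Bz\<close> span the copy of \<open>k\<^sup>G\<close>,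
  and \<open>D(H\<^sub>8) \<rightarrow> kG\<close> is the projection to the block \<open>D(H\<^sub>8) Bz 0\<close>, on which the characters live.
\<close>

text \<open>\<open>is_H8\<close> gives \<open>H\<close> only by a presentation and by the coproduct
  and counit of the generators. Linear independence of the eight products therefore has to be
  extracted from the presentation, through a formal copy of the basis on which the relations act as
  zero, and the antipode has to be guessed and identified by uniqueness of convolution inverses. The
  choice of \<open>u\<close> makes the basis monomial: its square is 1 on the part
  \<open>\<alpha> = 0\<close> and \<open>im\<close> on the part \<open>\<alpha> = 1\<close>, whereas
  the square of \<open>z\<close> involves \<open>x\<close>. The price is that representations
  supported on the second part need a square root \<open>w\<close> of \<open>im\<close>. That the
  double satisfies the Hopf algebra axioms is not taken for granted either. Associativity is read
  off from a complete set of multiplicative matrix coefficients and coassociativity from a basis of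
  comatrix units; only the compatibility of product and coproduct, the counit and the antipode are
  checked on \<open>F\<close>. Modules and comodules are counted by one argument, since both amount
  to operators on a coordinate space that satisfy the relations of matrix units.\<close>

section \<open>Linear algebra in free vector spaces\<close>

text \<open>Linearity as bare equations: the rules in \<open>lnr_intros\<close> then prove it for
  nested expressions by syntax alone. \<open>lnr_iff_linear\<close> identifies it with the notion
  used in \<open>lmap\<close>.\<close>

definition lnr :: "(('i \<Rightarrow>\<^sub>0 'k::field) \<Rightarrow> ('j \<Rightarrow>\<^sub>0 'k)) \<Rightarrow> bool"
  where "lnr f \<longleftrightarrow> (\<forall>u v. f (u + v) = f u + f v) \<and> (\<forall>c v. f (smul c v) = smul c (f v))"

definition lfn :: "(('i \<Rightarrow>\<^sub>0 'k::field) \<Rightarrow> 'k) \<Rightarrow> bool"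
  where "lfn f \<longleftrightarrow> (\<forall>u v. f (u + v) = f u + f v) \<and> (\<forall>c v. f (smul c v) = c * f v)"

named_theorems lnr_intros

lemma lnr_add: "lnr f \<Longrightarrow> f (u + v) = f u + f v"
  and lnr_smul: "lnr f \<Longrightarrow> f (smul c v) = smul c (f v)"
  by (auto simp: lnr_def)

lemma lfn_add: "lfn f \<Longrightarrow> f (u + v) = f u + f v"
  and lfn_smul: "lfn f \<Longrightarrow> f (smul c v) = c * f v"
  by (auto simp: lfn_def)

lemma smul_0_left [simp]: "smul 0 v = 0"
  and smul_0_right [simp]: "smul c 0 = 0"
  and smul_1 [simp]: "smul 1 v = v"
  and smul_smul [simp]: "smul c (smul d v) = smul (c * d) v"
  by (auto intro!: poly_mapping_eqI)

lemma smul_single [simp]: "smul c (Poly_Mapping.single i d) = Poly_Mapping.single i (c * d)"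
  by (auto intro!: poly_mapping_eqI simp: lookup_single when_def)

text \<open>For additive index types, \<open>v + v\<close> is rewritten to \<open>2 * v\<close> with
  the convolution product of finitely supported functions; this rule lets coordinatewise comparison
  pass through such terms.\<close>

lemma lookup_double: "Poly_Mapping.lookup (2 * v) i = 2 * Poly_Mapping.lookup v i"
  for v :: "'a::monoid_add \<Rightarrow>\<^sub>0 'b::comm_ring_1"
  by (simp only: mult_2 lookup_add)

lemma lnr_0: "lnr f \<Longrightarrow> f 0 = 0"
  using lnr_smul[of f 0 0] by simp

lemma lfn_0: "lfn f \<Longrightarrow> f 0 = 0"
  using lfn_smul[of f 0 0] by simp

lemma lnr_sum: "lnr f \<Longrightarrow> f (\<Sum>a\<in>A. g a) = (\<Sum>a\<in>A. f (g a))"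
  by (induction A rule: infinite_finite_induct) (auto simp: lnr_add lnr_0)

lemma lfn_sum: "lfn f \<Longrightarrow> f (\<Sum>a\<in>A. g a) = (\<Sum>a\<in>A. f (g a))"
  by (induction A rule: infinite_finite_induct) (auto simp: lfn_add lfn_0)

lemma lnr_diff: "lnr f \<Longrightarrow> f (u - v) = f u - f v"
proof -
  assume f: "lnr f"
  have "u - v = u + smul (-1) v" for u v :: "'z \<Rightarrow>\<^sub>0 'k::field"
    by (auto intro!: poly_mapping_eqI simp: lookup_add lookup_minus)
  then show ?thesis using f by (metis lnr_add lnr_smul)
qed

lemma lnr_iff_linear: "lnr f \<longleftrightarrow> Vector_Spaces.linear smul smul f"
  by (auto simp: lnr_def Vector_Spaces.linear_def module_hom_def module_hom_axioms_def
      pm.vector_space_axioms pm.module_axioms)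

lemma lmap_iff: "lmap I J f \<longleftrightarrow> lnr f \<and> (\<forall>v\<in>vsp I. f v \<in> vsp J)"
  by (auto simp: lmap_def lnr_iff_linear)

lemma sum_expand:
  assumes "finite A" "Poly_Mapping.keys v \<subseteq> A"
  shows "v = (\<Sum>i\<in>A. smul (Poly_Mapping.lookup v i) (bv i))"
proof (rule poly_mapping_eqI)
  fix l
  have "Poly_Mapping.lookup (\<Sum>i\<in>A. smul (Poly_Mapping.lookup v i) (bv i)) l
      = (\<Sum>i\<in>A. if i = l then Poly_Mapping.lookup v i else 0)"
    by (auto simp: lookup_sum lookup_single when_def intro!: sum.cong)
  also have "\<dots> = Poly_Mapping.lookup v l"
    using assms by (auto simp: sum.delta' in_keys_iff subset_iff)
  finally show "Poly_Mapping.lookup v l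
      = Poly_Mapping.lookup (\<Sum>i\<in>A. smul (Poly_Mapping.lookup v i) (bv i)) l" ..
qed

lemma lin_superset:
  assumes "finite A" "Poly_Mapping.keys v \<subseteq> A"
  shows "lin f v = (\<Sum>i\<in>A. smul (Poly_Mapping.lookup v i) (f i))"
  unfolding lin_def
  by (rule sum.mono_neutral_left) (use assms in \<open>auto simp: in_keys_iff\<close>)

lemma lfun_superset:
  assumes "finite A" "Poly_Mapping.keys v \<subseteq> A"
  shows "lfun f v = (\<Sum>i\<in>A. Poly_Mapping.lookup v i * f i)"
  unfolding lfun_def
  by (rule sum.mono_neutral_left) (use assms in \<open>auto simp: in_keys_iff\<close>)

lemma keys_smul_subset: "Poly_Mapping.keys (smul c v) \<subseteq> Poly_Mapping.keys v"
  by (auto simp: in_keys_iff)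

lemma lnr_lin [lnr_intros]: "lnr (lin f)"
proof -
  have "lin f (u + v) = lin f u + lin f v" for u v
  proof -
    let ?A = "Poly_Mapping.keys u \<union> Poly_Mapping.keys v"
    have "lin f w = (\<Sum>i\<in>?A. smul (Poly_Mapping.lookup w i) (f i))"
      if "Poly_Mapping.keys w \<subseteq> ?A" for w
      by (rule lin_superset) (use that in auto)
    then show ?thesis
      using Poly_Mapping.keys_add[of u v]
      by (auto simp: lookup_add pm.scale_left_distrib sum.distrib)
  qed
  moreover have "lin f (smul c v) = smul c (lin f v)" for c v
    using lin_superset[of "Poly_Mapping.keys v" "smul c v" f] keys_smul_subset[of c v]
    by (simp add: lin_def pm.scale_sum_right)
  ultimately show ?thesis by (auto simp: lnr_def)
qed

lemma lfn_lfun [lnr_intros]: "lfn (lfun f)"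
proof -
  have "lfun f (u + v) = lfun f u + lfun f v" for u v
  proof -
    let ?A = "Poly_Mapping.keys u \<union> Poly_Mapping.keys v"
    have "lfun f w = (\<Sum>i\<in>?A. Poly_Mapping.lookup w i * f i)"
      if "Poly_Mapping.keys w \<subseteq> ?A" for w
      by (rule lfun_superset) (use that in auto)
    then show ?thesis
      using Poly_Mapping.keys_add[of u v]
      by (auto simp: lookup_add distrib_right sum.distrib)
  qed
  moreover have "lfun f (smul c v) = c * lfun f v" for c v
    using lfun_superset[of "Poly_Mapping.keys v" "smul c v" f] keys_smul_subset[of c v]
    by (simp add: lfun_def sum_distrib_left mult.assoc)
  ultimately show ?thesis by (auto simp: lfn_def)
qed

lemma lin_bv [simp]: "lin f (bv i) = f i"
  by (simp add: lin_def)

lemma lin_single: "lin f (Poly_Mapping.single i c) = smul c (f i)"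
  by (cases "c = 0") (auto simp: lin_def)

lemma lfun_bv [simp]: "lfun f (bv i) = f i"
  by (simp add: lfun_def)

lemma lnr_eq_lin:
  assumes "lnr f"
  shows "f v = lin (\<lambda>i. f (bv i)) v"
proof -
  have "f v = f (\<Sum>i\<in>Poly_Mapping.keys v. smul (Poly_Mapping.lookup v i) (bv i))"
    by (rule arg_cong[OF sum_expand]) auto
  also have "\<dots> = lin (\<lambda>i. f (bv i)) v"
    by (simp add: lin_def lnr_sum[OF assms] lnr_smul[OF assms] del: smul_single)
  finally show ?thesis .
qed

lemma lfn_eq_lfun:
  assumes "lfn f"
  shows "f v = lfun (\<lambda>i. f (bv i)) v"
proof -
  have "f v = f (\<Sum>i\<in>Poly_Mapping.keys v. smul (Poly_Mapping.lookup v i) (bv i))"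
    by (rule arg_cong[OF sum_expand]) auto
  also have "\<dots> = lfun (\<lambda>i. f (bv i)) v"
    by (simp add: lfun_def lfn_sum[OF assms] lfn_smul[OF assms] del: smul_single)
  finally show ?thesis .
qed

lemma lin_cong_vsp: "v \<in> vsp I \<Longrightarrow> (\<And>i. i \<in> I \<Longrightarrow> f i = g i) \<Longrightarrow> lin f v = lin g v"
  by (auto simp: lin_def vsp_def intro!: sum.cong)

lemma lnr_ext:
  assumes "lnr f" "lnr g" "v \<in> vsp I" "\<And>i. i \<in> I \<Longrightarrow> f (bv i) = g (bv i)"
  shows "f v = g v"
  using lnr_eq_lin[OF assms(1), of v] lnr_eq_lin[OF assms(2), of v]
    lin_cong_vsp[OF assms(3), of "\<lambda>i. f (bv i)" "\<lambda>i. g (bv i)"] assms(4) by simp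

lemma lin_bv_id: "lin bv v = v"
  using lnr_eq_lin[of "\<lambda>v. v" v] by (simp add: lnr_def)

subsection \<open>Closure properties\<close>

lemma vsp_subspace [simp]: "pm.subspace (vsp I)"
  unfolding pm.subspace_def vsp_def
  using Poly_Mapping.keys_add keys_smul_subset by fastforce

lemma vsp_intros [simp, intro]:
  "0 \<in> vsp I"
  "u \<in> vsp I \<Longrightarrow> v \<in> vsp I \<Longrightarrow> u + v \<in> vsp I"
  "u \<in> vsp I \<Longrightarrow> v \<in> vsp I \<Longrightarrow> u - v \<in> vsp I"
  "u \<in> vsp I \<Longrightarrow> smul c u \<in> vsp I"
  "i \<in> I \<Longrightarrow> Poly_Mapping.single i c \<in> vsp I"
  by (auto simp: pm.subspace_0 pm.subspace_add pm.subspace_diff pm.subspace_scale)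
    (auto simp: vsp_def)

lemma vsp_sum [simp, intro]: "(\<And>a. a \<in> A \<Longrightarrow> f a \<in> vsp I) \<Longrightarrow> (\<Sum>a\<in>A. f a) \<in> vsp I"
  by (rule pm.subspace_sum) auto

lemma vsp_UNIV [simp]: "vsp UNIV = UNIV"
  by (auto simp: vsp_def)

lemma lookup_vsp: "v \<in> vsp I \<Longrightarrow> i \<notin> I \<Longrightarrow> Poly_Mapping.lookup v i = 0"
  by (auto simp: vsp_def in_keys_iff)

lemma lin_closed: "v \<in> vsp I \<Longrightarrow> (\<And>i. i \<in> I \<Longrightarrow> f i \<in> vsp J) \<Longrightarrow> lin f v \<in> vsp J"
  by (auto simp: lin_def vsp_def[of I])

lemma lnr_closed: "lnr f \<Longrightarrow> v \<in> vsp I \<Longrightarrow> (\<And>i. i \<in> I \<Longrightarrow> f (bv i) \<in> vsp J) \<Longrightarrow> f v \<in> vsp J"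
  using lin_closed[of v I "\<lambda>i. f (bv i)" J] by (simp flip: lnr_eq_lin)

lemma span_closed:
  assumes "lnr f" "v \<in> pm.span B" "pm.subspace S" "\<And>b. b \<in> B \<Longrightarrow> f b \<in> S"
  shows "f v \<in> S"
  using assms(2)
  by (induction rule: pm.span_induct_alt)
    (use assms in \<open>auto simp: lnr_0 lnr_add lnr_smul pm.subspace_0 pm.subspace_add pm.subspace_scale\<close>)

subsection \<open>Tensor products and bilinear maps\<close>

lemma lookup_tens [simp]:
  "Poly_Mapping.lookup (tens u v) (i, j) = Poly_Mapping.lookup u i * Poly_Mapping.lookup v j"
proof -
  have "Poly_Mapping.lookup (tens u v) (i, j)
      = (\<Sum>a\<in>Poly_Mapping.keys u. \<Sum>b\<in>Poly_Mapping.keys v.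
          if b = j then (if a = i then Poly_Mapping.lookup u i * Poly_Mapping.lookup v j else 0) else 0)"
    unfolding tens_def
    by (auto simp: lookup_sum lookup_single when_def intro!: sum.cong)
  also have "\<dots> = Poly_Mapping.lookup u i * Poly_Mapping.lookup v j"
    by (cases "j \<in> Poly_Mapping.keys v"; cases "i \<in> Poly_Mapping.keys u") (auto simp: in_keys_iff)
  finally show ?thesis .
qed

lemma tens_eqI: "(\<And>i j. Poly_Mapping.lookup u (i, j) = Poly_Mapping.lookup v (i, j)) \<Longrightarrow> u = v"
  by (rule poly_mapping_eqI) (auto simp: split_paired_all)

lemma tens_add_left: "tens (u + u') v = tens u v + tens u' v"
  and tens_add_right: "tens u (v + v') = tens u v + tens u v'"
  and tens_smul_left [simp]: "tens (smul c u) v = smul c (tens u v)"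
  and tens_smul_right [simp]: "tens u (smul c v) = smul c (tens u v)"
  by (auto intro!: tens_eqI simp: lookup_add algebra_simps)

lemma tens_bv [simp]: "tens (bv i) (bv j) = bv (i, j)"
  by (auto intro!: tens_eqI simp: lookup_single when_def)

lemma lnr_tens1: "lnr (\<lambda>u. tens u v)" and lnr_tens2: "lnr (tens u)"
  by (auto simp: lnr_def tens_add_left tens_add_right)

lemma lnr_id [lnr_intros, simp]: "lnr (\<lambda>v. v)"
  by (simp add: lnr_def)

lemma lnr_id' [lnr_intros, simp]: "lnr id"
  by (simp add: lnr_def)

lemma lnr_comp: "lnr g \<Longrightarrow> lnr f \<Longrightarrow> lnr (\<lambda>v. g (f v))"
  by (simp add: lnr_def)

lemma lnr_intros1 [lnr_intros]:
  "lnr f \<Longrightarrow> lnr (\<lambda>v. lin h (f v))"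
  "lnr f \<Longrightarrow> lnr (\<lambda>v. tens (f v) w)"
  "lnr f' \<Longrightarrow> lnr (\<lambda>v. tens w' (f' v))"
  "lnr f \<Longrightarrow> lnr (\<lambda>v. smul c (f v))"
  "lfn g \<Longrightarrow> lnr (\<lambda>v. smul (g v) w)"
  "lnr f \<Longrightarrow> lnr f2 \<Longrightarrow> lnr (\<lambda>v. f v + f2 v)"
  "lnr f \<Longrightarrow> lnr f2 \<Longrightarrow> lnr (\<lambda>v. f v - f2 v)"
  "lnr (\<lambda>v. 0)"
  by (auto simp: lnr_def lnr_add[OF lnr_lin] lnr_smul[OF lnr_lin] tens_add_left tens_add_right
      pm.scale_right_distrib pm.scale_left_distrib lfn_def mult.commute pm.scale_right_diff_distrib)

lemma lnr_sum_fun [lnr_intros]: "(\<And>a. a \<in> A \<Longrightarrow> lnr (f a)) \<Longrightarrow> lnr (\<lambda>v. \<Sum>a\<in>A. f a v)"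
  by (simp add: lnr_def sum.distrib pm.scale_sum_right)

lemma lin_tens: "lin f (tens u v) = lin (\<lambda>i. lin (\<lambda>j. f (i, j)) v) u"
proof -
  have 1: "lnr (\<lambda>v. lin f (tens (bv i) v))" for i by (intro lnr_intros)
  have "lin f (tens (bv i) v) = lin (\<lambda>j. f (i, j)) v" for i
    using lnr_eq_lin[OF 1, of i v] by simp
  moreover have 2: "lnr (\<lambda>u. lin f (tens u v))" by (intro lnr_intros)
  ultimately show ?thesis using lnr_eq_lin[OF 2, of u] by simp
qed

text \<open>The structure maps in the definitions are linear extensions from pairs of basis vectors;
  this turns each of them into the expected formula on pure tensors.\<close>

lemma lin_bilinear:
  assumes "\<And>b. lnr (\<lambda>a. h a b)" "\<And>a. lnr (\<lambda>b. h a b)"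
  shows "lin (\<lambda>(i, j). h (bv i) (bv j)) (tens u v) = h u v"
proof -
  have "h u v = lin (\<lambda>i. h (bv i) v) u" by (rule lnr_eq_lin[OF assms(1)])
  also have "\<dots> = lin (\<lambda>i. lin (\<lambda>j. h (bv i) (bv j)) v) u"
    using lnr_eq_lin[OF assms(2), of _ v] by simp
  finally show ?thesis by (simp add: lin_tens)
qed

lemma lnr_tmap [lnr_intros]: "lnr f \<Longrightarrow> lnr (\<lambda>v. tmap g h (f v))"
  unfolding tmap_def by (intro lnr_intros)

lemma tmap_tens [simp]: "lnr f \<Longrightarrow> lnr g \<Longrightarrow> tmap f g (tens u v) = tens (f u) (g v)"
  unfolding tmap_def
  by (rule lin_bilinear[where h = "\<lambda>a b. tens (f a) (g b)"]) (auto intro!: lnr_intros)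

lemma lnr_reassoc [lnr_intros]: "lnr f \<Longrightarrow> lnr (\<lambda>v. reassoc (f v))"
  unfolding reassoc_def by (intro lnr_intros)

lemma reassoc_tens [simp]: "reassoc (tens (tens u v) w) = tens u (tens v w)"
proof -
  have "reassoc (tens (tens u v) w) = lin (\<lambda>i. lin (\<lambda>j. lin (\<lambda>l. bv (i, j, l)) w) v) u"
    by (simp add: reassoc_def lin_tens)
  also have "\<dots> = lin bv (tens u (tens v w))"
    by (simp add: lin_tens)
  finally show ?thesis by (simp add: lin_bv_id)
qed

lemma tens_closed [simp, intro]: "u \<in> vsp I \<Longrightarrow> v \<in> vsp J \<Longrightarrow> tens u v \<in> vsp (I \<times> J)"
  by (fastforce simp: vsp_def in_keys_iff)

lemma lnr_mul1 [lnr_intros]: "lnr f \<Longrightarrow> lnr (\<lambda>v. mul A (f v) b)"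
  and lnr_mul2 [lnr_intros]: "lnr f \<Longrightarrow> lnr (\<lambda>v. mul A a (f v))"
  unfolding mul_def by (intro lnr_intros; assumption)+

lemma mul_bv [simp]: "mul A (bv i) (bv j) = bmult A i j"
  by (simp add: mul_def)

lemma mul_linear:
  "mul A (a + a') b = mul A a b + mul A a' b"
  "mul A a (b + b') = mul A a b + mul A a b'"
  "mul A (smul c a) b = smul c (mul A a b)"
  "mul A a (smul c b) = smul c (mul A a b)"
  "mul A (a - a') b = mul A a b - mul A a' b"
  "mul A a (b - b') = mul A a b - mul A a b'"
  "mul A 0 b = 0" "mul A a 0 = 0"
  "mul A (\<Sum>t\<in>T. f t) b = (\<Sum>t\<in>T. mul A (f t) b)"
  "mul A a (\<Sum>t\<in>T. f t) = (\<Sum>t\<in>T. mul A a (f t))"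
  by (simp_all add: lnr_add[OF lnr_mul1[OF lnr_id, of A b]] lnr_add[OF lnr_mul2[OF lnr_id, of A a]] lnr_smul[OF lnr_mul1[OF lnr_id, of A b]] lnr_smul[OF lnr_mul2[OF lnr_id, of A a]] lnr_sum[OF lnr_mul1[OF lnr_id, of A b]] lnr_sum[OF lnr_mul2[OF lnr_id, of A a]] lnr_0[OF lnr_mul1[OF lnr_id, of A b]] lnr_0[OF lnr_mul2[OF lnr_id, of A a]] lnr_diff[OF lnr_mul1[OF lnr_id, of A b]] lnr_diff[OF lnr_mul2[OF lnr_id, of A a]])

lemma tens_linear:
  "tens (a + a') b = tens a b + tens a' b"
  "tens a (b + b') = tens a b + tens a b'"
  "tens (smul c a) b = smul c (tens a b)"
  "tens a (smul c b) = smul c (tens a b)"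
  "tens (a - a') b = tens a b - tens a' b"
  "tens a (b - b') = tens a b - tens a b'"
  "tens 0 b = 0" "tens a 0 = 0"
  "tens (\<Sum>t\<in>T. f t) b = (\<Sum>t\<in>T. tens (f t) b)"
  "tens a (\<Sum>t\<in>T. f t) = (\<Sum>t\<in>T. tens a (f t))"
  by (simp_all add: lnr_add[OF lnr_tens1[of b]] lnr_add[OF lnr_tens2[of a]] lnr_smul[OF lnr_tens1[of b]] lnr_smul[OF lnr_tens2[of a]] lnr_sum[OF lnr_tens1[of b]] lnr_sum[OF lnr_tens2[of a]] lnr_0[OF lnr_tens1[of b]] lnr_0[OF lnr_tens2[of a]] lnr_diff[OF lnr_tens1[of b]] lnr_diff[OF lnr_tens2[of a]])

lemma lnr_comult [lnr_intros]: "lnr f \<Longrightarrow> lnr (\<lambda>v. comult H (f v))"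
  unfolding comult_def by (intro lnr_intros)

lemma lnr_antipode [lnr_intros]: "lnr f \<Longrightarrow> lnr (\<lambda>v. antipode H (f v))"
  unfolding antipode_def by (intro lnr_intros)

lemma lnr_comult' [lnr_intros, simp]: "lnr (comult H)"
  and lnr_antipode' [lnr_intros, simp]: "lnr (antipode H)"
  unfolding comult_def antipode_def by (rule lnr_lin)+

lemma lfn_comp [lnr_intros]:
  "lnr f \<Longrightarrow> lfn (\<lambda>v. lfun h (f v))"
  "lnr f \<Longrightarrow> lfn (\<lambda>v. counit H (f v))"
  "lnr f \<Longrightarrow> lfn (\<lambda>v. pairing p (f v))"
  "lfn (counit H)"
  "lfn (pairing p)"
  "lfn g \<Longrightarrow> lfn (\<lambda>v. c * g v)"
  "lfn g \<Longrightarrow> lfn (\<lambda>v. g v * c)"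
  unfolding counit_def pairing_def
  using lfn_lfun[unfolded lfn_def] by (auto simp: lfn_def lnr_def algebra_simps)

lemma comult_bv [simp]: "comult H (bv i) = bcomult H i"
  and counit_bv [simp]: "counit H (bv i) = bcounit H i"
  and antipode_bv [simp]: "antipode H (bv i) = bantipode H i"
  by (simp_all add: comult_def counit_def antipode_def)

lemma counit_left_tens [simp]: "lin (\<lambda>(i, j). smul (bcounit H i) (bv j)) (tens u v) = smul (counit H u) v"
  using lin_bilinear[of "\<lambda>u v. smul (counit H u) v" u v] by (simp add: lnr_intros del: smul_single)

lemma counit_right_tens [simp]: "lin (\<lambda>(i, j). smul (bcounit H j) (bv i)) (tens u v) = smul (counit H v) u"
  using lin_bilinear[of "\<lambda>u v. smul (counit H v) u" u v] by (simp add: lnr_intros del: smul_single)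

lemma mul_tensor_alg [simp]:
  "mul (tensor_alg A B) (tens a b) (tens a' b') = tens (mul A a a') (mul B b b')"
proof -
  have "mul (tensor_alg A B) (tens a b) (tens a' b')
     = lin (\<lambda>(i, j). lin (\<lambda>(i', j'). tens (bmult A i i') (bmult B j j')) (tens a' b')) (tens a b)"
    by (simp add: mul_def lin_tens tensor_alg_def)
  also have "\<dots> = lin (\<lambda>(i, j). tens (mul A (bv i) a') (mul B (bv j) b')) (tens a b)"
  proof -
    have "lin (\<lambda>(i', j'). tens (bmult A i i') (bmult B j j')) (tens a' b')
        = tens (mul A (bv i) a') (mul B (bv j) b')" for i j
      using lin_bilinear[of "\<lambda>a' b'. tens (mul A (bv i) a') (mul B (bv j) b')" a' b']
      by (simp add: lnr_intros)
    then show ?thesis by simp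
  qed
  also have "\<dots> = tens (mul A a a') (mul B b b')"
    by (rule lin_bilinear[of "\<lambda>a b. tens (mul A a a') (mul B b b')"]) (intro lnr_intros)+
  finally show ?thesis .
qed

lemma antipode_left_tens [simp]:
  "lin (\<lambda>(i, j). mul H (antipode H (bv i)) (bv j)) (tens u v) = mul H (antipode H u) v"
  by (rule lin_bilinear[of "\<lambda>u v. mul H (antipode H u) v"]) (intro lnr_intros)+

lemma antipode_right_tens [simp]:
  "lin (\<lambda>(i, j). mul H (bv i) (antipode H (bv j))) (tens u v) = mul H u (antipode H v)"
  by (rule lin_bilinear[of "\<lambda>u v. mul H u (antipode H v)"]) (intro lnr_intros)+

subsection \<open>Pairings\<close>

lemma pairing_superset:
  assumes "finite A" "Poly_Mapping.keys p \<subseteq> A \<or> Poly_Mapping.keys a \<subseteq> A"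
  shows "pairing p a = (\<Sum>i\<in>A. Poly_Mapping.lookup p i * Poly_Mapping.lookup a i)"
proof -
  have "pairing p a = (\<Sum>i\<in>A \<union> Poly_Mapping.keys a. Poly_Mapping.lookup a i * Poly_Mapping.lookup p i)"
    unfolding pairing_def by (rule lfun_superset) (use assms in auto)
  also have "\<dots> = (\<Sum>i\<in>A. Poly_Mapping.lookup a i * Poly_Mapping.lookup p i)"
    by (rule sum.mono_neutral_right) (use assms in \<open>auto simp: in_keys_iff\<close>)
  finally show ?thesis by (simp add: mult.commute)
qed

lemma pairing_commute: "pairing p a = pairing a p"
  using pairing_superset[of "Poly_Mapping.keys p" p a] pairing_superset[of "Poly_Mapping.keys p" a p]
  by (simp add: mult.commute)

lemma pairing_bv [simp]: "pairing p (bv i) = Poly_Mapping.lookup p i"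
  and pairing_bv' [simp]: "pairing (bv i) p = Poly_Mapping.lookup p i"
  by (simp_all add: pairing_commute[of "bv i"]) (simp_all add: pairing_def)

lemma lfn_pairing_left [lnr_intros]: "lnr f \<Longrightarrow> lfn (\<lambda>v. pairing (f v) p)"
  by (subst pairing_commute) (intro lnr_intros)

lemma pairing_linear:
  "pairing p (a + a') = pairing p a + pairing p a'"
  "pairing p (smul c a) = c * pairing p a"
  "pairing p 0 = 0"
  "pairing p (\<Sum>t\<in>T. g t) = (\<Sum>t\<in>T. pairing p (g t))"
  "pairing (p + p') a = pairing p a + pairing p' a"
  "pairing (smul c p) a = c * pairing p a"
  "pairing 0 a = 0"
  "pairing (\<Sum>t\<in>T. q t) a = (\<Sum>t\<in>T. pairing (q t) a)"
  by (simp_all add: lfn_add[OF lfn_comp(5)[of p]] lfn_add[OF lfn_pairing_left[OF lnr_id, of a]] lfn_smul[OF lfn_comp(5)[of p]] lfn_smul[OF lfn_pairing_left[OF lnr_id, of a]] lfn_0[OF lfn_comp(5)[of p]] lfn_0[OF lfn_pairing_left[OF lnr_id, of a]] lfn_sum[OF lfn_comp(5)[of p]] lfn_sum[OF lfn_pairing_left[OF lnr_id, of a]])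

lemma lfn_bilinear_eq:
  assumes "\<And>b. lfn (\<lambda>a. h a b)" "\<And>a. lfn (\<lambda>b. h a b)" "\<And>b. lfn (\<lambda>a. h' a b)" "\<And>a. lfn (\<lambda>b. h' a b)"
    and "\<And>i j. h (bv i) (bv j) = h' (bv i) (bv j)"
  shows "h u v = h' u v"
proof -
  have "h (bv i) v = h' (bv i) v" for i
    using lfn_eq_lfun[OF assms(2), of "bv i" v] lfn_eq_lfun[OF assms(4), of "bv i" v] assms(5) by simp
  then show ?thesis
    using lfn_eq_lfun[OF assms(1), of u v] lfn_eq_lfun[OF assms(3), of u v] by simp
qed

lemma pairing_tens [simp]: "pairing (tens p q) (tens a b) = pairing p a * pairing q b"
proof (rule lfn_bilinear_eq[of "\<lambda>a b. pairing (tens p q) (tens a b)" "\<lambda>a b. pairing p a * pairing q b"])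
qed (auto intro!: lnr_intros)

lemma pairing_eqI:
  assumes "p \<in> vsp I" "q \<in> vsp I" "\<And>i. i \<in> I \<Longrightarrow> pairing p (bv i) = pairing q (bv i)"
  shows "p = q"
  by (rule poly_mapping_eqI) (use assms in \<open>metis pairing_bv lookup_vsp\<close>)

lemma lookup_sum_single:
  "finite A \<Longrightarrow> Poly_Mapping.lookup (\<Sum>i\<in>A. Poly_Mapping.single i (c i)) j = (if j \<in> A then c j else 0)"
  by (simp add: lookup_sum lookup_single when_def sum.delta cong: if_cong)

text \<open>A functional is stored as the vector of its values on basis vectors. Coordinate formulas
  of that kind, such as those in \<open>dual\<close> and \<open>coad\<close>, are evaluated by this
  rule.\<close>

lemma pairing_sum_single:
  assumes "finite A" "a \<in> vsp A" "lfn c"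
  shows "pairing (\<Sum>i\<in>A. Poly_Mapping.single i (c (bv i))) a = c a"
proof -
  have "pairing (\<Sum>i\<in>A. Poly_Mapping.single i (c (bv i))) a = (\<Sum>i\<in>A. c (bv i) * Poly_Mapping.lookup a i)"
    using assms(1) by (subst pairing_superset[of A]) (use assms in \<open>auto simp: lookup_sum_single vsp_def\<close>)
  also have "\<dots> = c a"
    using assms(1,2) lfn_eq_lfun[OF assms(3), of a]
    by (subst (asm) lfun_superset[of A]) (auto simp: vsp_def mult.commute)
  finally show ?thesis .
qed

section \<open>Dual bases\<close>

text \<open>A basis \<open>b\<close> of \<open>k[I]\<close> together with its dual basis
  \<open>f\<close>, both as coordinate vectors. The index set \<open>T\<close> need not be
  \<open>I\<close>: the convenient bases of \<open>H\<close> and of its double are unrelated to the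
  given basis vectors.\<close>

definition dframe :: "'i set \<Rightarrow> 't set \<Rightarrow> ('t \<Rightarrow> ('i \<Rightarrow>\<^sub>0 'k::field)) \<Rightarrow> ('t \<Rightarrow> ('i \<Rightarrow>\<^sub>0 'k)) \<Rightarrow> bool"
  where "dframe I T b f \<longleftrightarrow> finite I \<and> finite T \<and> (\<forall>t\<in>T. b t \<in> vsp I) \<and> (\<forall>t\<in>T. f t \<in> vsp I) \<and>
    (\<forall>s\<in>T. \<forall>t\<in>T. pairing (f s) (b t) = (if s = t then 1 else 0)) \<and>
    (\<forall>v\<in>vsp I. v = (\<Sum>t\<in>T. smul (pairing (f t) v) (b t)))"

lemma dframeD:
  assumes "dframe I T b f"
  shows "finite I" "finite T" "t \<in> T \<Longrightarrow> b t \<in> vsp I" "t \<in> T \<Longrightarrow> f t \<in> vsp I"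
    "s \<in> T \<Longrightarrow> t \<in> T \<Longrightarrow> pairing (f s) (b t) = (if s = t then 1 else 0)"
    "v \<in> vsp I \<Longrightarrow> (\<Sum>t\<in>T. smul (pairing (f t) v) (b t)) = v"
  using assms unfolding dframe_def by auto

text \<open>Evaluating \<open>p\<close> on the expansion of \<open>bv i\<close> in the family
  \<open>b\<close> yields the coordinates of \<open>p\<close> in the family
  \<open>f\<close>.\<close>

lemma dframe_sym:
  assumes d: "dframe I T b f"
  shows "dframe I T f b"
  unfolding dframe_def
proof (intro conjI ballI)
  fix p :: "'a \<Rightarrow>\<^sub>0 'c" assume p: "p \<in> vsp I"
  show "p = (\<Sum>t\<in>T. smul (pairing (b t) p) (f t))"
  proof (rule pairing_eqI[OF p])
    show "(\<Sum>t\<in>T. smul (pairing (b t) p) (f t)) \<in> vsp I"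
      using dframeD(4)[OF d] by auto
    fix i assume "i \<in> I"
    then have "bv i = (\<Sum>t\<in>T. smul (pairing (f t) (bv i)) (b t))"
      using dframeD(6)[OF d, of "bv i"] by simp
    then have "pairing p (bv i) = pairing p (\<Sum>t\<in>T. smul (pairing (f t) (bv i)) (b t))"
      by (rule arg_cong)
    also have "\<dots> = pairing (\<Sum>t\<in>T. smul (pairing (b t) p) (f t)) (bv i)"
      by (simp add: pairing_linear pairing_commute[of p] mult.commute lookup_sum)
    finally show "pairing p (bv i) = pairing (\<Sum>t\<in>T. smul (pairing (b t) p) (f t)) (bv i)" .
  qed
qed (use dframeD[OF d] in \<open>auto simp: pairing_commute[of "b _"]\<close>)

lemma dframe_ext:
  assumes "dframe I T b f" "lnr \<phi>" "lnr \<psi>" "\<And>t. t \<in> T \<Longrightarrow> \<phi> (b t) = \<psi> (b t)" "v \<in> vsp I"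
  shows "\<phi> v = \<psi> v"
proof -
  have v: "v = (\<Sum>t\<in>T. smul (pairing (f t) v) (b t))" using dframeD(6)[OF assms(1,5)] by simp
  show ?thesis
    by (subst v, subst (2) v) (simp add: lnr_sum lnr_smul assms)
qed

lemma dframe_fn_ext:
  assumes "dframe I T b f" "lfn \<phi>" "lfn \<psi>" "\<And>t. t \<in> T \<Longrightarrow> \<phi> (b t) = \<psi> (b t)" "v \<in> vsp I"
  shows "\<phi> v = \<psi> v"
proof -
  have v: "v = (\<Sum>t\<in>T. smul (pairing (f t) v) (b t))" using dframeD(6)[OF assms(1,5)] by simp
  show ?thesis
    by (subst v, subst (2) v) (simp add: lfn_sum lfn_smul assms)
qed

lemma dframe_closed:
  assumes "dframe I T b f" "lnr \<phi>" "pm.subspace S" "\<And>t. t \<in> T \<Longrightarrow> \<phi> (b t) \<in> S" "v \<in> vsp I"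
  shows "\<phi> v \<in> S"
proof -
  have v: "v = (\<Sum>t\<in>T. smul (pairing (f t) v) (b t))" using dframeD(6)[OF assms(1,5)] by simp
  show ?thesis
    by (subst v) (auto simp: lnr_sum lnr_smul assms intro!: pm.subspace_sum pm.subspace_scale)
qed

lemma dframe_pairing_ext:
  assumes "dframe I T b f" "u \<in> vsp I" "v \<in> vsp I" "\<And>t. t \<in> T \<Longrightarrow> pairing (f t) u = pairing (f t) v"
  shows "u = v"
proof -
  have "u = (\<Sum>t\<in>T. smul (pairing (f t) u) (b t))" using dframeD(6)[OF assms(1,2)] ..
  also have "\<dots> = (\<Sum>t\<in>T. smul (pairing (f t) v) (b t))"
    by (intro sum.cong) (simp_all add: assms(4))
  also have "\<dots> = v" by (rule dframeD(6)[OF assms(1,3)])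
  finally show ?thesis .
qed

lemma dframe_pairing_ext':
  assumes "dframe I T b f" "u \<in> vsp I" "v \<in> vsp I" "\<And>t. t \<in> T \<Longrightarrow> pairing u (b t) = pairing v (b t)"
  shows "u = v"
  by (rule dframe_pairing_ext[OF dframe_sym[OF assms(1)] assms(2,3)])
    (metis assms(4) pairing_commute)

lemma dframe_span:
  assumes "dframe I T b f"
  shows "pm.span (b ` T) = vsp I"
proof
  show "pm.span (b ` T) \<subseteq> vsp I"
    by (rule pm.span_minimal) (use dframeD[OF assms] in auto)
  show "vsp I \<subseteq> pm.span (b ` T)"
    using dframe_closed[OF assms lnr_id, of "pm.span (b ` T)"]
    by (auto intro: pm.span_base)
qed

lemma dframe_bv: "finite I \<Longrightarrow> dframe I I bv bv"
  unfolding dframe_def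
  by (auto simp: lookup_single when_def vsp_def simp del: smul_single intro!: sum_expand)

lemma dframe_tens:
  assumes d: "dframe I T b f" and e: "dframe J U c g"
  shows "dframe (I \<times> J) (T \<times> U) (\<lambda>(t, u). tens (b t) (c u)) (\<lambda>(t, u). tens (f t) (g u))"
  unfolding dframe_def
proof (intro conjI ballI)
  fix v :: "'a \<times> 'd \<Rightarrow>\<^sub>0 'c" assume v: "v \<in> vsp (I \<times> J)"
  let ?s = "\<lambda>v. \<Sum>t\<in>T \<times> U. smul (pairing (case t of (t, u) \<Rightarrow> tens (f t) (g u)) v)
      (case t of (t, u) \<Rightarrow> tens (b t) (c u))"
  show "v = ?s v"
  proof (rule lnr_ext[OF lnr_id _ v])
    show "lnr ?s" by (intro lnr_intros)
    fix ij assume "ij \<in> I \<times> J"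
    then obtain i j where ij: "ij = (i, j)" "i \<in> I" "j \<in> J" by auto
    have "?s (bv ij) = tens (\<Sum>t\<in>T. smul (pairing (f t) (bv i)) (b t)) (\<Sum>t\<in>U. smul (pairing (g t) (bv j)) (c t))"
      unfolding ij(1) tens_bv[symmetric] tens_linear(9) unfolding tens_linear(10) sum.cartesian_product
      by (intro sum.cong) (auto simp: mult.commute simp del: tens_bv)
    also have "\<dots> = bv ij" using dframeD(6)[OF d, of "bv i"] dframeD(6)[OF e, of "bv j"] ij by simp
    finally show "bv ij = ?s (bv ij)" ..
  qed
qed (use dframeD[OF d] dframeD[OF e] in \<open>auto split: if_splits\<close>)

text \<open>The coordinate functionals of a basis, stored through their values on the
  \<open>bv i\<close>, form the dual family.\<close>

lemma dframe_ex_indep: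
  assumes fin: "finite I" "finite T" and b: "\<And>t. t \<in> T \<Longrightarrow> b t \<in> vsp I"
    and sp: "vsp I \<subseteq> pm.span (b ` T)"
    and ind: "\<And>c. (\<Sum>t\<in>T. smul (c t) (b t)) = 0 \<Longrightarrow> \<forall>t\<in>T. c t = 0"
  shows "\<exists>f. dframe I T b f"
proof -
  have inj: "inj_on b T"
  proof (rule inj_onI, rule ccontr)
    fix s t assume st: "s \<in> T" "t \<in> T" "b s = b t" "s \<noteq> t"
    let ?c = "\<lambda>u. if u = s then 1 else if u = t then -1 else 0"
    have "(\<Sum>u\<in>T. smul (?c u) (b u)) = (\<Sum>u\<in>{s, t}. smul (?c u) (b u))"
      by (rule sum.mono_neutral_right) (use st fin in auto)
    also have "\<dots> = 0" using st by (auto intro!: poly_mapping_eqI simp: lookup_add)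
    finally show False using ind[of ?c] st by auto
  qed
  have "\<exists>c. v = (\<Sum>t\<in>T. smul (c t) (b t))" if "v \<in> vsp I" for v
  proof -
    have "v \<in> range (\<lambda>u. \<Sum>x\<in>b ` T. smul (u x) x)"
      using that sp pm.span_finite[of "b ` T"] fin by auto
    then obtain u where "v = (\<Sum>x\<in>b ` T. smul (u x) x)" by (rule rangeE)
    then have "v = (\<Sum>t\<in>T. smul (u (b t)) (b t))" by (simp add: sum.reindex[OF inj])
    then show ?thesis by (intro exI[of _ "\<lambda>t. u (b t)"])
  qed
  then obtain c where c: "\<And>v. v \<in> vsp I \<Longrightarrow> v = (\<Sum>t\<in>T. smul (c v t) (b t))" by metis
  define f where "f t = (\<Sum>i\<in>I. Poly_Mapping.single i (c (bv i) t))" for t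
  have ex: "v = (\<Sum>t\<in>T. smul (pairing (f t) v) (b t))" if "v \<in> vsp I" for v
  proof (rule lnr_ext[OF lnr_id _ that])
    show "lnr (\<lambda>v. \<Sum>t\<in>T. smul (pairing (f t) v) (b t))" by (intro lnr_intros)
    fix i assume i: "i \<in> I"
    have "(\<Sum>t\<in>T. smul (pairing (f t) (bv i)) (b t)) = (\<Sum>t\<in>T. smul (c (bv i) t) (b t))"
      using i fin by (simp add: f_def lookup_sum_single)
    also have "\<dots> = bv i" using c[of "bv i"] i by simp
    finally show "bv i = (\<Sum>t\<in>T. smul (pairing (f t) (bv i)) (b t))" ..
  qed
  have "pairing (f s) (b t) = (if s = t then 1 else 0)" if st: "s \<in> T" "t \<in> T" for s t
  proof -
    have "(\<Sum>s\<in>T. smul (if s = t then 1 else 0) (b s)) = (\<Sum>s\<in>T. if s = t then b s else 0)"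
      by (rule sum.cong) auto
    also have "\<dots> = b t" using st fin by simp
    finally have "(\<Sum>s\<in>T. smul (pairing (f s) (b t) - (if s = t then 1 else 0)) (b s)) = 0"
      using ex[OF b[OF st(2)]] by (simp add: pm.scale_left_diff_distrib sum_subtractf)
    from ind[OF this] st(1) show ?thesis by auto
  qed
  moreover have "f t \<in> vsp I" for t by (auto simp: f_def)
  ultimately show ?thesis using fin b ex unfolding dframe_def by blast
qed

lemma dframe_indep:
  assumes "dframe I T b f" "(\<Sum>t\<in>T. smul (c t) (b t)) = 0" "t \<in> T"
  shows "c t = 0"
proof -
  have "0 = pairing (f t) (\<Sum>s\<in>T. smul (c s) (b s))" using assms(2) by (simp add: pairing_linear)
  also have "\<dots> = (\<Sum>s\<in>T. if s = t then c s else 0)"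
    unfolding pairing_linear by (rule sum.cong) (use dframeD(5)[OF assms(1,3)] in auto)
  also have "\<dots> = c t" using assms(3) dframeD(2)[OF assms(1)] by simp
  finally show ?thesis by simp
qed

lemma dframe_independent:
  assumes d: "dframe I T b f"
  shows "pm.independent (b ` T)" "inj_on b T"
proof -
  show inj: "inj_on b T"
  proof (rule inj_onI)
    fix s t assume "s \<in> T" "t \<in> T" "b s = b t"
    then show "s = t" using dframeD(5)[OF d, of s s] dframeD(5)[OF d, of s t] by (auto split: if_splits)
  qed
  show "pm.independent (b ` T)"
  proof (rule pm.independent_if_scalars_zero)
    show "finite (b ` T)" using dframeD(2)[OF d] by simp
    fix u x assume "(\<Sum>x\<in>b ` T. smul (u x) x) = 0" "x \<in> b ` T"
    then show "u x = 0" using dframe_indep[OF d, of "\<lambda>t. u (b t)"] by (auto simp: sum.reindex[OF inj])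
  qed
qed

text \<open>A dimension count: for a spanning family of the right size independence is automatic.
  For the 64 matrix coefficients and the 64 comatrix units of the double it is thus enough to write
  a known basis in terms of them.\<close>

lemma dframe_ex_card:
  assumes d: "dframe I T b f" and fin: "finite T'" and card: "card T' = card T"
    and b': "\<And>t. t \<in> T' \<Longrightarrow> b' t \<in> vsp I" and sp: "\<And>t. t \<in> T \<Longrightarrow> b t \<in> pm.span (b' ` T')"
  shows "\<exists>f'. dframe I T' b' f'"
proof (rule dframe_ex_indep[OF dframeD(1)[OF d] fin b'])
  show sp': "vsp I \<subseteq> pm.span (b' ` T')"
    unfolding dframe_span[OF d, symmetric] by (rule pm.span_minimal) (use sp in auto)
  have "pm.span (b' ` T') \<subseteq> vsp I" by (rule pm.span_minimal) (use b' in auto)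
  with sp' have eq: "pm.span (b' ` T') = pm.span (b ` T)" using dframe_span[OF d] by auto
  obtain B where B: "B \<subseteq> b' ` T'" "pm.independent B" "pm.span B = pm.span (b' ` T')"
  proof (rule pm.maximal_independent_subset[of "b' ` T'"])
    fix B assume B: "B \<subseteq> b' ` T'" "pm.independent B" "b' ` T' \<subseteq> pm.span B"
    then have "pm.span B = pm.span (b' ` T')"
      using pm.span_superset[of "b' ` T'"] by (auto simp: pm.span_eq)
    with B(1,2) show thesis by (rule that)
  qed
  have "card B = card (b ` T)"
    using pm.dim_span_eq_card_independent[OF B(2)] B(3) eq
      pm.dim_span_eq_card_independent[OF dframe_independent(1)[OF d]] by simp
  also have "\<dots> = card T'" using card dframe_independent(2)[OF d] by (simp add: card_image)
  finally have cB: "card B = card T'" .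
  have cim: "card (b' ` T') = card T'"
    using card_mono[OF _ B(1)] card_image_le[OF fin, of b'] fin cB by simp
  then have inj: "inj_on b' T'" by (rule eq_card_imp_inj_on[OF fin])
  have "B = b' ` T'" by (rule card_subset_eq) (use B(1) cim cB fin in auto)
  then have ind: "pm.independent (b' ` T')" using B by simp
  fix c assume c: "(\<Sum>t\<in>T'. smul (c t) (b' t)) = 0"
  show "\<forall>t\<in>T'. c t = 0"
  proof
    fix t assume t: "t \<in> T'"
    have "(\<Sum>x\<in>b' ` T'. smul (c (the_inv_into T' b' x)) x) = 0"
      using c by (simp add: sum.reindex[OF inj] the_inv_into_f_f[OF inj])
    from pm.independentD[OF ind _ _ this, of "b' t"] t fin
    show "c t = 0" by (simp add: the_inv_into_f_f[OF inj])
  qed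
qed

lemma dframe_card:
  assumes "dframe I T b f"
  shows "card T = card I"
proof -
  have *: "card U = pm.dim (vsp I :: ('a \<Rightarrow>\<^sub>0 'c) set)"
    if d: "dframe I U c g" for U and c :: "'b \<Rightarrow> 'a \<Rightarrow>\<^sub>0 'c" and g
  proof -
    have "card U = card (c ` U)" using dframe_independent(2)[OF d] by (simp add: card_image)
    also have "\<dots> = pm.dim (pm.span (c ` U))"
      using pm.dim_span_eq_card_independent[OF dframe_independent(1)[OF d]] by simp
    finally show ?thesis by (simp add: dframe_span[OF d])
  qed
  have "card I = pm.dim (vsp I :: ('a \<Rightarrow>\<^sub>0 'c) set)"
  proof -
    have d: "dframe I I (bv :: 'a \<Rightarrow> 'a \<Rightarrow>\<^sub>0 'c) bv" by (rule dframe_bv[OF dframeD(1)[OF assms]])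
    have "card I = card ((bv :: 'a \<Rightarrow> 'a \<Rightarrow>\<^sub>0 'c) ` I)" using dframe_independent(2)[OF d] by (simp add: card_image)
    also have "\<dots> = pm.dim (pm.span ((bv :: 'a \<Rightarrow> 'a \<Rightarrow>\<^sub>0 'c) ` I))"
      using pm.dim_span_eq_card_independent[OF dframe_independent(1)[OF d]] by simp
    finally show ?thesis by (simp add: dframe_span[OF d])
  qed
  with *[OF assms] show ?thesis by simp
qed

section \<open>Modules over systems of matrix units\<close>

text \<open>Labels of matrix units: a block with a row and a column of it.\<close>

definition mix :: "'l set \<Rightarrow> ('l \<Rightarrow> 'r set) \<Rightarrow> ('l \<times> 'r \<times> 'r) set"
  where "mix \<Lambda> R = Sigma \<Lambda> (\<lambda>l. R l \<times> R l)"

lemma mem_mix [simp]: "(l, r, s) \<in> mix \<Lambda> R \<longleftrightarrow> l \<in> \<Lambda> \<and> r \<in> R l \<and> s \<in> R l"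
  by (auto simp: mix_def)

lemma sum_mix:
  assumes "finite \<Lambda>" "\<And>l. l \<in> \<Lambda> \<Longrightarrow> finite (R l)"
  shows "(\<Sum>t\<in>mix \<Lambda> R. g t) = (\<Sum>l\<in>\<Lambda>. \<Sum>r\<in>R l. \<Sum>s\<in>R l. g (l, r, s))"
proof -
  have "(\<Sum>l\<in>\<Lambda>. \<Sum>r\<in>R l. \<Sum>s\<in>R l. g (l, r, s)) = (\<Sum>l\<in>\<Lambda>. \<Sum>p\<in>R l \<times> R l. g (l, p))"
    by (simp add: sum.cartesian_product split_def)
  also have "\<dots> = (\<Sum>t\<in>mix \<Lambda> R. g t)"
    unfolding mix_def using assms by (subst sum.Sigma) (auto simp: split_def)
  finally show ?thesis ..
qed

text \<open>A module over a product of matrix algebras, presented by the operators of the matrix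
  units. Modules over an algebra and comodules over a coalgebra both reduce to this form, so
  irreducibility, isomorphism and counting are treated only once.\<close>

definition mu_rep :: "'l set \<Rightarrow> ('l \<Rightarrow> 'r set) \<Rightarrow> nat \<Rightarrow>
    ('l \<times> 'r \<times> 'r \<Rightarrow> (nat \<Rightarrow>\<^sub>0 'k::field) \<Rightarrow> (nat \<Rightarrow>\<^sub>0 'k)) \<Rightarrow> bool"
  where "mu_rep \<Lambda> R n T \<longleftrightarrow>
    (\<forall>t\<in>mix \<Lambda> R. lmap {..<n} {..<n} (T t)) \<and>
    (\<forall>l r s l' r' s' v. (l, r, s) \<in> mix \<Lambda> R \<longrightarrow> (l', r', s') \<in> mix \<Lambda> R \<longrightarrow> v \<in> vsp {..<n} \<longrightarrow>
       T (l, r, s) (T (l', r', s') v) = (if l = l' \<and> s = r' then T (l, r, s') v else 0)) \<and>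
    (\<forall>v\<in>vsp {..<n}. (\<Sum>l\<in>\<Lambda>. \<Sum>r\<in>R l. T (l, r, r) v) = v)"

definition mu_irr :: "'l set \<Rightarrow> ('l \<Rightarrow> 'r set) \<Rightarrow> nat \<Rightarrow>
    ('l \<times> 'r \<times> 'r \<Rightarrow> (nat \<Rightarrow>\<^sub>0 'k::field) \<Rightarrow> (nat \<Rightarrow>\<^sub>0 'k)) \<Rightarrow> bool"
  where "mu_irr \<Lambda> R n T \<longleftrightarrow> mu_rep \<Lambda> R n T \<and> n > 0 \<and>
    (\<forall>W. pm.subspace W \<and> W \<subseteq> vsp {..<n} \<and> (\<forall>t\<in>mix \<Lambda> R. \<forall>w\<in>W. T t w \<in> W)
       \<longrightarrow> W = {0} \<or> W = vsp {..<n})"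

definition mu_iso :: "'l set \<Rightarrow> ('l \<Rightarrow> 'r set) \<Rightarrow> nat \<Rightarrow>
    ('l \<times> 'r \<times> 'r \<Rightarrow> (nat \<Rightarrow>\<^sub>0 'k::field) \<Rightarrow> (nat \<Rightarrow>\<^sub>0 'k)) \<Rightarrow>
    ('l \<times> 'r \<times> 'r \<Rightarrow> (nat \<Rightarrow>\<^sub>0 'k) \<Rightarrow> (nat \<Rightarrow>\<^sub>0 'k)) \<Rightarrow> bool"
  where "mu_iso \<Lambda> R n T T' \<longleftrightarrow>
    (\<exists>\<phi>. lmap {..<n} {..<n} \<phi> \<and> bij_betw \<phi> (vsp {..<n}) (vsp {..<n}) \<and>
      (\<forall>t\<in>mix \<Lambda> R. \<forall>v\<in>vsp {..<n}. \<phi> (T t v) = T' t (\<phi> v)))"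

lemma mu_repD:
  assumes "mu_rep \<Lambda> R n T"
  shows "t \<in> mix \<Lambda> R \<Longrightarrow> lnr (T t)"
    "t \<in> mix \<Lambda> R \<Longrightarrow> v \<in> vsp {..<n} \<Longrightarrow> T t v \<in> vsp {..<n}"
    "(l, r, s) \<in> mix \<Lambda> R \<Longrightarrow> (l', r', s') \<in> mix \<Lambda> R \<Longrightarrow> v \<in> vsp {..<n} \<Longrightarrow>
       T (l, r, s) (T (l', r', s') v) = (if l = l' \<and> s = r' then T (l, r, s') v else 0)"
    "v \<in> vsp {..<n} \<Longrightarrow> (\<Sum>l\<in>\<Lambda>. \<Sum>r\<in>R l. T (l, r, r) v) = v"
  using assms unfolding mu_rep_def lmap_iff by blast+

lemma lmap_inverse:
  assumes \<phi>: "lmap I J \<phi>" "bij_betw \<phi> (vsp I) (vsp J)"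
  obtains \<psi> where "lmap J I \<psi>" "bij_betw \<psi> (vsp J) (vsp I)"
    "\<And>v. v \<in> vsp I \<Longrightarrow> \<psi> (\<phi> v) = v" "\<And>v. v \<in> vsp J \<Longrightarrow> \<phi> (\<psi> v) = v"
proof -
  have l: "lnr \<phi>" and c: "\<And>v. v \<in> vsp I \<Longrightarrow> \<phi> v \<in> vsp J" using \<phi> by (auto simp: lmap_iff)
  \<comment> \<open>The set-theoretic inverse is controlled only on \<open>vsp J\<close>; extending
    its values on basis vectors gives a map that is linear everywhere.\<close>
  let ?g = "inv_into (vsp I) \<phi>"
  let ?\<psi> = "lin (\<lambda>j. ?g (bv j))"
  have g: "?g v \<in> vsp I" "\<phi> (?g v) = v" if "v \<in> vsp J" for v
    using that \<phi>(2) by (auto simp: bij_betw_def inv_into_into f_inv_into_f)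
  have cl: "?\<psi> v \<in> vsp I" if "v \<in> vsp J" for v by (rule lin_closed[OF that]) (simp add: g)
  have 1: "\<phi> (?\<psi> v) = v" if "v \<in> vsp J" for v
    by (rule lnr_ext[OF _ lnr_id that]) (auto intro!: lnr_comp[OF l] lnr_intros simp: g)
  have 2: "?\<psi> (\<phi> v) = v" if "v \<in> vsp I" for v
    using \<phi>(2) 1[OF c[OF that]] cl[OF c[OF that]] that by (auto simp: bij_betw_def inj_on_def)
  have "bij_betw ?\<psi> (vsp J) (vsp I)"
    by (rule bij_betw_byWitness[of _ \<phi>]) (use 1 2 c cl in auto)
  moreover have "lmap J I ?\<psi>" using cl by (auto simp: lmap_iff intro: lnr_intros)
  ultimately show thesis using that 1 2 by blast
qed

lemma mu_iso_refl_on: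
  assumes "\<And>t v. t \<in> mix \<Lambda> R \<Longrightarrow> v \<in> vsp {..<n} \<Longrightarrow> T t v = T' t v"
  shows "mu_iso \<Lambda> R n T T'"
  unfolding mu_iso_def using assms
  by (intro exI[of _ id]) (auto simp: lmap_iff)

lemma mu_iso_sym:
  assumes T: "\<And>t v. t \<in> mix \<Lambda> R \<Longrightarrow> v \<in> vsp {..<n} \<Longrightarrow> T t v \<in> vsp {..<n}"
    and i: "mu_iso \<Lambda> R n T T'"
  shows "mu_iso \<Lambda> R n T' T"
proof -
  obtain \<phi> where \<phi>: "lmap {..<n} {..<n} \<phi>" "bij_betw \<phi> (vsp {..<n}) (vsp {..<n})"
    "\<And>t v. t \<in> mix \<Lambda> R \<Longrightarrow> v \<in> vsp {..<n} \<Longrightarrow> \<phi> (T t v) = T' t (\<phi> v)"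
    using i unfolding mu_iso_def by blast
  obtain \<psi> where \<psi>: "lmap {..<n} {..<n} \<psi>" "bij_betw \<psi> (vsp {..<n}) (vsp {..<n})"
    "\<And>v. v \<in> vsp {..<n} \<Longrightarrow> \<psi> (\<phi> v) = v" "\<And>v. v \<in> vsp {..<n} \<Longrightarrow> \<phi> (\<psi> v) = v"
    using lmap_inverse[OF \<phi>(1,2)] by blast
  have "\<psi> (T' t v) = T t (\<psi> v)" if "t \<in> mix \<Lambda> R" "v \<in> vsp {..<n}" for t v
  proof -
    have p: "\<psi> v \<in> vsp {..<n}" using \<psi>(1) that by (auto simp: lmap_iff)
    have "\<psi> (T' t v) = \<psi> (T' t (\<phi> (\<psi> v)))" using \<psi>(4) that by simp
    also have "\<dots> = \<psi> (\<phi> (T t (\<psi> v)))" using \<phi>(3) that p by simp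
    also have "\<dots> = T t (\<psi> v)" using \<psi>(3) T that p by simp
    finally show ?thesis .
  qed
  with \<psi>(1,2) show ?thesis unfolding mu_iso_def by blast
qed

lemma mu_iso_trans:
  assumes "mu_iso \<Lambda> R n T T'" "mu_iso \<Lambda> R n T' T''"
  shows "mu_iso \<Lambda> R n T T''"
proof -
  obtain \<phi> where \<phi>: "lmap {..<n} {..<n} \<phi>" "bij_betw \<phi> (vsp {..<n}) (vsp {..<n})"
    "\<And>t v. t \<in> mix \<Lambda> R \<Longrightarrow> v \<in> vsp {..<n} \<Longrightarrow> \<phi> (T t v) = T' t (\<phi> v)"
    using assms(1) unfolding mu_iso_def by blast
  obtain \<psi> where \<psi>: "lmap {..<n} {..<n} \<psi>" "bij_betw \<psi> (vsp {..<n}) (vsp {..<n})"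
    "\<And>t v. t \<in> mix \<Lambda> R \<Longrightarrow> v \<in> vsp {..<n} \<Longrightarrow> \<psi> (T' t v) = T'' t (\<psi> v)"
    using assms(2) unfolding mu_iso_def by blast
  have "lmap {..<n} {..<n} (\<psi> \<circ> \<phi>)"
    using \<phi>(1) \<psi>(1) by (auto simp: lmap_iff lnr_def)
  moreover have "bij_betw (\<psi> \<circ> \<phi>) (vsp {..<n}) (vsp {..<n})"
    using \<phi>(2) \<psi>(2) by (rule bij_betw_trans)
  moreover have "(\<psi> \<circ> \<phi>) (T t v) = T'' t ((\<psi> \<circ> \<phi>) v)" if "t \<in> mix \<Lambda> R" "v \<in> vsp {..<n}" for t v
    using that \<phi>(1) by (simp add: \<phi>(3) \<psi>(3) lmap_iff)
  ultimately show ?thesis unfolding mu_iso_def by blast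
qed

section \<open>Column modules and the classification of irreducible modules over matrix
  units\<close>

text \<open>Modules live on \<open>vsp {..<n}\<close>, so the rows of a block have to be
  numbered.\<close>

definition row_enum :: "'r set \<Rightarrow> 'r \<Rightarrow> nat"
  where "row_enum S = (SOME h. bij_betw h S {..<card S})"

lemma row_enum: "finite S \<Longrightarrow> bij_betw (row_enum S) S {..<card S}"
  unfolding row_enum_def
  unfolding lessThan_atLeast0 using someI_ex[OF ex_bij_betw_finite_nat] .

text \<open>The column module of block \<open>l\<close>, the simple module of that matrix
  factor.\<close>

definition mu_std :: "('l \<Rightarrow> 'r set) \<Rightarrow> 'l \<Rightarrow> 'l \<times> 'r \<times> 'r \<Rightarrow> (nat \<Rightarrow>\<^sub>0 'k::field) \<Rightarrow> (nat \<Rightarrow>\<^sub>0 'k)"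
  where "mu_std R l = (\<lambda>(l', r, s) v. if l' = l
    then smul (Poly_Mapping.lookup v (row_enum (R l) s)) (bv (row_enum (R l) r)) else 0)"

context
  fixes \<Lambda> :: "'l set" and R :: "'l \<Rightarrow> 'r set"
  assumes fin: "finite \<Lambda>" "\<And>l. l \<in> \<Lambda> \<Longrightarrow> finite (R l)" and ne: "\<And>l. l \<in> \<Lambda> \<Longrightarrow> R l \<noteq> {}"
begin

lemma row_enum_less: "l \<in> \<Lambda> \<Longrightarrow> r \<in> R l \<Longrightarrow> row_enum (R l) r < card (R l)"
  using row_enum[OF fin(2)] by (fastforce simp: bij_betw_def)

lemma row_enum_eq: "l \<in> \<Lambda> \<Longrightarrow> r \<in> R l \<Longrightarrow> s \<in> R l \<Longrightarrow> row_enum (R l) r = row_enum (R l) s \<longleftrightarrow> r = s"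
  using row_enum[OF fin(2), of l] by (auto simp: bij_betw_def inj_on_def)

lemma mu_std_rep:
  assumes l: "l \<in> \<Lambda>"
  shows "mu_rep \<Lambda> R (card (R l)) (mu_std R l)"
  unfolding mu_rep_def
proof (intro conjI ballI allI impI)
  fix t assume "t \<in> mix \<Lambda> R"
  then show "lmap {..<card (R l)} {..<card (R l)} (mu_std R l t)"
    using l by (cases t) (auto simp: lmap_iff mu_std_def lnr_def lookup_add single_add row_enum_less)
next
  fix l1 r s l2 r' s' v
  assume "(l1, r, s) \<in> mix \<Lambda> R" "(l2, r', s') \<in> mix \<Lambda> R"
  then show "mu_std R l (l1, r, s) (mu_std R l (l2, r', s') v)
      = (if l1 = l2 \<and> s = r' then mu_std R l (l1, r, s') v else 0)"
    by (auto simp: mu_std_def lookup_single when_def row_enum_eq)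
next
  fix v assume v: "v \<in> vsp {..<card (R l)}"
  have "(\<Sum>l'\<in>\<Lambda>. \<Sum>r\<in>R l'. mu_std R l (l', r, r) v) = (\<Sum>l'\<in>\<Lambda>. if l' = l then \<Sum>r\<in>R l. mu_std R l (l, r, r) v else 0)"
    by (intro sum.cong refl) (auto simp: mu_std_def)
  also have "\<dots> = (\<Sum>r\<in>R l. smul (Poly_Mapping.lookup v (row_enum (R l) r)) (bv (row_enum (R l) r)))"
    using l fin by (simp add: mu_std_def del: smul_single)
  also have "\<dots> = (\<Sum>i<card (R l). smul (Poly_Mapping.lookup v i) (bv i))"
    by (rule sum.reindex_bij_betw[OF row_enum]) (use fin l in auto)
  also have "\<dots> = v" by (rule sum_expand[symmetric]) (use v in \<open>auto simp: vsp_def\<close>)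
  finally show "(\<Sum>l'\<in>\<Lambda>. \<Sum>r\<in>R l'. mu_std R l (l', r, r) v) = v" .
qed

text \<open>A nonzero vector has a nonzero coordinate; matrix units isolate it and move it to every
  position, so the vector generates the whole module.\<close>

lemma mu_std_irr:
  assumes l: "l \<in> \<Lambda>"
  shows "mu_irr \<Lambda> R (card (R l)) (mu_std R l :: _ \<Rightarrow> (nat \<Rightarrow>\<^sub>0 'k::field) \<Rightarrow> _)"
  unfolding mu_irr_def
proof (intro conjI allI impI)
  show "mu_rep \<Lambda> R (card (R l)) (mu_std R l :: _ \<Rightarrow> (nat \<Rightarrow>\<^sub>0 'k) \<Rightarrow> _)" by (rule mu_std_rep[OF l])
  show "0 < card (R l)" using fin ne l by (simp add: card_gt_0_iff)
  fix W :: "(nat \<Rightarrow>\<^sub>0 'k) set"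
  assume W: "pm.subspace W \<and> W \<subseteq> vsp {..<card (R l)} \<and> (\<forall>t\<in>mix \<Lambda> R. \<forall>w\<in>W. mu_std R l t w \<in> W)"
  show "W = {0} \<or> W = vsp {..<card (R l)}"
  proof (cases "W = {0}")
    case False
    then obtain w where w: "w \<in> W" "w \<noteq> 0" using W pm.subspace_0[of W] by auto
    then obtain i where i: "Poly_Mapping.lookup w i \<noteq> 0" by (metis poly_mapping_eqI lookup_zero)
    have "w \<in> vsp {..<card (R l)}" using w W by blast
    with i have "i < card (R l)" using lookup_vsp[of w "{..<card (R l)}" i] by auto
    then obtain s where s: "s \<in> R l" "i = row_enum (R l) s"
      using row_enum[OF fin(2)[OF l]] by (auto simp: bij_betw_def)
    have *: "bv (row_enum (R l) r) \<in> W" if "r \<in> R l" for r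
    proof -
      have "mu_std R l (l, r, s) w \<in> W" using W w that s l by auto
      then have "smul (1 / Poly_Mapping.lookup w i) (mu_std R l (l, r, s) w) \<in> W"
        using W pm.subspace_scale[of W] by simp
      then show ?thesis using i s by (simp add: mu_std_def)
    qed
    have b: "bv j \<in> W" if "j < card (R l)" for j
    proof -
      have "j \<in> row_enum (R l) ` R l"
        using that bij_betw_imp_surj_on[OF row_enum[OF fin(2)[OF l]]] by simp
      then show ?thesis using * by blast
    qed
    have "vsp {..<card (R l)} \<subseteq> W"
    proof
      fix v :: "nat \<Rightarrow>\<^sub>0 'k" assume "v \<in> vsp {..<card (R l)}"
      then have "v = (\<Sum>j<card (R l). smul (Poly_Mapping.lookup v j) (bv j))"
        by (intro sum_expand) (auto simp: vsp_def)
      also have "\<dots> \<in> W" using W b by (intro pm.subspace_sum pm.subspace_scale) auto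
      finally show "v \<in> W" .
    qed
    then show ?thesis using W by blast
  qed simp
qed

text \<open>The diagonal matrix unit \<open>(l, r, r)\<close> fixes a basis vector of the first
  module and acts as zero on the second if the labels differ.\<close>

lemma mu_std_inj:
  assumes "l \<in> \<Lambda>" "l' \<in> \<Lambda>" "card (R l) = n" "mu_iso \<Lambda> R n (mu_std R l) (mu_std R l' :: _ \<Rightarrow> (nat \<Rightarrow>\<^sub>0 'k::field) \<Rightarrow> _)"
  shows "l = l'"
proof (rule ccontr)
  assume n: "l \<noteq> l'"
  obtain \<phi> :: "(nat \<Rightarrow>\<^sub>0 'k) \<Rightarrow> (nat \<Rightarrow>\<^sub>0 'k)" where \<phi>: "lmap {..<n} {..<n} \<phi>" "bij_betw \<phi> (vsp {..<n}) (vsp {..<n})"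
    "\<And>t v. t \<in> mix \<Lambda> R \<Longrightarrow> v \<in> vsp {..<n} \<Longrightarrow> \<phi> (mu_std R l t v) = mu_std R l' t (\<phi> v)"
    using assms(4) unfolding mu_iso_def by blast
  obtain r where r: "r \<in> R l" using ne assms(1) by blast
  let ?v = "bv (row_enum (R l) r) :: nat \<Rightarrow>\<^sub>0 'k"
  have v: "?v \<in> vsp {..<n}" using row_enum_less[OF assms(1) r] assms(3) by auto
  have "\<phi> ?v = \<phi> (mu_std R l (l, r, r) ?v)" by (simp add: mu_std_def)
  also have "\<dots> = 0" using \<phi>(3)[of "(l, r, r)" ?v] r assms(1) v n by (simp add: mu_std_def)
  also have "\<dots> = \<phi> 0" using \<phi>(1) by (simp add: lmap_iff lnr_0)
  finally have "?v = 0" using \<phi>(2) v by (auto simp: bij_betw_def inj_on_def)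
  then show False by (metis lookup_single_eq lookup_zero zero_neq_one)
qed

text \<open>Some diagonal matrix unit has a nonzero vector \<open>u\<close> in its image. Moving
  \<open>u\<close> by the matrix units of the same column gives vectors \<open>c r\<close> with the
  multiplication table of the column module; they span a nonzero submodule, which is
  everything.\<close>

lemma mu_irr_std:
  fixes T :: "'l \<times> 'r \<times> 'r \<Rightarrow> (nat \<Rightarrow>\<^sub>0 'k::field) \<Rightarrow> (nat \<Rightarrow>\<^sub>0 'k)"
  assumes irr: "mu_irr \<Lambda> R n T"
  shows "\<exists>l\<in>\<Lambda>. card (R l) = n \<and> mu_iso \<Lambda> R n (mu_std R l) T"
proof -
  have rep: "mu_rep \<Lambda> R n T" and n: "n > 0" using irr by (auto simp: mu_irr_def)
  have b0: "bv 0 \<in> (vsp {..<n} :: (nat \<Rightarrow>\<^sub>0 'k) set)" "bv 0 \<noteq> (0 :: nat \<Rightarrow>\<^sub>0 'k)"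
    by (rule vsp_intros(5), use n in simp) (metis lookup_single_eq lookup_zero zero_neq_one)
  \<comment> \<open>The diagonal matrix units sum to the identity, so one of them does not
    annihilate \<open>bv 0\<close>.\<close>
  have "\<exists>l\<in>\<Lambda>. \<exists>a\<in>R l. T (l, a, a) (bv 0) \<noteq> 0"
    using mu_repD(4)[OF rep b0(1)] b0(2) by (metis (no_types, lifting) sum.neutral)
  then obtain l a where la: "l \<in> \<Lambda>" "a \<in> R l" and u0: "T (l, a, a) (bv 0) \<noteq> 0" by blast
  define u where "u = T (l, a, a) (bv 0)"
  define c where "c r = T (l, r, a) u" for r
  have u: "u \<in> vsp {..<n}" "T (l, a, a) u = u" "u \<noteq> 0"
    using la b0 u0 mu_repD(2)[OF rep, of "(l, a, a)" "bv 0"] mu_repD(3)[OF rep, of l a a l a a "bv 0"]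
    by (auto simp: u_def)
  have cv: "c r \<in> vsp {..<n}" if "r \<in> R l" for r
    using mu_repD(2)[OF rep] la u that by (simp add: c_def)
  have Tc: "T (l', p, q) (c r) = (if l' = l \<and> q = r then c p else 0)"
    if "(l', p, q) \<in> mix \<Lambda> R" "r \<in> R l" for l' p q r
    using mu_repD(3)[OF rep that(1), of l r a u] that la u by (auto simp: c_def)
  have span: "pm.span (c ` R l) = vsp {..<n}"
  proof -
    have "\<forall>t\<in>mix \<Lambda> R. \<forall>w\<in>pm.span (c ` R l). T t w \<in> pm.span (c ` R l)"
    proof (intro ballI)
      fix t w assume t: "t \<in> mix \<Lambda> R" and w: "w \<in> pm.span (c ` R l)"
      obtain l' p q where t': "t = (l', p, q)" by (cases t)
      show "T t w \<in> pm.span (c ` R l)"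
      proof (rule span_closed[OF mu_repD(1)[OF rep t] w])
        fix b assume "b \<in> c ` R l"
        then show "T t b \<in> pm.span (c ` R l)"
          using t pm.span_base[of _ "c ` R l"] by (auto simp: t' Tc pm.span_zero)
      qed simp
    qed
    moreover have "pm.span (c ` R l) \<subseteq> vsp {..<n}" by (rule pm.span_minimal) (use cv in auto)
    moreover have "u \<in> pm.span (c ` R l)"
      by (rule pm.span_base) (use u la in \<open>auto simp: c_def intro!: image_eqI[of _ _ a]\<close>)
    ultimately have "pm.span (c ` R l) = {0} \<or> pm.span (c ` R l) = vsp {..<n}" "u \<in> pm.span (c ` R l)"
      using irr pm.subspace_span[of "c ` R l"] unfolding mu_irr_def by blast+
    then show ?thesis using u(3) by auto
  qed
  obtain f where f: "dframe {..<n} (R l) c f"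
  proof -
    have "\<exists>f. dframe {..<n} (R l) c f"
    proof (rule dframe_ex_indep)
      fix e assume e: "(\<Sum>r\<in>R l. smul (e r) (c r)) = 0"
      show "\<forall>r\<in>R l. e r = 0"
      proof
        fix r assume r: "r \<in> R l"
        have m: "(l, a, r) \<in> mix \<Lambda> R" using la r by simp
        \<comment> \<open>The matrix unit \<open>(l, a, r)\<close> extracts the coefficient of
          \<open>c r\<close> from a linear relation.\<close>
        have "0 = T (l, a, r) (\<Sum>r\<in>R l. smul (e r) (c r))"
          using e lnr_0[OF mu_repD(1)[OF rep m]] by simp
        also have "\<dots> = (\<Sum>r'\<in>R l. smul (e r') (T (l, a, r) (c r')))"
          by (simp only: lnr_sum[OF mu_repD(1)[OF rep m]] lnr_smul[OF mu_repD(1)[OF rep m]])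
        also have "\<dots> = (\<Sum>r'\<in>R l. if r' = r then smul (e r) (c a) else 0)"
          using Tc[OF m] by (intro sum.cong) auto
        also have "\<dots> = smul (e r) u" using r fin(2)[OF la(1)] u by (simp add: c_def)
        finally show "e r = 0" using u(3) by (metis pm.scale_eq_0_iff)
      qed
    qed (use fin la cv span in auto)
    then show thesis using that by blast
  qed
  have card: "card (R l) = n" using dframe_card[OF f] by simp
  let ?h = "row_enum (R l)"
  have h: "bij_betw ?h (R l) {..<n}" using row_enum[OF fin(2)[OF la(1)]] card by simp
  define \<phi> where "\<phi> v = (\<Sum>r\<in>R l. smul (Poly_Mapping.lookup v (?h r)) (c r))" for v
  define \<psi> where "\<psi> v = (\<Sum>r\<in>R l. smul (pairing (f r) v) (bv (?h r)))" for v
  have l\<phi>: "lnr \<phi>" unfolding \<phi>_def lnr_def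
    by (simp add: lookup_add pm.scale_left_distrib sum.distrib pm.scale_sum_right)
  have l\<psi>: "lnr \<psi>" unfolding \<psi>_def by (intro lnr_intros)
  have \<phi>b: "\<phi> (bv (?h r)) = c r" if "r \<in> R l" for r
  proof -
    have "\<phi> (bv (?h r)) = (\<Sum>s\<in>R l. if s = r then c r else 0)"
      unfolding \<phi>_def by (intro sum.cong) (use that la in \<open>auto simp: lookup_single when_def row_enum_eq\<close>)
    then show ?thesis using that fin la by simp
  qed
  have \<psi>c: "\<psi> (c r) = bv (?h r)" if "r \<in> R l" for r
  proof -
    have "\<psi> (c r) = (\<Sum>s\<in>R l. if s = r then bv (?h r) else 0)"
      unfolding \<psi>_def by (intro sum.cong) (use that dframeD(5)[OF f] in auto)
    then show ?thesis using that fin la by simp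
  qed
  have cl: "\<phi> v \<in> vsp {..<n}" "\<psi> v \<in> vsp {..<n}" for v
    using cv row_enum_less[OF la(1)] by (auto simp: \<phi>_def \<psi>_def card)
  have 1: "\<phi> (\<psi> v) = v" if "v \<in> vsp {..<n}" for v
    by (rule dframe_ext[OF f lnr_comp[OF l\<phi> l\<psi>] lnr_id _ that]) (simp add: \<psi>c \<phi>b)
  have 2: "\<psi> (\<phi> v) = v" if "v \<in> vsp {..<n}" for v
  proof (rule lnr_ext[OF lnr_comp[OF l\<psi> l\<phi>] lnr_id that])
    fix i assume "i \<in> {..<n}"
    then obtain r where "r \<in> R l" "i = ?h r" using h by (auto simp: bij_betw_def)
    then show "\<psi> (\<phi> (bv i)) = bv i" by (simp add: \<phi>b \<psi>c)
  qed
  have "bij_betw \<phi> (vsp {..<n}) (vsp {..<n})"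
    by (rule bij_betw_byWitness[of _ \<psi>]) (use 1 2 cl in auto)
  moreover have "lmap {..<n} {..<n} \<phi>" using l\<phi> cl by (simp add: lmap_iff)
  moreover have "\<phi> (mu_std R l t v) = T t (\<phi> v)" if t: "t \<in> mix \<Lambda> R" and v: "v \<in> vsp {..<n}" for t v
  proof -
    have t2: "lnr (T t)" by (rule mu_repD(1)[OF rep t])
    have t1: "lnr (mu_std R l t :: (nat \<Rightarrow>\<^sub>0 'k) \<Rightarrow> _)" using mu_repD(1)[OF mu_std_rep[OF la(1)] t] .
    show ?thesis
    proof (rule lnr_ext[OF lnr_comp[OF l\<phi> t1] lnr_comp[OF t2 l\<phi>] v])
      fix i assume "i \<in> {..<n}"
      then obtain r where r: "r \<in> R l" "i = ?h r" using h by (auto simp: bij_betw_def)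
      obtain l' p q where t': "t = (l', p, q)" by (cases t)
      show "\<phi> (mu_std R l t (bv i)) = T t (\<phi> (bv i))"
        using t r la lnr_0[OF l\<phi>] by (auto simp: t' \<phi>b Tc mu_std_def lookup_single when_def row_enum_eq)
    qed
  qed
  ultimately have "mu_iso \<Lambda> R n (mu_std R l) T" unfolding mu_iso_def by blast
  with la card show ?thesis by blast
qed

text \<open>Irreducible objects \<open>x \<in> X\<close> that are encoded by matrix unit operators \<open>Op x\<close>.\<close>

lemma mu_count:
  fixes Op :: "'x \<Rightarrow> 'l \<times> 'r \<times> 'r \<Rightarrow> (nat \<Rightarrow>\<^sub>0 'k::field) \<Rightarrow> (nat \<Rightarrow>\<^sub>0 'k)"
  assumes X: "\<And>x. x \<in> X \<Longrightarrow> mu_irr \<Lambda> R n (Op x)"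
    and ex: "\<And>T. mu_irr \<Lambda> R n T \<Longrightarrow> \<exists>x\<in>X. mu_iso \<Lambda> R n (Op x) T"
    and iso: "\<And>x y. x \<in> X \<Longrightarrow> y \<in> X \<Longrightarrow> E x y \<longleftrightarrow> mu_iso \<Lambda> R n (Op x) (Op y)"
  shows "finite (X // {(x, y). x \<in> X \<and> y \<in> X \<and> E x y})
    \<and> card (X // {(x, y). x \<in> X \<and> y \<in> X \<and> E x y}) = card {l \<in> \<Lambda>. card (R l) = n}"
proof -
  let ?r = "{(x, y). x \<in> X \<and> y \<in> X \<and> E x y}"
  let ?L = "{l \<in> \<Lambda>. card (R l) = n}"
  have sym: "mu_iso \<Lambda> R n T' T" if "mu_iso \<Lambda> R n T T'" "mu_irr \<Lambda> R n T" for T T' :: "'l \<times> 'r \<times> 'r \<Rightarrow> (nat \<Rightarrow>\<^sub>0 'k) \<Rightarrow> (nat \<Rightarrow>\<^sub>0 'k)"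
    using mu_iso_sym[OF _ that(1)] mu_repD(2)[of \<Lambda> R n T] that(2) by (auto simp: mu_irr_def)
  \<comment> \<open>One object \<open>s l\<close> is chosen for each label of dimension
    \<open>n\<close>; the classes of the \<open>s l\<close> are then all the classes, without
    repetition.\<close>
  have "\<exists>x\<in>X. mu_iso \<Lambda> R n (Op x) (mu_std R l)" if "l \<in> ?L" for l
    using ex[of "mu_std R l"] mu_std_irr[of l] that by auto
  then obtain s where s: "\<And>l. l \<in> ?L \<Longrightarrow> s l \<in> X" "\<And>l. l \<in> ?L \<Longrightarrow> mu_iso \<Lambda> R n (Op (s l)) (mu_std R l)"
    by metis
  have cls: "\<exists>l\<in>?L. E (s l) x" if x: "x \<in> X" for x
  proof -
    obtain l where l: "l \<in> ?L" "mu_iso \<Lambda> R n (mu_std R l) (Op x)" using mu_irr_std[OF X[OF x]] by blast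
    then show ?thesis using mu_iso_trans[OF s(2)] iso s(1) x by blast
  qed
  have equiv: "equiv X ?r"
  proof (rule equivI)
    show "?r \<subseteq> X \<times> X" by auto
    show "refl_on X ?r" using mu_iso_refl_on[of \<Lambda> R n] iso by (auto simp: refl_on_def)
    show "sym ?r" using sym X iso by (auto simp: sym_def)
    show "trans ?r" unfolding trans_def using mu_iso_trans iso by (auto; blast)
  qed
  have q: "X // ?r = (\<lambda>l. ?r `` {s l}) ` ?L"
  proof
    show "(\<lambda>l. ?r `` {s l}) ` ?L \<subseteq> X // ?r" using s(1) by (auto simp: quotient_def)
    show "X // ?r \<subseteq> (\<lambda>l. ?r `` {s l}) ` ?L"
    proof
      fix C assume "C \<in> X // ?r"
      then obtain x where x: "x \<in> X" "C = ?r `` {x}" by (auto simp: quotient_def)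
      obtain l where l: "l \<in> ?L" "E (s l) x" using cls[OF x(1)] by blast
      then have "?r `` {s l} = ?r `` {x}" using s(1) x(1) by (intro equiv_class_eq[OF equiv]) auto
      then show "C \<in> (\<lambda>l. ?r `` {s l}) ` ?L" using l x by blast
    qed
  qed
  have "inj_on (\<lambda>l. ?r `` {s l}) ?L"
  proof (rule inj_onI)
    fix l l' assume l: "l \<in> ?L" "l' \<in> ?L" "?r `` {s l} = ?r `` {s l'}"
    then have "E (s l) (s l')"
      using eq_equiv_class[OF l(3) equiv] s(1) by blast
    then have i: "mu_iso \<Lambda> R n (Op (s l)) (Op (s l'))" using iso s(1) l by blast
    have "mu_iso \<Lambda> R n (mu_std R l) (Op (s l))" using sym s l X by blast
    then have "mu_iso \<Lambda> R n (mu_std R l) (mu_std R l' :: _ \<Rightarrow> (nat \<Rightarrow>\<^sub>0 'k) \<Rightarrow> _)"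
      using i s(2)[OF l(2)] mu_iso_trans by blast
    then show "l = l'" using mu_std_inj l by blast
  qed
  then show ?thesis using fin(1) by (simp add: q card_image)
qed

end

section \<open>Algebras with a basis of matrix units\<close>

text \<open>The identity is injective on \<open>L\<close>, so it has a linear left inverse on the
  whole space with values in \<open>L\<close>.\<close>

lemma lnr_proj:
  fixes L :: "('i \<Rightarrow>\<^sub>0 'k::field) set"
  assumes "pm.subspace L"
  obtains p where "lnr p" "\<And>v. p v \<in> L" "\<And>v. v \<in> L \<Longrightarrow> p v = v"
proof -
  interpret vs: vector_space_pair "smul :: 'k \<Rightarrow> ('i \<Rightarrow>\<^sub>0 'k) \<Rightarrow> _" "smul :: 'k \<Rightarrow> ('i \<Rightarrow>\<^sub>0 'k) \<Rightarrow> _" ..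
  have "Vector_Spaces.linear smul smul (id :: ('i \<Rightarrow>\<^sub>0 'k) \<Rightarrow> _)" by (simp add: lnr_iff_linear[symmetric])
  from vs.linear_exists_left_inverse_on[OF this assms inj_on_id]
  obtain g where "range g \<subseteq> L" "Vector_Spaces.linear smul smul g" "\<forall>v\<in>L. g (id v) = v" by blast
  then show thesis using that[of g] by (auto simp: lnr_iff_linear)
qed

text \<open>The product is constrained only by the requirement that the functionals \<open>f\<close>
  multiply like matrix coefficients. As they form a basis of the dual space, they embed
  \<open>A\<close> into a product of matrix algebras, and associativity and the unit laws become
  consequences.\<close>

locale mat_alg =
  fixes A :: "('i, 'k::field, 'z) alg_scheme" and \<Lambda> :: "'l set" and R :: "'l \<Rightarrow> 'r set"
    and E f :: "'l \<times> 'r \<times> 'r \<Rightarrow> ('i \<Rightarrow>\<^sub>0 'k)"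
  assumes fin: "finite \<Lambda>" "\<And>l. l \<in> \<Lambda> \<Longrightarrow> finite (R l)" and ne: "\<And>l. l \<in> \<Lambda> \<Longrightarrow> R l \<noteq> {}"
    and frame: "dframe (basis A) (mix \<Lambda> R) E f"
    and closed: "\<And>a b. a \<in> space A \<Longrightarrow> b \<in> space A \<Longrightarrow> mul A a b \<in> space A"
    and unt_closed: "unt A \<in> space A"
    and f_mul: "\<And>l r s a b. (l, r, s) \<in> mix \<Lambda> R \<Longrightarrow> a \<in> space A \<Longrightarrow> b \<in> space A \<Longrightarrow>
      pairing (f (l, r, s)) (mul A a b) = (\<Sum>q\<in>R l. pairing (f (l, r, q)) a * pairing (f (l, q, s)) b)"
    and f_unt: "\<And>l r s. (l, r, s) \<in> mix \<Lambda> R \<Longrightarrow> pairing (f (l, r, s)) (unt A) = (if r = s then 1 else 0)"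
begin

lemma sum_mix': "(\<Sum>t\<in>mix \<Lambda> R. g t) = (\<Sum>l\<in>\<Lambda>. \<Sum>r\<in>R l. \<Sum>s\<in>R l. g (l, r, s))"
  by (rule sum_mix) (use fin in auto)

lemma E_closed: "t \<in> mix \<Lambda> R \<Longrightarrow> E t \<in> space A"
  by (rule dframeD(3)[OF frame])

lemma f_E: "t \<in> mix \<Lambda> R \<Longrightarrow> t' \<in> mix \<Lambda> R \<Longrightarrow> pairing (f t) (E t') = (if t = t' then 1 else 0)"
  by (rule dframeD(5)[OF frame])

lemma E_mul:
  assumes "(l, r, s) \<in> mix \<Lambda> R" "(l', r', s') \<in> mix \<Lambda> R"
  shows "mul A (E (l, r, s)) (E (l', r', s')) = (if l = l' \<and> s = r' then E (l, r, s') else 0)"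
proof (rule dframe_pairing_ext[OF frame])
  fix t assume t: "t \<in> mix \<Lambda> R"
  obtain m p q where t': "t = (m, p, q)" by (cases t)
  have "pairing (f t) (mul A (E (l, r, s)) (E (l', r', s')))
      = (\<Sum>u\<in>R m. if m = l \<and> p = r \<and> u = s \<and> m = l' \<and> u = r' \<and> q = s' then 1 else 0)"
    using t unfolding t' by (subst f_mul) (use assms in \<open>auto simp: f_E E_closed intro!: sum.cong\<close>)
  also have "\<dots> = pairing (f t) (if l = l' \<and> s = r' then E (l, r, s') else 0)"
  proof (cases "m = l \<and> p = r \<and> m = l' \<and> s = r' \<and> q = s'")
    case True
    then have "(\<Sum>u\<in>R m. if m = l \<and> p = r \<and> u = s \<and> m = l' \<and> u = r' \<and> q = s' then 1 else 0)
        = (\<Sum>u\<in>R m. if u = s then 1 else (0::'k))" by (intro sum.cong) auto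
    also have "\<dots> = 1" using True assms fin by simp
    finally show ?thesis using True t assms f_E[of "(l, r, s')" "(l, r, s')"] by (auto simp: t')
  next
    case False
    then have "(\<Sum>u\<in>R m. if m = l \<and> p = r \<and> u = s \<and> m = l' \<and> u = r' \<and> q = s' then 1 else 0) = (0::'k)"
      by (intro sum.neutral) auto
    then show ?thesis using False t assms by (auto simp: t' f_E pairing_linear)
  qed
  finally show "pairing (f t) (mul A (E (l, r, s)) (E (l', r', s')))
      = pairing (f t) (if l = l' \<and> s = r' then E (l, r, s') else 0)" .
qed (use assms in \<open>auto intro!: closed E_closed\<close>)

lemma unt_E: "unt A = (\<Sum>l\<in>\<Lambda>. \<Sum>r\<in>R l. E (l, r, r))"
proof -
  have "unt A = (\<Sum>t\<in>mix \<Lambda> R. smul (pairing (f t) (unt A)) (E t))"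
    using dframeD(6)[OF frame unt_closed] ..
  also have "\<dots> = (\<Sum>l\<in>\<Lambda>. \<Sum>r\<in>R l. \<Sum>s\<in>R l. if r = s then E (l, r, r) else 0)"
    unfolding sum_mix' by (intro sum.cong) (auto simp: f_unt)
  also have "\<dots> = (\<Sum>l\<in>\<Lambda>. \<Sum>r\<in>R l. E (l, r, r))"
    using fin by (intro sum.cong) auto
  finally show ?thesis .
qed

lemma is_algebra: "is_algebra A"
  unfolding is_algebra_def
proof (intro conjI ballI)
  fix i j assume "i \<in> basis A" "j \<in> basis A"
  then show "bmult A i j \<in> space A" using closed[of "bv i" "bv j"] by simp
next
  fix a b c assume abc: "a \<in> space A" "b \<in> space A" "c \<in> space A"
  show "mul A (mul A a b) c = mul A a (mul A b c)"
  proof (rule dframe_pairing_ext[OF frame])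
    fix t assume t: "t \<in> mix \<Lambda> R"
    obtain m p q where t': "t = (m, p, q)" by (cases t)
    have "pairing (f t) (mul A (mul A a b) c)
      = (\<Sum>u\<in>R m. \<Sum>v\<in>R m. pairing (f (m, p, v)) a * pairing (f (m, v, u)) b * pairing (f (m, u, q)) c)"
      using t abc unfolding t' by (simp add: f_mul closed sum_distrib_right)
    also have "\<dots> = pairing (f t) (mul A a (mul A b c))"
      using t abc unfolding t' by (subst sum.swap) (simp add: f_mul closed sum_distrib_left mult.assoc)
    finally show "pairing (f t) (mul A (mul A a b) c) = pairing (f t) (mul A a (mul A b c))" .
  qed (use abc closed in auto)
next
  fix a assume a: "a \<in> space A"
  show "mul A (unt A) a = a"
  proof (rule dframe_pairing_ext[OF frame])
    fix t assume t: "t \<in> mix \<Lambda> R"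
    obtain m p q where t': "t = (m, p, q)" by (cases t)
    have "pairing (f t) (mul A (unt A) a) = (\<Sum>u\<in>R m. if p = u then pairing (f (m, u, q)) a else 0)"
      using t a unfolding t' by (subst f_mul) (auto simp: f_unt unt_closed intro!: sum.cong)
    then show "pairing (f t) (mul A (unt A) a) = pairing (f t) a" using t fin by (simp add: t')
  qed (use a closed unt_closed in auto)
  show "mul A a (unt A) = a"
  proof (rule dframe_pairing_ext[OF frame])
    fix t assume t: "t \<in> mix \<Lambda> R"
    obtain m p q where t': "t = (m, p, q)" by (cases t)
    have "pairing (f t) (mul A a (unt A)) = (\<Sum>u\<in>R m. if u = q then pairing (f (m, p, u)) a else 0)"
      using t a unfolding t' by (subst f_mul) (auto simp: f_unt unt_closed intro!: sum.cong)
    then show "pairing (f t) (mul A a (unt A)) = pairing (f t) a" using t fin by (simp add: t')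
  qed (use a closed unt_closed in auto)
qed (rule unt_closed)

lemma mul_assoc: "a \<in> space A \<Longrightarrow> b \<in> space A \<Longrightarrow> c \<in> space A \<Longrightarrow> mul A (mul A a b) c = mul A a (mul A b c)"
  and mul_unt: "a \<in> space A \<Longrightarrow> mul A (unt A) a = a" "a \<in> space A \<Longrightarrow> mul A a (unt A) = a"
  using is_algebra unfolding is_algebra_def by blast+

text \<open>A projection \<open>p\<close> onto a left ideal is made \<open>A\<close>-linear by averaging over matrix units:
  \<open>x \<mapsto> \<Sum> E\<^sub>r\<^sub>0 p(E\<^sub>0\<^sub>r x)\<close>.\<close>

lemma semisimple: "semisimple_alg A"
  unfolding semisimple_alg_def
proof (intro allI impI)
  fix L assume L: "is_left_ideal A L"
  then have sL: "pm.subspace L" and LA: "L \<subseteq> space A" and ideal: "\<And>a l. a \<in> space A \<Longrightarrow> l \<in> L \<Longrightarrow> mul A a l \<in> L"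
    by (auto simp: is_left_ideal_def)
  obtain p where p: "lnr p" "\<And>v. p v \<in> L" "\<And>v. v \<in> L \<Longrightarrow> p v = v" using lnr_proj[OF sL] by blast
  \<comment> \<open>Any fixed row of each block can play the part of row 0 in the average.\<close>
  define z where "z l = (SOME r. r \<in> R l)" for l
  have z: "z l \<in> R l" if "l \<in> \<Lambda>" for l
    unfolding z_def by (rule someI_ex) (use ne[OF that] in blast)
  define P where "P x = (\<Sum>l\<in>\<Lambda>. \<Sum>r\<in>R l. mul A (E (l, r, z l)) (p (mul A (E (l, z l, r)) x)))" for x
  have lP: "lnr P" unfolding P_def by (intro lnr_intros lnr_comp[OF p(1)])
  have PL: "P x \<in> L" for x
    unfolding P_def by (intro pm.subspace_sum sL ideal p(2) E_closed) (auto simp: z)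
  have Pl: "P x = x" if x: "x \<in> L" for x
  proof -
    have "P x = (\<Sum>l\<in>\<Lambda>. \<Sum>r\<in>R l. mul A (E (l, r, r)) x)"
      unfolding P_def
    proof (intro sum.cong refl)
      fix l r assume lr: "l \<in> \<Lambda>" "r \<in> R l"
      then have m: "(l, r, z l) \<in> mix \<Lambda> R" "(l, z l, r) \<in> mix \<Lambda> R" using z by auto
      have "p (mul A (E (l, z l, r)) x) = mul A (E (l, z l, r)) x"
        by (rule p(3)[OF ideal[OF E_closed[OF m(2)] x]])
      then show "mul A (E (l, r, z l)) (p (mul A (E (l, z l, r)) x)) = mul A (E (l, r, r)) x"
        using m x LA by (auto simp: mul_assoc[symmetric] E_closed E_mul[OF m])
    qed
    also have "\<dots> = mul A (unt A) x" by (simp add: unt_E mul_linear)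
    also have "\<dots> = x" using x LA by (auto simp: mul_unt)
    finally show ?thesis .
  qed
  \<comment> \<open>Multiplication by the matrix unit \<open>(m, b, c)\<close>, before or after
    \<open>P\<close>, leaves one summand of the average, namely the same element
    \<open>?Q\<close>.\<close>
  have Pm: "P (mul A a x) = mul A a (P x)" if a: "a \<in> space A" and x: "x \<in> space A" for a x
  proof (rule dframe_ext[OF frame _ _ _ a])
    show "lnr (\<lambda>a. P (mul A a x))" by (intro lnr_intros lnr_comp[OF lP])
    show "lnr (\<lambda>a. mul A a (P x))" by (intro lnr_intros)
    fix t assume t: "t \<in> mix \<Lambda> R"
    obtain m b c where t': "t = (m, b, c)" by (cases t)
    have mbc: "m \<in> \<Lambda>" "b \<in> R m" "c \<in> R m" using t by (auto simp: t')
    have pA: "p v \<in> space A" for v using p(2) LA by blast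
    let ?Q = "mul A (E (m, b, z m)) (p (mul A (E (m, z m, c)) x))"
    have "mul A (E (l, r, z l)) (p (mul A (E (l, z l, r)) (mul A (E t) x)))
        = (if l = m then if r = b then ?Q else 0 else 0)" if lr: "l \<in> \<Lambda>" "r \<in> R l" for l r
    proof -
      have "(l, z l, r) \<in> mix \<Lambda> R" using z lr by simp
      then have "mul A (E (l, z l, r)) (mul A (E t) x) = (if l = m \<and> r = b then mul A (E (l, z l, c)) x else 0)"
        using t x by (auto simp: t' mul_assoc[symmetric] E_closed E_mul mul_linear)
      then show ?thesis by (auto simp: lnr_0[OF p(1)] mul_linear)
    qed
    then have "P (mul A (E t) x) = (\<Sum>l\<in>\<Lambda>. \<Sum>r\<in>R l. if l = m then if r = b then ?Q else 0 else 0)"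
      unfolding P_def by (intro sum.cong) auto
    also have "\<dots> = (\<Sum>l\<in>\<Lambda>. if l = m then (\<Sum>r\<in>R m. if r = b then ?Q else 0) else 0)"
      by (intro sum.cong) auto
    also have "\<dots> = ?Q" using fin mbc by simp
    finally have l: "P (mul A (E t) x) = ?Q" .
    have "mul A (E t) (mul A (E (l, r, z l)) (p (mul A (E (l, z l, r)) x)))
        = (if l = m then if r = c then ?Q else 0 else 0)" if lr: "l \<in> \<Lambda>" "r \<in> R l" for l r
    proof -
      have "(l, r, z l) \<in> mix \<Lambda> R" using z lr by simp
      then show ?thesis
        using t pA by (auto simp: t' mul_assoc[symmetric] E_closed E_mul mul_linear)
    qed
    then have "mul A (E t) (P x) = (\<Sum>l\<in>\<Lambda>. \<Sum>r\<in>R l. if l = m then if r = c then ?Q else 0 else 0)"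
      unfolding P_def mul_linear by (intro sum.cong) auto
    also have "\<dots> = (\<Sum>l\<in>\<Lambda>. if l = m then (\<Sum>r\<in>R m. if r = c then ?Q else 0) else 0)"
      by (intro sum.cong) auto
    also have "\<dots> = ?Q" using fin mbc by simp
    finally show "P (mul A (E t) x) = mul A (E t) (P x)" using l by simp
  qed
  \<comment> \<open>The kernel of the \<open>A\<close>-linear projection is the complementary left
    ideal.\<close>
  let ?M = "{x \<in> space A. P x = 0}"
  have "is_left_ideal A ?M"
    unfolding is_left_ideal_def
  proof (intro conjI ballI)
    show "pm.subspace ?M"
      using lP by (auto simp: pm.subspace_def lnr_0 lnr_add lnr_smul)
    fix a l assume "a \<in> space A" "l \<in> ?M"
    then show "mul A a l \<in> ?M" by (simp add: closed Pm mul_linear)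
  qed auto
  moreover have "L \<inter> ?M = {0}" using Pl LA pm.subspace_0[OF sL] lnr_0[OF lP] by auto
  moreover have "{l + m |l m. l \<in> L \<and> m \<in> ?M} = space A"
  proof
    show "{l + m |l m. l \<in> L \<and> m \<in> ?M} \<subseteq> space A" using LA by auto
    show "space A \<subseteq> {l + m |l m. l \<in> L \<and> m \<in> ?M}"
    proof
      fix x assume x: "x \<in> space A"
      have "x = P x + (x - P x)" by simp
      moreover have "x - P x \<in> ?M" using x PL LA Pl by (auto simp: lnr_diff[OF lP])
      ultimately show "x \<in> {l + m |l m. l \<in> L \<and> m \<in> ?M}" using PL by blast
    qed
  qed
  ultimately show "\<exists>M. is_left_ideal A M \<and> L \<inter> M = {0} \<and> {l + m |l m. l \<in> L \<and> m \<in> M} = space A"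
    by blast
qed

section \<open>Modules over an algebra as matrix unit operators\<close>

definition rep_op :: "(('i \<times> nat \<Rightarrow>\<^sub>0 'k) \<Rightarrow> (nat \<Rightarrow>\<^sub>0 'k)) \<Rightarrow> 'l \<times> 'r \<times> 'r \<Rightarrow> (nat \<Rightarrow>\<^sub>0 'k) \<Rightarrow> (nat \<Rightarrow>\<^sub>0 'k)"
  where "rep_op \<alpha> t v = \<alpha> (tens (E t) v)"

text \<open>Reconstructs an action from operators of matrix units: the coordinates of an element of
  \<open>A\<close> in the basis \<open>E\<close> are its matrix coefficients.\<close>

definition op_rep :: "('l \<times> 'r \<times> 'r \<Rightarrow> (nat \<Rightarrow>\<^sub>0 'k) \<Rightarrow> (nat \<Rightarrow>\<^sub>0 'k)) \<Rightarrow> ('i \<times> nat \<Rightarrow>\<^sub>0 'k) \<Rightarrow> (nat \<Rightarrow>\<^sub>0 'k)"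
  where "op_rep T = lin (\<lambda>(i, m). \<Sum>t\<in>mix \<Lambda> R. smul (pairing (f t) (bv i)) (T t (bv m)))"

lemma rep_expand:
  assumes "lnr \<alpha>" "a \<in> space A"
  shows "\<alpha> (tens a v) = (\<Sum>t\<in>mix \<Lambda> R. smul (pairing (f t) a) (rep_op \<alpha> t v))"
proof (rule dframe_ext[OF frame _ _ _ assms(2)])
  show "lnr (\<lambda>a. \<alpha> (tens a v))" by (intro lnr_comp[OF assms(1)] lnr_intros)
  show "lnr (\<lambda>a. \<Sum>t\<in>mix \<Lambda> R. smul (pairing (f t) a) (rep_op \<alpha> t v))" by (intro lnr_intros)
  fix t assume "t \<in> mix \<Lambda> R"
  then have "(\<Sum>t'\<in>mix \<Lambda> R. smul (pairing (f t') (E t)) (rep_op \<alpha> t' v)) = (\<Sum>t'\<in>mix \<Lambda> R. if t' = t then rep_op \<alpha> t v else 0)"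
    by (intro sum.cong) (auto simp: f_E)
  then show "\<alpha> (tens (E t) v) = (\<Sum>t'\<in>mix \<Lambda> R. smul (pairing (f t') (E t)) (rep_op \<alpha> t' v))"
    using \<open>t \<in> mix \<Lambda> R\<close> dframeD(2)[OF frame] by (simp add: rep_op_def)
qed

lemma rep_mu:
  assumes "is_rep A n \<alpha>"
  shows "mu_rep \<Lambda> R n (rep_op \<alpha>)"
proof -
  have l: "lnr \<alpha>" and cl: "\<And>v. v \<in> vsp (basis A \<times> {..<n}) \<Longrightarrow> \<alpha> v \<in> vsp {..<n}"
    and u: "\<And>v. v \<in> vsp {..<n} \<Longrightarrow> \<alpha> (tens (unt A) v) = v"
    and m: "\<And>a b v. a \<in> space A \<Longrightarrow> b \<in> space A \<Longrightarrow> v \<in> vsp {..<n} \<Longrightarrow> \<alpha> (tens (mul A a b) v) = \<alpha> (tens a (\<alpha> (tens b v)))"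
    using assms unfolding is_rep_def lmap_iff by blast+
  show ?thesis
    unfolding mu_rep_def
  proof (intro conjI ballI allI impI)
    fix t assume "t \<in> mix \<Lambda> R"
    then show "lmap {..<n} {..<n} (rep_op \<alpha> t)"
      unfolding lmap_iff rep_op_def by (auto intro!: lnr_comp[OF l] lnr_intros cl E_closed)
  next
    fix x r s x' r' s' and v :: "nat \<Rightarrow>\<^sub>0 'k"
    assume "(x, r, s) \<in> mix \<Lambda> R" "(x', r', s') \<in> mix \<Lambda> R" "v \<in> vsp {..<n}"
    then show "rep_op \<alpha> (x, r, s) (rep_op \<alpha> (x', r', s') v) = (if x = x' \<and> s = r' then rep_op \<alpha> (x, r, s') v else 0)"
      unfolding rep_op_def by (subst m[symmetric]) (auto simp: E_closed E_mul tens_linear lnr_0[OF l])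
  next
    fix v :: "nat \<Rightarrow>\<^sub>0 'k" assume v: "v \<in> vsp {..<n}"
    show "(\<Sum>x\<in>\<Lambda>. \<Sum>r\<in>R x. rep_op \<alpha> (x, r, r) v) = v"
      using u[OF v] by (simp add: unt_E tens_linear lnr_sum[OF l] rep_op_def)
  qed
qed

lemma rep_stable_iff:
  assumes "lnr \<alpha>" "pm.subspace W"
  shows "(\<forall>a\<in>space A. \<forall>w\<in>W. \<alpha> (tens a w) \<in> W) \<longleftrightarrow> (\<forall>t\<in>mix \<Lambda> R. \<forall>w\<in>W. rep_op \<alpha> t w \<in> W)"
proof
  assume *: "\<forall>t\<in>mix \<Lambda> R. \<forall>w\<in>W. rep_op \<alpha> t w \<in> W"
  show "\<forall>a\<in>space A. \<forall>w\<in>W. \<alpha> (tens a w) \<in> W"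
    using * assms by (auto simp: rep_expand intro!: pm.subspace_sum pm.subspace_scale)
qed (auto simp: rep_op_def E_closed)

lemma irr_mu: "irreducible_rep A n \<alpha> \<longleftrightarrow> is_rep A n \<alpha> \<and> mu_irr \<Lambda> R n (rep_op \<alpha>)"
proof -
  have "lnr \<alpha>" if "is_rep A n \<alpha>" using that by (simp add: is_rep_def lmap_iff)
  then show ?thesis
    unfolding irreducible_rep_def mu_irr_def using rep_mu rep_stable_iff by metis
qed

lemma op_rep_tens:
  assumes "\<And>t. t \<in> mix \<Lambda> R \<Longrightarrow> lnr (T t)"
  shows "op_rep T (tens a v) = (\<Sum>t\<in>mix \<Lambda> R. smul (pairing (f t) a) (T t v))"
  unfolding op_rep_def
  by (rule lin_bilinear[of "\<lambda>a v. \<Sum>t\<in>mix \<Lambda> R. smul (pairing (f t) a) (T t v)"])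
    (intro lnr_intros assms; assumption)+

lemma rep_op_rep:
  assumes "\<And>t. t \<in> mix \<Lambda> R \<Longrightarrow> lnr (T t)" "t \<in> mix \<Lambda> R"
  shows "rep_op (op_rep T) t v = T t v"
proof -
  have "rep_op (op_rep T) t v = (\<Sum>t'\<in>mix \<Lambda> R. if t' = t then T t v else 0)"
    unfolding rep_op_def by (subst op_rep_tens) (use assms in \<open>auto simp: f_E intro!: sum.cong\<close>)
  then show ?thesis using assms(2) dframeD(2)[OF frame] by simp
qed

lemma op_rep_is_rep:
  assumes T: "mu_rep \<Lambda> R n T"
  shows "is_rep A n (op_rep T)"
proof -
  note l = mu_repD(1)[OF T] and cl = mu_repD(2)[OF T]
  have ot: "op_rep T (tens a v) = (\<Sum>t\<in>mix \<Lambda> R. smul (pairing (f t) a) (T t v))" for a v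
    by (rule op_rep_tens[OF l])
  show ?thesis
    unfolding is_rep_def
  proof (intro conjI ballI)
    show "lmap (basis A \<times> {..<n}) {..<n} (op_rep T)"
      unfolding lmap_iff
    proof (intro conjI ballI)
      show "lnr (op_rep T)" unfolding op_rep_def by (rule lnr_lin)
      fix v :: "'i \<times> nat \<Rightarrow>\<^sub>0 'k" assume "v \<in> vsp (basis A \<times> {..<n})"
      then show "op_rep T v \<in> vsp {..<n}"
        unfolding op_rep_def by (rule lin_closed) (auto intro!: cl vsp_intros)
    qed
    fix v :: "nat \<Rightarrow>\<^sub>0 'k" assume v: "v \<in> vsp {..<n}"
    have "op_rep T (tens (unt A) v) = (\<Sum>x\<in>\<Lambda>. \<Sum>r\<in>R x. \<Sum>s\<in>R x. if r = s then T (x, r, r) v else 0)"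
      unfolding ot sum_mix' by (intro sum.cong) (auto simp: f_unt)
    also have "\<dots> = (\<Sum>x\<in>\<Lambda>. \<Sum>r\<in>R x. T (x, r, r) v)" using fin by (intro sum.cong) auto
    finally show "op_rep T (tens (unt A) v) = v" using mu_repD(4)[OF T v] by simp
    fix a b assume a: "a \<in> space A" and b: "b \<in> space A"
    show "op_rep T (tens (mul A a b) v) = op_rep T (tens a (op_rep T (tens b v)))"
    proof (rule dframe_ext[OF frame _ _ _ a])
      show "lnr (\<lambda>a. op_rep T (tens (mul A a b) v))" "lnr (\<lambda>a. op_rep T (tens a (op_rep T (tens b v))))"
        unfolding op_rep_def by (intro lnr_intros)+
      fix t assume t: "t \<in> mix \<Lambda> R"
      show "op_rep T (tens (mul A (E t) b) v) = op_rep T (tens (E t) (op_rep T (tens b v)))"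
      proof (rule dframe_ext[OF frame _ _ _ b])
        show "lnr (\<lambda>b. op_rep T (tens (mul A (E t) b) v))" "lnr (\<lambda>b. op_rep T (tens (E t) (op_rep T (tens b v))))"
          unfolding op_rep_def by (intro lnr_intros)+
        fix t' assume t': "t' \<in> mix \<Lambda> R"
        obtain x r s x' r' s' where tt: "t = (x, r, s)" "t' = (x', r', s')" by (cases t, cases t')
        have o0: "op_rep T 0 = 0" unfolding op_rep_def by (rule lnr_0[OF lnr_lin])
        have o: "op_rep T (tens (E t) w) = T t w" if "t \<in> mix \<Lambda> R" for t w
          using rep_op_rep[OF l that] by (simp add: rep_op_def)
        have "op_rep T (tens (mul A (E t) (E t')) v) = (if x = x' \<and> s = r' then T (x, r, s') v else 0)"
          using t t' unfolding tt by (auto simp: E_mul o tens_linear o0)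
        also have "\<dots> = op_rep T (tens (E t) (op_rep T (tens (E t') v)))"
          using t t' v mu_repD(3)[OF T, of x r s x' r' s' v] unfolding tt by (simp only: o)
        finally show "op_rep T (tens (mul A (E t) (E t')) v) = op_rep T (tens (E t) (op_rep T (tens (E t') v)))" .
      qed
    qed
  qed
qed

lemma rep_iso_mu:
  assumes "is_rep A n \<alpha>" "is_rep A n \<beta>"
  shows "rep_iso A n \<alpha> \<beta> \<longleftrightarrow> mu_iso \<Lambda> R n (rep_op \<alpha>) (rep_op \<beta>)"
proof -
  have l: "lnr \<alpha>" "lnr \<beta>" using assms by (auto simp: is_rep_def lmap_iff)
  have "(\<forall>a\<in>space A. \<forall>v\<in>vsp {..<n}. \<phi> (\<alpha> (tens a v)) = \<beta> (tens a (\<phi> v)))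
      \<longleftrightarrow> (\<forall>t\<in>mix \<Lambda> R. \<forall>v\<in>vsp {..<n}. \<phi> (rep_op \<alpha> t v) = rep_op \<beta> t (\<phi> v))" if "lnr \<phi>" for \<phi>
  proof
    assume *: "\<forall>t\<in>mix \<Lambda> R. \<forall>v\<in>vsp {..<n}. \<phi> (rep_op \<alpha> t v) = rep_op \<beta> t (\<phi> v)"
    show "\<forall>a\<in>space A. \<forall>v\<in>vsp {..<n}. \<phi> (\<alpha> (tens a v)) = \<beta> (tens a (\<phi> v))"
      using * by (simp add: rep_expand l lnr_sum[OF that] lnr_smul[OF that])
  qed (simp add: rep_op_def E_closed)
  then show ?thesis unfolding rep_iso_def mu_iso_def lmap_iff by blast
qed

lemma card_irrep_classes:
  "finite (irrep_classes A n) \<and> card (irrep_classes A n) = card {l \<in> \<Lambda>. card (R l) = n}"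
proof -
  have e: "irrep_classes A n = {\<alpha>. irreducible_rep A n \<alpha>} //
    {(\<alpha>, \<beta>). \<alpha> \<in> {\<alpha>. irreducible_rep A n \<alpha>} \<and> \<beta> \<in> {\<alpha>. irreducible_rep A n \<alpha>} \<and> rep_iso A n \<alpha> \<beta>}"
    by (simp add: irrep_classes_def)
  show ?thesis
    unfolding e
  proof (rule mu_count[of \<Lambda> R _ _ rep_op, OF fin ne])
    fix T :: "'l \<times> 'r \<times> 'r \<Rightarrow> (nat \<Rightarrow>\<^sub>0 'k) \<Rightarrow> (nat \<Rightarrow>\<^sub>0 'k)" assume T: "mu_irr \<Lambda> R n T"
    then have rep: "mu_rep \<Lambda> R n T" by (simp add: mu_irr_def)
    note r = rep_op_rep[of T, OF mu_repD(1)[OF rep]]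
    have i: "mu_iso \<Lambda> R n (rep_op (op_rep T)) T" by (rule mu_iso_refl_on) (simp add: r)
    have "irreducible_rep A n (op_rep T)"
      unfolding irr_mu using op_rep_is_rep[OF rep] rep_mu[OF op_rep_is_rep[OF rep]] T
      by (auto simp: mu_irr_def r)
    with i show "\<exists>x\<in>{\<alpha>. irreducible_rep A n \<alpha>}. mu_iso \<Lambda> R n (rep_op x) T" by blast
  qed (auto simp: irr_mu rep_iso_mu)
qed

lemma irrep_dim: "irreducible_rep A n \<alpha> \<Longrightarrow> \<exists>l\<in>\<Lambda>. n = card (R l)"
  using mu_irr_std[of \<Lambda> R n "rep_op \<alpha>", OF fin ne] by (auto simp: irr_mu)

end

section \<open>Coalgebras with a basis of matrix coefficients\<close>

text \<open>This is \<open>id \<otimes> p\<close>, the slice of a tensor by a functional on the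
  second factor.\<close>

definition contract :: "('j \<Rightarrow>\<^sub>0 'k::field) \<Rightarrow> ('i \<times> 'j \<Rightarrow>\<^sub>0 'k) \<Rightarrow> ('i \<Rightarrow>\<^sub>0 'k)"
  where "contract p = lin (\<lambda>(m, i). smul (pairing p (bv i)) (bv m))"

lemma lnr_contract [lnr_intros]: "lnr f \<Longrightarrow> lnr (\<lambda>v. contract p (f v))"
  unfolding contract_def by (intro lnr_intros)

lemma contract_tens [simp]: "contract p (tens v h) = smul (pairing p h) v"
  unfolding contract_def
  by (rule lin_bilinear[of "\<lambda>v h. smul (pairing p h) v"]) (intro lnr_intros)+

lemma contract_linear:
  "contract p (\<Sum>t\<in>A. g t) = (\<Sum>t\<in>A. contract p (g t))"
  "contract p (smul c v) = smul c (contract p v)"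
  by (simp_all add: lnr_sum[OF lnr_contract[OF lnr_id]] lnr_smul[OF lnr_contract[OF lnr_id]])

lemma contract_closed: "v \<in> vsp (I \<times> J) \<Longrightarrow> contract p v \<in> vsp I"
  unfolding contract_def by (rule lin_closed) auto

lemma contract_expand:
  assumes d: "dframe J T b f" and w: "w \<in> vsp (I \<times> J)"
  shows "w = (\<Sum>t\<in>T. tens (contract (f t) w) (b t))"
proof (rule lnr_ext[OF lnr_id _ w])
  show "lnr (\<lambda>w. \<Sum>t\<in>T. tens (contract (f t) w) (b t))" by (intro lnr_intros)
  fix ij assume "ij \<in> I \<times> J"
  then obtain i j where ij: "ij = (i, j)" "j \<in> J" by auto
  have "tens (bv i) (bv j) = tens (bv i) (\<Sum>t\<in>T. smul (pairing (f t) (bv j)) (b t))"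
    using dframeD(6)[OF d, of "bv j"] ij by simp
  also have "\<dots> = (\<Sum>t\<in>T. tens (contract (f t) (tens (bv i) (bv j))) (b t))"
    by (simp add: tens_linear del: tens_bv pairing_bv smul_single)
  finally show "bv ij = (\<Sum>t\<in>T. tens (contract (f t) (bv ij)) (b t))" by (simp add: ij)
qed

lemma contract_eqI:
  assumes "dframe J T b f" "w \<in> vsp (I \<times> J)" "w' \<in> vsp (I \<times> J)"
    "\<And>t. t \<in> T \<Longrightarrow> contract (f t) w = contract (f t) w'"
  shows "w = w'"
proof -
  have "w = (\<Sum>t\<in>T. tens (contract (f t) w) (b t))" by (rule contract_expand[OF assms(1,2)])
  also have "\<dots> = (\<Sum>t\<in>T. tens (contract (f t) w') (b t))" by (intro sum.cong) (simp_all add: assms(4))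
  also have "\<dots> = w'" by (rule contract_expand[OF assms(1,3), symmetric])
  finally show ?thesis .
qed

text \<open>\<open>P\<close> is a family of comatrix units. Its dual family \<open>f\<close> would
  be a system of matrix units in the dual algebra; slicing by \<open>f\<close> gives their action on
  a comodule without forming that algebra.\<close>

locale comat =
  fixes H :: "('i, 'k::field) hopf" and \<Lambda> :: "'l set" and R :: "'l \<Rightarrow> 'r set"
    and P f :: "'l \<times> 'r \<times> 'r \<Rightarrow> ('i \<Rightarrow>\<^sub>0 'k)"
  assumes fin: "finite \<Lambda>" "\<And>l. l \<in> \<Lambda> \<Longrightarrow> finite (R l)" and ne: "\<And>l. l \<in> \<Lambda> \<Longrightarrow> R l \<noteq> {}"
    and frame: "dframe (basis H) (mix \<Lambda> R) P f"
    and comult_P: "\<And>l r s. (l, r, s) \<in> mix \<Lambda> R \<Longrightarrow>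
      comult H (P (l, r, s)) = (\<Sum>q\<in>R l. tens (P (l, r, q)) (P (l, q, s)))"
    and counit_P: "\<And>l r s. (l, r, s) \<in> mix \<Lambda> R \<Longrightarrow> counit H (P (l, r, s)) = (if r = s then 1 else 0)"
begin

lemma sum_mix': "(\<Sum>t\<in>mix \<Lambda> R. g t) = (\<Sum>l\<in>\<Lambda>. \<Sum>r\<in>R l. \<Sum>s\<in>R l. g (l, r, s))"
  by (rule sum_mix) (use fin in auto)

lemma P_closed: "t \<in> mix \<Lambda> R \<Longrightarrow> P t \<in> space H"
  by (rule dframeD(3)[OF frame])

lemma f_P: "t \<in> mix \<Lambda> R \<Longrightarrow> t' \<in> mix \<Lambda> R \<Longrightarrow> pairing (f t) (P t') = (if t = t' then 1 else 0)"
  by (rule dframeD(5)[OF frame])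

lemma comult_closed: "v \<in> space H \<Longrightarrow> comult H v \<in> vsp (basis H \<times> basis H)"
proof (rule dframe_closed[OF frame lnr_comult'])
  fix t assume t: "t \<in> mix \<Lambda> R"
  then show "comult H (P t) \<in> vsp (basis H \<times> basis H)"
    by (cases t) (auto simp: comult_P intro!: vsp_sum tens_closed P_closed)
qed auto

lemma is_coalgebra: "is_coalgebra H"
  unfolding is_coalgebra_def
proof (intro conjI ballI)
  fix i assume "i \<in> basis H"
  then show "bcomult H i \<in> vsp (basis H \<times> basis H)" using comult_closed[of "bv i"] by simp
next
  fix a assume a: "a \<in> space H"
  show "reassoc (tmap (comult H) id (comult H a)) = tmap id (comult H) (comult H a)"
  proof (rule dframe_ext[OF frame _ _ _ a])
    fix t assume t: "t \<in> mix \<Lambda> R"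
    obtain l r s where t': "t = (l, r, s)" by (cases t)
    have "reassoc (tmap (comult H) id (comult H (P t)))
       = (\<Sum>q\<in>R l. \<Sum>p\<in>R l. tens (P (l, r, p)) (tens (P (l, p, q)) (P (l, q, s))))"
      using t unfolding t'
      by (simp add: comult_P lnr_sum[OF lnr_tmap[OF lnr_id]] lnr_sum[OF lnr_reassoc[OF lnr_id]] tens_linear)
    also have "\<dots> = tmap id (comult H) (comult H (P t))"
      using t unfolding t'
      by (subst sum.swap) (simp add: comult_P lnr_sum[OF lnr_tmap[OF lnr_id]] tens_linear)
    finally show "reassoc (tmap (comult H) id (comult H (P t))) = tmap id (comult H) (comult H (P t))" .
  qed (intro lnr_intros)+
  show "lin (\<lambda>(i, j). smul (bcounit H i) (bv j)) (comult H a) = a"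
  proof (rule dframe_ext[OF frame _ _ _ a])
    fix t assume t: "t \<in> mix \<Lambda> R"
    obtain l r s where t': "t = (l, r, s)" by (cases t)
    have "lin (\<lambda>(i, j). smul (bcounit H i) (bv j)) (comult H (P t)) = (\<Sum>q\<in>R l. if q = r then P (l, q, s) else 0)"
      using t unfolding t'
      by (simp add: comult_P lnr_sum[OF lnr_lin] del: smul_single) (intro sum.cong, auto simp: counit_P)
    also have "\<dots> = P t" using t fin by (simp add: t')
    finally show "lin (\<lambda>(i, j). smul (bcounit H i) (bv j)) (comult H (P t)) = P t" .
  qed (intro lnr_intros)+
  show "lin (\<lambda>(i, j). smul (bcounit H j) (bv i)) (comult H a) = a"
  proof (rule dframe_ext[OF frame _ _ _ a])
    fix t assume t: "t \<in> mix \<Lambda> R"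
    obtain l r s where t': "t = (l, r, s)" by (cases t)
    have "lin (\<lambda>(i, j). smul (bcounit H j) (bv i)) (comult H (P t)) = (\<Sum>q\<in>R l. if q = s then P (l, r, q) else 0)"
      using t unfolding t'
      by (simp add: comult_P lnr_sum[OF lnr_lin] del: smul_single) (intro sum.cong, auto simp: counit_P)
    also have "\<dots> = P t" using t fin by (simp add: t')
    finally show "lin (\<lambda>(i, j). smul (bcounit H j) (bv i)) (comult H (P t)) = P t" .
  qed (intro lnr_intros)+
qed

section \<open>Comodules over a coalgebra as matrix unit operators\<close>

definition corep_op :: "((nat \<Rightarrow>\<^sub>0 'k) \<Rightarrow> (nat \<times> 'i \<Rightarrow>\<^sub>0 'k)) \<Rightarrow> 'l \<times> 'r \<times> 'r \<Rightarrow> (nat \<Rightarrow>\<^sub>0 'k) \<Rightarrow> (nat \<Rightarrow>\<^sub>0 'k)"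
  where "corep_op \<delta> t v = contract (f t) (\<delta> v)"

definition op_corep :: "('l \<times> 'r \<times> 'r \<Rightarrow> (nat \<Rightarrow>\<^sub>0 'k) \<Rightarrow> (nat \<Rightarrow>\<^sub>0 'k)) \<Rightarrow> (nat \<Rightarrow>\<^sub>0 'k) \<Rightarrow> (nat \<times> 'i \<Rightarrow>\<^sub>0 'k)"
  where "op_corep T v = (\<Sum>t\<in>mix \<Lambda> R. tens (T t v) (P t))"

lemma corep_expand:
  assumes "lmap {..<n} ({..<n} \<times> basis H) \<delta>" "v \<in> vsp {..<n}"
  shows "\<delta> v = (\<Sum>t\<in>mix \<Lambda> R. tens (corep_op \<delta> t v) (P t))"
  unfolding corep_op_def
  by (rule contract_expand[OF frame]) (use assms in \<open>auto simp: lmap_iff\<close>)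

text \<open>Since \<open>T\<close> is arbitrary, one computation serves both to extract the matrix
  unit relations from a comodule and to verify coassociativity when the relations are given.\<close>

lemma coassoc_side:
  assumes that: "(x, r, s) \<in> mix \<Lambda> R" "(x', r', s') \<in> mix \<Lambda> R"
  shows "contract (tens (f (x, r, s)) (f (x', r', s'))) (tmap id (comult H) (op_corep T v))
    = (if x = x' \<and> s = r' then T (x, r, s') v else 0)"
proof -
  have "contract (tens (f (x, r, s)) (f (x', r', s'))) (tmap id (comult H) (op_corep T v))
    = (\<Sum>l\<in>\<Lambda>. \<Sum>p\<in>R l. \<Sum>u\<in>R l. \<Sum>q\<in>R l.
        smul (pairing (f (x, r, s)) (P (l, p, q)) * pairing (f (x', r', s')) (P (l, q, u))) (T (l, p, u) v))"
    unfolding op_corep_def sum_mix' lnr_sum[OF lnr_tmap[OF lnr_id]] contract_linear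
    by (intro sum.cong) (auto simp: comult_P tens_linear contract_linear)
  also have "\<dots> = (\<Sum>l\<in>\<Lambda>. \<Sum>p\<in>R l. \<Sum>u\<in>R l. \<Sum>q\<in>R l.
      if q = s then if u = s' then if p = r then if l = x then if x = x' \<and> s = r' then T (x, r, s') v else 0 else 0 else 0 else 0 else 0)"
    by (intro sum.cong) (use that in \<open>auto simp: f_P\<close>)
  also have "\<dots> = (\<Sum>l\<in>\<Lambda>. if l = x then \<Sum>p\<in>R x. if p = r then \<Sum>u\<in>R x. if u = s' then \<Sum>q\<in>R x.
      if q = s then if x = x' \<and> s = r' then T (x, r, s') v else 0 else 0 else 0 else 0 else 0)"
    by (intro sum.cong) (auto intro!: sum.cong sum.neutral)
  also have "\<dots> = (if x = x' \<and> s = r' then T (x, r, s') v else 0)"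
    using that fin by auto
  finally show ?thesis .
qed

text \<open>Slicing the coassociativity law by two dual functionals gives the products of the
  operators, and the counit law gives the decomposition of the identity.\<close>

lemma corep_mu:
  assumes "is_corep H n \<delta>"
  shows "mu_rep \<Lambda> R n (corep_op \<delta>)"
proof -
  have lm: "lmap {..<n} ({..<n} \<times> basis H) \<delta>"
    and ca: "\<And>v. v \<in> vsp {..<n} \<Longrightarrow> reassoc (tmap \<delta> id (\<delta> v)) = tmap id (comult H) (\<delta> v)"
    and cu: "\<And>v. v \<in> vsp {..<n} \<Longrightarrow> lin (\<lambda>(m, i). smul (bcounit H i) (bv m)) (\<delta> v) = v"
    using assms unfolding is_corep_def by blast+
  have l: "lnr \<delta>" and cl: "\<And>v. v \<in> vsp {..<n} \<Longrightarrow> \<delta> v \<in> vsp ({..<n} \<times> basis H)"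
    using lm by (auto simp: lmap_iff)
  have lop: "lnr (corep_op \<delta> t)" for t
    unfolding corep_op_def[abs_def] by (intro lnr_intros l)
  have op_cl: "corep_op \<delta> t v \<in> vsp {..<n}" if "v \<in> vsp {..<n}" for t v
    unfolding corep_op_def by (rule contract_closed) (rule cl[OF that])
  have ex: "\<delta> v = op_corep (corep_op \<delta>) v" if "v \<in> vsp {..<n}" for v
    unfolding op_corep_def by (rule corep_expand[OF lm that])
  show ?thesis
    unfolding mu_rep_def
  proof (intro conjI ballI allI impI)
    fix t assume "t \<in> mix \<Lambda> R"
    show "lmap {..<n} {..<n} (corep_op \<delta> t)" using lop op_cl by (auto simp: lmap_iff)
  next
    fix x r s x' r' s' and v :: "nat \<Rightarrow>\<^sub>0 'k"
    assume m: "(x, r, s) \<in> mix \<Lambda> R" "(x', r', s') \<in> mix \<Lambda> R" and v: "v \<in> vsp {..<n}"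
    let ?c = "contract (tens (f (x, r, s)) (f (x', r', s')))"
    have "reassoc (tmap \<delta> id (\<delta> v)) = (\<Sum>t\<in>mix \<Lambda> R. reassoc (tens (\<delta> (corep_op \<delta> t v)) (P t)))"
      by (subst corep_expand[OF lm v]) (simp add: lnr_sum[OF lnr_tmap[OF lnr_id]] lnr_sum[OF lnr_reassoc[OF lnr_id]] l)
    \<comment> \<open>The operator applied last is paired with the first of the two factors from
      \<open>H\<close>, so composites appear in the same order as products of matrix units.\<close>
    also have "\<dots> = (\<Sum>t\<in>mix \<Lambda> R. \<Sum>t'\<in>mix \<Lambda> R. tens (corep_op \<delta> t' (corep_op \<delta> t v)) (tens (P t') (P t)))"
      by (subst corep_expand[OF lm op_cl[OF v]]) (simp add: tens_linear lnr_sum[OF lnr_reassoc[OF lnr_id]])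
    finally have "?c (reassoc (tmap \<delta> id (\<delta> v))) = (\<Sum>t\<in>mix \<Lambda> R. \<Sum>t'\<in>mix \<Lambda> R.
        smul (pairing (f (x, r, s)) (P t') * pairing (f (x', r', s')) (P t)) (corep_op \<delta> t' (corep_op \<delta> t v)))"
      by (simp add: contract_linear)
    also have "\<dots> = (\<Sum>t\<in>mix \<Lambda> R. \<Sum>t'\<in>mix \<Lambda> R. if t' = (x, r, s) then if t = (x', r', s') then
        corep_op \<delta> (x, r, s) (corep_op \<delta> (x', r', s') v) else 0 else 0)"
      by (intro sum.cong) (use m in \<open>auto simp: f_P\<close>)
    also have "\<dots> = corep_op \<delta> (x, r, s) (corep_op \<delta> (x', r', s') v)"
      using m dframeD(2)[OF frame] by simp
    finally show "corep_op \<delta> (x, r, s) (corep_op \<delta> (x', r', s') v) = (if x = x' \<and> s = r' then corep_op \<delta> (x, r, s') v else 0)"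
      using coassoc_side[OF m, of "corep_op \<delta>" v] m unfolding ca[OF v] ex[OF v, symmetric] by simp
  next
    fix v :: "nat \<Rightarrow>\<^sub>0 'k" assume v: "v \<in> vsp {..<n}"
    have *: "lin (\<lambda>(m, i). smul (bcounit H i) (bv m)) (tens w h) = smul (counit H h) w" for w :: "nat \<Rightarrow>\<^sub>0 'k" and h
      using lin_bilinear[of "\<lambda>w h. smul (counit H h) w" w h] by (simp add: lnr_intros del: smul_single)
    have "v = lin (\<lambda>(m, i). smul (bcounit H i) (bv m)) (\<Sum>t\<in>mix \<Lambda> R. tens (corep_op \<delta> t v) (P t))"
      using cu[OF v] corep_expand[OF lm v] by simp
    also have "\<dots> = (\<Sum>x\<in>\<Lambda>. \<Sum>r\<in>R x. \<Sum>s\<in>R x. if r = s then corep_op \<delta> (x, r, r) v else 0)"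
      unfolding lnr_sum[OF lnr_lin] sum_mix' * by (intro sum.cong) (auto simp: counit_P)
    also have "\<dots> = (\<Sum>x\<in>\<Lambda>. \<Sum>r\<in>R x. corep_op \<delta> (x, r, r) v)"
      using fin by (intro sum.cong) auto
    finally show "(\<Sum>x\<in>\<Lambda>. \<Sum>r\<in>R x. corep_op \<delta> (x, r, r) v) = v" ..
  qed
qed

lemma corep_op_corep:
  assumes "t \<in> mix \<Lambda> R"
  shows "corep_op (op_corep T) t v = T t v"
proof -
  have "corep_op (op_corep T) t v = (\<Sum>t'\<in>mix \<Lambda> R. if t' = t then T t v else 0)"
    unfolding corep_op_def op_corep_def contract_linear contract_tens
    by (intro sum.cong) (use assms in \<open>auto simp: f_P\<close>)
  then show ?thesis using assms dframeD(2)[OF frame] by simp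
qed

lemma op_corep_is_corep:
  assumes T: "mu_rep \<Lambda> R n T"
  shows "is_corep H n (op_corep T)"
proof -
  note l = mu_repD(1)[OF T] and cl = mu_repD(2)[OF T]
  have lo: "lnr (op_corep T)" unfolding op_corep_def[abs_def] by (intro lnr_intros l)
  have o_cl: "op_corep T v \<in> vsp ({..<n} \<times> basis H)" if "v \<in> vsp {..<n}" for v
    unfolding op_corep_def by (intro vsp_sum tens_closed cl P_closed that)
  have cc: "tmap id (comult H) w \<in> vsp ({..<n} \<times> basis H \<times> basis H)" if "w \<in> vsp ({..<n} \<times> basis H)" for w
    unfolding tmap_def by (rule lin_closed[OF that]) (auto intro!: tens_closed comult_closed simp del: comult_bv)
  show ?thesis
    unfolding is_corep_def
  proof (intro conjI ballI)
    show "lmap {..<n} ({..<n} \<times> basis H) (op_corep T)" using lo o_cl by (auto simp: lmap_iff)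
    fix v :: "nat \<Rightarrow>\<^sub>0 'k" assume v: "v \<in> vsp {..<n}"
    have e: "reassoc (tmap (op_corep T) id (op_corep T v))
      = (\<Sum>t\<in>mix \<Lambda> R. \<Sum>t'\<in>mix \<Lambda> R. tens (T t' (T t v)) (tens (P t') (P t)))"
      by (subst op_corep_def[of T v])
        (simp add: lnr_sum[OF lnr_tmap[OF lnr_id]] lo tens_linear op_corep_def[of T "T _ v"] lnr_sum[OF lnr_reassoc[OF lnr_id]])
    show "reassoc (tmap (op_corep T) id (op_corep T v)) = tmap id (comult H) (op_corep T v)"
    proof (rule contract_eqI[OF dframe_tens[OF frame frame]])
      show "reassoc (tmap (op_corep T) id (op_corep T v)) \<in> vsp ({..<n} \<times> basis H \<times> basis H)"
        unfolding e by (intro vsp_sum tens_closed cl P_closed v)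
      show "tmap id (comult H) (op_corep T v) \<in> vsp ({..<n} \<times> basis H \<times> basis H)"
        by (intro cc o_cl v)
      fix t assume "t \<in> mix \<Lambda> R \<times> mix \<Lambda> R"
      then obtain x r s x' r' s' where t: "t = ((x, r, s), (x', r', s'))"
        and m: "(x, r, s) \<in> mix \<Lambda> R" "(x', r', s') \<in> mix \<Lambda> R" by (cases t) auto
      let ?c = "contract (tens (f (x, r, s)) (f (x', r', s')))"
      have "?c (reassoc (tmap (op_corep T) id (op_corep T v))) = (\<Sum>t\<in>mix \<Lambda> R. \<Sum>t'\<in>mix \<Lambda> R.
        if t' = (x, r, s) then if t = (x', r', s') then T (x, r, s) (T (x', r', s') v) else 0 else 0)"
        unfolding e contract_linear by (intro sum.cong) (use m in \<open>auto simp: f_P\<close>)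
      also have "\<dots> = T (x, r, s) (T (x', r', s') v)"
        using m dframeD(2)[OF frame] by simp
      finally show "contract (case t of (t, u) \<Rightarrow> tens (f t) (f u)) (reassoc (tmap (op_corep T) id (op_corep T v)))
        = contract (case t of (t, u) \<Rightarrow> tens (f t) (f u)) (tmap id (comult H) (op_corep T v))"
        using coassoc_side[OF m, of T v] mu_repD(3)[OF T m v] m by (simp add: t)
    qed
    have *: "lin (\<lambda>(m, i). smul (bcounit H i) (bv m)) (tens w h) = smul (counit H h) w" for w :: "nat \<Rightarrow>\<^sub>0 'k" and h
      using lin_bilinear[of "\<lambda>w h. smul (counit H h) w" w h] by (simp add: lnr_intros del: smul_single)
    have "lin (\<lambda>(m, i). smul (bcounit H i) (bv m)) (op_corep T v)
      = (\<Sum>x\<in>\<Lambda>. \<Sum>r\<in>R x. \<Sum>s\<in>R x. if r = s then T (x, r, r) v else 0)"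
      unfolding op_corep_def lnr_sum[OF lnr_lin] sum_mix' * by (intro sum.cong) (auto simp: counit_P)
    also have "\<dots> = (\<Sum>x\<in>\<Lambda>. \<Sum>r\<in>R x. T (x, r, r) v)"
      using fin by (intro sum.cong) auto
    finally show "lin (\<lambda>(m, i). smul (bcounit H i) (bv m)) (op_corep T v) = v"
      using mu_repD(4)[OF T v] by simp
  qed
qed

text \<open>Slices of \<open>W \<otimes> H\<close> lie in \<open>W\<close>, and conversely a
  coaction is recovered from its slices.\<close>

lemma corep_stable_iff:
  assumes "lmap {..<n} ({..<n} \<times> basis H) \<delta>" "pm.subspace W" "W \<subseteq> vsp {..<n}"
  shows "\<delta> ` W \<subseteq> pm.span {tens w h |w h. w \<in> W \<and> h \<in> space H} \<longleftrightarrow> (\<forall>t\<in>mix \<Lambda> R. \<forall>w\<in>W. corep_op \<delta> t w \<in> W)"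
proof
  assume *: "\<delta> ` W \<subseteq> pm.span {tens w h |w h. w \<in> W \<and> h \<in> space H}"
  show "\<forall>t\<in>mix \<Lambda> R. \<forall>w\<in>W. corep_op \<delta> t w \<in> W"
  proof (intro ballI)
    fix t w assume "t \<in> mix \<Lambda> R" "w \<in> W"
    then have "\<delta> w \<in> pm.span {tens w h |w h. w \<in> W \<and> h \<in> space H}" using * by blast
    then show "corep_op \<delta> t w \<in> W"
      unfolding corep_op_def
      by (rule span_closed[OF lnr_contract[OF lnr_id] _ assms(2)]) (auto intro: pm.subspace_scale[OF assms(2)])
  qed
next
  assume *: "\<forall>t\<in>mix \<Lambda> R. \<forall>w\<in>W. corep_op \<delta> t w \<in> W"
  show "\<delta> ` W \<subseteq> pm.span {tens w h |w h. w \<in> W \<and> h \<in> space H}"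
  proof
    fix u assume "u \<in> \<delta> ` W"
    then obtain w where w: "w \<in> W" "u = \<delta> w" by blast
    have "\<delta> w = (\<Sum>t\<in>mix \<Lambda> R. tens (corep_op \<delta> t w) (P t))"
      by (rule corep_expand[OF assms(1)]) (use w assms(3) in blast)
    also have "\<dots> \<in> pm.span {tens w h |w h. w \<in> W \<and> h \<in> space H}"
      by (intro pm.span_sum pm.span_base) (use * w P_closed in blast)
    finally show "u \<in> pm.span {tens w h |w h. w \<in> W \<and> h \<in> space H}" by (simp add: w)
  qed
qed

lemma irr_mu: "irreducible_corep H n \<delta> \<longleftrightarrow> is_corep H n \<delta> \<and> mu_irr \<Lambda> R n (corep_op \<delta>)"
proof -
  have lm: "lmap {..<n} ({..<n} \<times> basis H) \<delta>" if "is_corep H n \<delta>" using that by (simp add: is_corep_def)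
  show ?thesis
    unfolding irreducible_corep_def mu_irr_def using corep_mu corep_stable_iff[OF lm] by (metis (no_types, lifting))
qed

lemma corep_iso_mu:
  assumes "is_corep H n \<delta>" "is_corep H n \<gamma>"
  shows "corep_iso H n \<delta> \<gamma> \<longleftrightarrow> mu_iso \<Lambda> R n (corep_op \<delta>) (corep_op \<gamma>)"
proof -
  have lm: "lmap {..<n} ({..<n} \<times> basis H) \<delta>" "lmap {..<n} ({..<n} \<times> basis H) \<gamma>"
    using assms by (auto simp: is_corep_def)
  have "(\<forall>v\<in>vsp {..<n}. tmap \<phi> id (\<delta> v) = \<gamma> (\<phi> v))
      \<longleftrightarrow> (\<forall>t\<in>mix \<Lambda> R. \<forall>v\<in>vsp {..<n}. \<phi> (corep_op \<delta> t v) = corep_op \<gamma> t (\<phi> v))"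
    if \<phi>: "lmap {..<n} {..<n} \<phi>" for \<phi>
  proof -
    have l: "lnr \<phi>" and cl: "\<And>v. v \<in> vsp {..<n} \<Longrightarrow> \<phi> v \<in> vsp {..<n}" using \<phi> by (auto simp: lmap_iff)
    have e: "tmap \<phi> id (\<delta> v) = (\<Sum>t\<in>mix \<Lambda> R. tens (\<phi> (corep_op \<delta> t v)) (P t))" if "v \<in> vsp {..<n}" for v
      by (subst corep_expand[OF lm(1) that]) (simp add: lnr_sum[OF lnr_tmap[OF lnr_id]] l)
    have g: "\<gamma> (\<phi> v) = (\<Sum>t\<in>mix \<Lambda> R. tens (corep_op \<gamma> t (\<phi> v)) (P t))" if "v \<in> vsp {..<n}" for v
      by (rule corep_expand[OF lm(2) cl[OF that]])
    have c: "contract (f t) (tmap \<phi> id (\<delta> v)) = \<phi> (corep_op \<delta> t v)" if t: "t \<in> mix \<Lambda> R" and v: "v \<in> vsp {..<n}" for t v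
    proof -
      have "contract (f t) (tmap \<phi> id (\<delta> v)) = (\<Sum>t'\<in>mix \<Lambda> R. if t' = t then \<phi> (corep_op \<delta> t v) else 0)"
        unfolding e[OF v] contract_linear by (intro sum.cong) (use t in \<open>auto simp: f_P\<close>)
      then show ?thesis using t dframeD(2)[OF frame] by simp
    qed
    show ?thesis
    proof
      assume *: "\<forall>v\<in>vsp {..<n}. tmap \<phi> id (\<delta> v) = \<gamma> (\<phi> v)"
      show "\<forall>t\<in>mix \<Lambda> R. \<forall>v\<in>vsp {..<n}. \<phi> (corep_op \<delta> t v) = corep_op \<gamma> t (\<phi> v)"
        using * c by (auto simp: corep_op_def[of \<gamma>])
    next
      assume *: "\<forall>t\<in>mix \<Lambda> R. \<forall>v\<in>vsp {..<n}. \<phi> (corep_op \<delta> t v) = corep_op \<gamma> t (\<phi> v)"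
      show "\<forall>v\<in>vsp {..<n}. tmap \<phi> id (\<delta> v) = \<gamma> (\<phi> v)"
        using * by (simp add: e g)
    qed
  qed
  then show ?thesis unfolding corep_iso_def mu_iso_def by blast
qed

lemma card_corep_classes:
  "finite (irred_corep_classes H n) \<and> card (irred_corep_classes H n) = card {l \<in> \<Lambda>. card (R l) = n}"
proof -
  have e: "irred_corep_classes H n = {\<delta>. irreducible_corep H n \<delta>} //
    {(\<delta>, \<gamma>). \<delta> \<in> {\<delta>. irreducible_corep H n \<delta>} \<and> \<gamma> \<in> {\<delta>. irreducible_corep H n \<delta>} \<and> corep_iso H n \<delta> \<gamma>}"
    by (simp add: irred_corep_classes_def)
  show ?thesis
    unfolding e
  proof (rule mu_count[of \<Lambda> R _ _ corep_op, OF fin ne])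
    fix T :: "'l \<times> 'r \<times> 'r \<Rightarrow> (nat \<Rightarrow>\<^sub>0 'k) \<Rightarrow> (nat \<Rightarrow>\<^sub>0 'k)" assume T: "mu_irr \<Lambda> R n T"
    then have rep: "mu_rep \<Lambda> R n T" by (simp add: mu_irr_def)
    have i: "mu_iso \<Lambda> R n (corep_op (op_corep T)) T" by (rule mu_iso_refl_on) (simp add: corep_op_corep)
    have "irreducible_corep H n (op_corep T)"
      unfolding irr_mu using op_corep_is_corep[OF rep] corep_mu[OF op_corep_is_corep[OF rep]] T
      by (auto simp: mu_irr_def corep_op_corep)
    with i show "\<exists>x\<in>{\<delta>. irreducible_corep H n \<delta>}. mu_iso \<Lambda> R n (corep_op x) T" by blast
  qed (auto simp: irr_mu corep_iso_mu)
qed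

lemma corep_dim: "irreducible_corep H n \<delta> \<Longrightarrow> \<exists>l\<in>\<Lambda>. n = card (R l)"
  using mu_irr_std[of \<Lambda> R n "corep_op \<delta>", OF fin ne] by (auto simp: irr_mu)

end

section \<open>The dual and the Drinfeld double\<close>

lemma pairing_sum_single': "finite A \<Longrightarrow> a \<in> vsp A \<Longrightarrow> lnr g \<Longrightarrow> 
    pairing (\<Sum>i\<in>A. Poly_Mapping.single i (pairing p (g (bv i)))) a = pairing p (g a)"
  by (rule pairing_sum_single[of A a "\<lambda>a. pairing p (g a)"]) (auto intro: lnr_intros)

lemma lnr_lin_comp: "lnr g \<Longrightarrow> g (lin f v) = lin (\<lambda>i. g (f i)) v"
  by (simp add: lin_def lnr_sum lnr_smul)

lemma lin_trilinear:
  assumes "\<And>b c. lnr (\<lambda>a. h a b c)" "\<And>a c. lnr (\<lambda>b. h a b c)" "\<And>a b. lnr (\<lambda>c. h a b c)"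
  shows "lin (\<lambda>(i, j, l). h (bv i) (bv j) (bv l)) (tens u (tens v w)) = h u v w"
proof -
  have 1: "lin (\<lambda>(j, l). h (bv i) (bv j) (bv l)) (tens v w) = h (bv i) v w" for i
    by (rule lin_bilinear[of "\<lambda>b c. h (bv i) b c"]) (rule assms)+
  have "lin (\<lambda>(i, j, l). h (bv i) (bv j) (bv l)) (tens u (tens v w))
      = lin (\<lambda>i. lin (\<lambda>(j, l). h (bv i) (bv j) (bv l)) (tens v w)) u"
    by (subst lin_tens) (simp add: split_def)
  also have "\<dots> = h u v w" using lnr_eq_lin[OF assms(1), of u v w] by (simp add: 1)
  finally show ?thesis .
qed

lemma lfn_ext: "lfn f \<Longrightarrow> lfn g \<Longrightarrow> (\<And>i. f (bv i) = g (bv i)) \<Longrightarrow> f v = g v"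
  using lfn_eq_lfun[of f v] lfn_eq_lfun[of g v] by simp

lemma dual_basis [simp]: "basis (dual H) = basis H"
  by (simp add: dual_def)

lemma mul_dual_closed: "finite (basis H) \<Longrightarrow> mul (dual H) p q \<in> space H"
  unfolding mul_def lin_def by (auto intro!: vsp_sum vsp_intros simp: dual_def)

lemma pairing_mul_dual:
  assumes fin: "finite (basis H)" and a: "a \<in> space H"
  shows "pairing (mul (dual H) p q) a = pairing (tens p q) (comult H a)"
proof (rule lfn_bilinear_eq[of "\<lambda>p q. pairing (mul (dual H) p q) a" "\<lambda>p q. pairing (tens p q) (comult H a)"])
  fix i j
  have "pairing (\<Sum>l\<in>basis H. Poly_Mapping.single l (pairing (bv (i, j)) (comult H (bv l)))) a
      = pairing (bv (i, j)) (comult H a)"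
    by (rule pairing_sum_single'[OF fin a lnr_comult'])
  then show "pairing (mul (dual H) (bv i) (bv j)) a = pairing (tens (bv i) (bv j)) (comult H a)"
    by (simp add: dual_def)
qed (intro lnr_intros)+

lemma pairing_unt_dual: "finite (basis H) \<Longrightarrow> a \<in> space H \<Longrightarrow> pairing (unt (dual H)) a = counit H a"
  using pairing_sum_single[of "basis H" a "counit H"] by (simp add: dual_def lnr_intros)

lemma unt_dual_closed: "unt (dual H) \<in> space H"
  by (auto simp: dual_def)

lemma counit_dual: "counit (dual H) p = pairing p (unt H)"
  by (simp add: counit_def dual_def pairing_commute[of p]) (simp add: pairing_def)

lemma comult_dual_closed: "p \<in> space H \<Longrightarrow> comult (dual H) p \<in> vsp (basis H \<times> basis H)"
  unfolding comult_def by (erule lin_closed) (auto simp: dual_def)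

lemma pairing_comult_dual:
  assumes fin: "finite (basis H)" and a: "a \<in> space H" and b: "b \<in> space H"
  shows "pairing (comult (dual H) p) (tens a b) = pairing p (mul H a b)"
proof -
  have "pairing (comult (dual H) (bv l)) (tens a b) = pairing (bv l) (mul H a b)" for l
  proof -
    have "lnr (\<lambda>w. lin (\<lambda>(i, j). bmult H i j) w)" by (rule lnr_lin)
    then have "pairing (\<Sum>ij\<in>basis H \<times> basis H. Poly_Mapping.single ij
          (pairing (bv l) (lin (\<lambda>(i, j). bmult H i j) (bv ij)))) (tens a b)
        = pairing (bv l) (lin (\<lambda>(i, j). bmult H i j) (tens a b))"
      by (intro pairing_sum_single') (use fin a b in auto)
    then show ?thesis
      by (simp add: dual_def mul_def split_def)
  qed
  moreover have "lfn (\<lambda>p. pairing (comult (dual H) p) (tens a b))" "lfn (\<lambda>p. pairing p (mul H a b))"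
    by (intro lnr_intros)+
  ultimately show ?thesis
    using lfn_ext[of "\<lambda>p. pairing (comult (dual H) p) (tens a b)" "\<lambda>p. pairing p (mul H a b)" p] by blast
qed

lemma antipode_dual_closed: "p \<in> space H \<Longrightarrow> antipode (dual H) p \<in> space H"
  unfolding antipode_def by (erule lin_closed) (auto simp: dual_def)

lemma pairing_antipode_dual:
  assumes fin: "finite (basis H)" and a: "a \<in> space H"
  shows "pairing (antipode (dual H) p) a = pairing p (antipode H a)"
proof -
  have "pairing (antipode (dual H) (bv l)) a = pairing (bv l) (antipode H a)" for l
    using pairing_sum_single'[OF fin a lnr_antipode'[of H], of "bv l"] by (simp add: dual_def)
  moreover have "lfn (\<lambda>p. pairing (antipode (dual H) p) a)" "lfn (\<lambda>p. pairing p (antipode H a))"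
    by (intro lnr_intros)+
  ultimately show ?thesis
    using lfn_ext[of "\<lambda>p. pairing (antipode (dual H) p) a" "\<lambda>p. pairing p (antipode H a)" p] by blast
qed

section \<open>The double of a Hopf algebra with involutive antipode\<close>

text \<open>An involutive antipode may replace the inverse antipode in the definition of the
  double.\<close>

locale fd_hopf_involutive =
  fixes H :: "('i, 'k::field) hopf"
  assumes fd: "is_fd_hopf_algebra H"
    and involutive: "\<And>a. a \<in> space H \<Longrightarrow> antipode H (antipode H a) = a"
begin

lemma fin: "finite (basis H)" and hopf: "is_hopf_algebra H" and alg: "is_algebra H" and coalg: "is_coalgebra H"
  using fd by (auto simp: is_fd_hopf_algebra_def is_hopf_algebra_def)

lemma comult_closed: "a \<in> space H \<Longrightarrow> comult H a \<in> vsp (basis H \<times> basis H)"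
  unfolding comult_def by (erule lin_closed) (use coalg in \<open>auto simp: is_coalgebra_def\<close>)

lemma antipode_closed: "a \<in> space H \<Longrightarrow> antipode H a \<in> space H"
  unfolding antipode_def by (erule lin_closed) (use hopf in \<open>auto simp: is_hopf_algebra_def\<close>)

lemma antipode_inv_eq: "a \<in> space H \<Longrightarrow> antipode_inv H a = antipode H a"
  unfolding antipode_inv_def
proof (rule inv_into_f_eq)
  show "inj_on (antipode H) (space H)" by (rule inj_on_inverseI) (rule involutive)
qed (auto intro: antipode_closed involutive)

text \<open>\<open>coadj\<close> with the antipode in place of \<open>antipode_inv\<close>. The
  latter is a choice of preimage, not known to be linear off \<open>space H\<close>; this version is
  linear in every argument and agrees with \<open>coadj\<close> for third arguments in
  \<open>space H\<close>.\<close>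

definition coad :: "('i \<Rightarrow>\<^sub>0 'k) \<Rightarrow> ('i \<Rightarrow>\<^sub>0 'k) \<Rightarrow> ('i \<Rightarrow>\<^sub>0 'k) \<Rightarrow> ('i \<Rightarrow>\<^sub>0 'k)"
  where "coad a q b = (\<Sum>t\<in>basis H. Poly_Mapping.single t (pairing q (mul H (mul H (antipode H b) (bv t)) a)))"

lemma coad_closed: "coad a q b \<in> space H"
  by (auto simp: coad_def)

lemma pairing_coad: "t \<in> space H \<Longrightarrow> pairing (coad a q b) t = pairing q (mul H (mul H (antipode H b) t) a)"
  unfolding coad_def by (rule pairing_sum_single'[OF fin], assumption, intro lnr_intros)

lemma lnr_single_sum: "(\<And>t. lfn (\<lambda>v. g v t)) \<Longrightarrow> lnr (\<lambda>v. \<Sum>t\<in>A. Poly_Mapping.single t (g v t))"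
  by (simp add: lnr_def lfn_def single_add sum.distrib pm.scale_sum_right)

lemma lnr_coad [lnr_intros]:
  "lnr f \<Longrightarrow> lnr (\<lambda>v. coad (f v) q b)" "lnr f \<Longrightarrow> lnr (\<lambda>v. coad a (f v) b)" "lnr f \<Longrightarrow> lnr (\<lambda>v. coad a q (f v))"
  unfolding coad_def by (intro lnr_single_sum lnr_intros; assumption)+

text \<open>Four linear extensions, one per argument, from the products of basis vectors. Here
  \<open>h\<close> has to range over \<open>basis H\<close>, so that the third legs of its iterated
  coproduct lie where \<open>coadj\<close> and \<open>coad\<close> agree.\<close>

lemma double_mul:
  assumes p: "p \<in> space H" and h: "h \<in> space H" and q: "q \<in> space H" and g: "g \<in> space H"
  shows "mul (double_alg H) (tens p h) (tens q g)
    = lin (\<lambda>(h1, h2, h3). tens (mul (dual H) p (coad (bv h1) q (bv h3))) (mul H (bv h2) g))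
        (tmap id (comult H) (comult H h))" (is "?l p h q g = ?r p h q g")
proof -
  have lr2: "lnr (\<lambda>h. ?r p h q g)" for p q g
    by (intro lnr_intros)
  have lr: "lnr (\<lambda>p. ?r p h q g)" "lnr (\<lambda>q. ?r p h q g)" "lnr (\<lambda>g. ?r p h q g)" for p h q g
    unfolding lin_def split_def by (intro lnr_intros)+
  have ll: "lnr (\<lambda>p. ?l p h q g)" "lnr (\<lambda>h. ?l p h q g)" "lnr (\<lambda>q. ?l p h q g)" "lnr (\<lambda>g. ?l p h q g)" for p h q g
    by (intro lnr_intros)+
  have "?l (bv i) (bv h) (bv j) (bv g) = ?r (bv i) (bv h) (bv j) (bv g)" if "h \<in> basis H" for i h j g
  proof -
    have "tmap id (comult H) (comult H (bv h)) \<in> vsp (basis H \<times> basis H \<times> basis H)"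
      unfolding tmap_def
      by (rule lin_closed[OF comult_closed]) (use that in \<open>auto intro!: tens_closed comult_closed simp del: comult_bv\<close>)
    then have "lin (\<lambda>(h1, h2, h3). tens (mul (dual H) (bv i) (coadj H (bv h1) (bv j) (bv h3))) (mul H (bv h2) (bv g)))
        (tmap id (comult H) (comult H (bv h))) = ?r (bv i) (bv h) (bv j) (bv g)"
      by (rule lin_cong_vsp) (auto simp: coadj_def coad_def antipode_inv_eq simp del: mul_bv pairing_bv pairing_bv')
    then show ?thesis by (simp add: double_alg_def)
  qed
  then have "?l (bv i) (bv h) (bv j) g = ?r (bv i) (bv h) (bv j) g" if "h \<in> basis H" for i h j
    using lnr_ext[OF ll(4) lr(3) g] that by blast
  then have "?l (bv i) (bv h) q g = ?r (bv i) (bv h) q g" if "h \<in> basis H" for i h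
    using lnr_ext[OF ll(3) lr(2) q] that by blast
  then have "?l (bv i) h q g = ?r (bv i) h q g" for i
    using lnr_ext[OF ll(2) lr2 h] by blast
  then show ?thesis using lnr_ext[OF ll(1) lr(1) p] by blast
qed

lemma double_mul_sum:
  assumes "p \<in> space H" "h \<in> space H" "q \<in> space H" "g \<in> space H"
    and "tmap id (comult H) (comult H h) = (\<Sum>s\<in>A. tens (a s) (tens (b s) (c s)))"
  shows "mul (double_alg H) (tens p h) (tens q g)
    = (\<Sum>s\<in>A. tens (mul (dual H) p (coad (a s) q (c s))) (mul H (b s) g))"
proof -
  have "lin (\<lambda>(h1, h2, h3). tens (mul (dual H) p (coad (bv h1) q (bv h3))) (mul H (bv h2) g)) (tens a (tens b c))
    = tens (mul (dual H) p (coad a q c)) (mul H b g)" for a b c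
    by (rule lin_trilinear[of "\<lambda>a b c. tens (mul (dual H) p (coad a q c)) (mul H b g)"]) (intro lnr_intros)+
  then show ?thesis
    unfolding double_mul[OF assms(1-4)] assms(5) lnr_sum[OF lnr_lin] by simp
qed

abbreviation "D \<equiv> drinfeld_double H"

lemma D_basis [simp]: "basis D = basis H \<times> basis H"
  by (simp add: drinfeld_double_def double_alg_def)

lemma D_mul: "mul D = mul (double_alg H)"
  by (intro ext) (simp add: mul_def drinfeld_double_def)

lemma D_unt: "unt D = tens (unt (dual H)) (unt H)"
  by (simp add: drinfeld_double_def double_alg_def)

lemma D_counit: "counit D (tens p h) = pairing p (unt H) * counit H h"
  by (rule lfn_bilinear_eq[of "\<lambda>p h. counit D (tens p h)" "\<lambda>p h. pairing p (unt H) * counit H h"])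
    (auto intro!: lnr_intros simp: drinfeld_double_def dual_def)

text \<open>The permutation of tensor factors in the coproduct of the double; the exchange of
  \<open>p1\<close> and \<open>p2\<close> reflects the opposite coproduct on the dual.\<close>

definition shuffle :: "(('i \<times> 'i) \<times> ('i \<times> 'i) \<Rightarrow>\<^sub>0 'k) \<Rightarrow> (('i \<times> 'i) \<times> ('i \<times> 'i) \<Rightarrow>\<^sub>0 'k)"
  where "shuffle = lin (\<lambda>((p1, p2), (h1, h2)). bv ((p2, h1), (p1, h2)))"

lemma lnr_shuffle: "lnr shuffle"
  unfolding shuffle_def by (rule lnr_lin)

lemma shuffle_tens: "shuffle (tens (tens p1 p2) (tens h1 h2)) = tens (tens p2 h1) (tens p1 h2)"
proof -
  have 1: "lin (\<lambda>(h1, h2). bv ((j, h1), (i, h2))) (tens h1 h2) = tens (tens (bv j) h1) (tens (bv i) h2)" for i j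
    using lin_bilinear[of "\<lambda>h1 h2. tens (tens (bv j) h1) (tens (bv i) h2)" h1 h2] by (simp add: lnr_intros)
  have "shuffle (tens (tens p1 p2) (tens h1 h2)) = lin (\<lambda>(i, j). tens (tens (bv j) h1) (tens (bv i) h2)) (tens p1 p2)"
    by (simp add: shuffle_def lin_tens[of _ "tens p1 p2"] split_def 1[unfolded split_def])
  also have "\<dots> = tens (tens p2 h1) (tens p1 h2)"
    by (rule lin_bilinear[of "\<lambda>p1 p2. tens (tens p2 h1) (tens p1 h2)"]) (intro lnr_intros)+
  finally show ?thesis .
qed

lemma D_comult: "comult D (tens p h) = shuffle (tens (comult (dual H) p) (comult H h))"
proof -
  have "comult D (tens p h) = lin (\<lambda>(i, j). shuffle (tens (comult (dual H) (bv i)) (comult H (bv j)))) (tens p h)"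
    by (simp add: comult_def[of D]) (simp add: drinfeld_double_def shuffle_def)
  also have "\<dots> = shuffle (tens (comult (dual H) p) (comult H h))"
    by (rule lin_bilinear[of "\<lambda>p h. shuffle (tens (comult (dual H) p) (comult H h))"])
      (intro lnr_comp[OF lnr_shuffle] lnr_intros)+
  finally show ?thesis .
qed

lemma D_antipode: "antipode D (tens p h)
    = mul (double_alg H) (tens (unt (dual H)) (antipode H h)) (tens (antipode (dual H) p) (unt H))"
proof -
  have "(\<Sum>t\<in>basis H. Poly_Mapping.single t (Poly_Mapping.lookup (antipode_inv H (bv t)) i)) = antipode (dual H) (bv i)" for i
    by (auto simp: dual_def antipode_inv_eq intro!: sum.cong)
  then have "antipode D (tens p h)
    = lin (\<lambda>(i, j). mul (double_alg H) (tens (unt (dual H)) (antipode H (bv j))) (tens (antipode (dual H) (bv i)) (unt H))) (tens p h)"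
    by (simp add: antipode_def[of D]) (simp add: drinfeld_double_def)
  also have "\<dots> = mul (double_alg H) (tens (unt (dual H)) (antipode H h)) (tens (antipode (dual H) p) (unt H))"
    by (rule lin_bilinear[of "\<lambda>p h. mul (double_alg H) (tens (unt (dual H)) (antipode H h)) (tens (antipode (dual H) p) (unt H))"])
      (intro lnr_intros)+
  finally show ?thesis .
qed

end

text \<open>The convolution product \<open>antipode H * id * S\<close> equals \<open>S\<close> with
  one bracketing and \<open>antipode H\<close> with the other. So a candidate only has to be shown
  to be a right convolution inverse of the identity.\<close>

lemma antipode_unique:
  assumes hopf: "is_hopf_algebra H" and l: "lnr S" and cl: "\<And>a. a \<in> space H \<Longrightarrow> S a \<in> space H"
    and conv: "\<And>a. a \<in> space H \<Longrightarrow> lin (\<lambda>(i, j). mul H (bv i) (S (bv j))) (comult H a) = smul (counit H a) (unt H)"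
    and a: "a \<in> space H"
  shows "S a = antipode H a"
proof -
  have alg: "is_algebra H" and coalg: "is_coalgebra H" using hopf by (auto simp: is_hopf_algebra_def)
  have assoc: "mul H (mul H a b) c = mul H a (mul H b c)" if "a \<in> space H" "b \<in> space H" "c \<in> space H" for a b c
    using alg that by (simp add: is_algebra_def)
  have un: "mul H (unt H) b = b" "mul H b (unt H) = b" if "b \<in> space H" for b
    using alg that by (auto simp: is_algebra_def)
  have Ac: "antipode H a \<in> space H" if "a \<in> space H" for a
    unfolding antipode_def by (rule lin_closed[OF that]) (use hopf in \<open>auto simp: is_hopf_algebra_def\<close>)
  have Dc: "comult H a \<in> vsp (basis H \<times> basis H)" if "a \<in> space H" for a
    unfolding comult_def by (rule lin_closed[OF that]) (use coalg in \<open>auto simp: is_coalgebra_def\<close>)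
  define h where "h a b c = mul H (antipode H a) (mul H b (S c))" for a b c
  define M where "M = lin (\<lambda>(i, j, k). h (bv i) (bv j) (bv k))"
  have lh: "lnr (\<lambda>a. h a b c)" "lnr (\<lambda>b. h a b c)" "lnr (\<lambda>c. h a b c)" for a b c
    unfolding h_def by (intro lnr_intros lnr_comp[OF l])+
  have lM: "lnr M" unfolding M_def by (rule lnr_lin)
  have Mt: "M (tens u (tens v w)) = h u v w" for u v w
    unfolding M_def by (rule lin_trilinear) (rule lh)+
  let ?w = "comult H a"
  \<comment> \<open>The bracketing \<open>antipode H * (id * S)\<close>, which collapses by the
    hypothesis on \<open>S\<close>.\<close>
  have "M (tmap id (comult H) ?w) = lin (\<lambda>(i, j). smul (counit H (bv j)) (antipode H (bv i))) ?w"
    unfolding tmap_def lnr_lin_comp[OF lM]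
  proof (rule lin_cong_vsp[OF Dc[OF a]], clarify)
    fix i j assume ij: "i \<in> basis H" "j \<in> basis H"
    have "M (tens (bv i) v) = mul H (antipode H (bv i)) (lin (\<lambda>(p, q). mul H (bv p) (S (bv q))) v)" for v
    proof (rule lnr_ext[of "\<lambda>v. M (tens (bv i) v)" _ v UNIV])
      show "lnr (\<lambda>v. M (tens (bv i) v))" by (intro lnr_comp[OF lM] lnr_intros)
      show "lnr (\<lambda>v. mul H (antipode H (bv i)) (lin (\<lambda>(p, q). mul H (bv p) (S (bv q))) v))" by (intro lnr_intros)
      fix pq :: "'a \<times> 'a"
      obtain p q where "pq = (p, q)" by (cases pq)
      then show "M (tens (bv i) (bv pq)) = mul H (antipode H (bv i)) (lin (\<lambda>(p, q). mul H (bv p) (S (bv q))) (bv pq))"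
        using Mt[of "bv i" "bv p" "bv q"] by (simp add: h_def)
    qed simp
    then show "M (tens (id (bv i)) (comult H (bv j))) = smul (counit H (bv j)) (antipode H (bv i))"
      using conv[of "bv j"] Ac[of "bv i"] ij un by (simp add: mul_linear)
  qed
  also have "\<dots> = antipode H (lin (\<lambda>(i, j). smul (bcounit H j) (bv i)) ?w)"
    unfolding lnr_lin_comp[OF lnr_antipode'] by (simp add: split_def lnr_smul[OF lnr_antipode'] del: smul_single antipode_bv)
  also have "\<dots> = antipode H a" using coalg a by (simp add: is_coalgebra_def)
  finally have 1: "M (tmap id (comult H) ?w) = antipode H a" .
  have lMr: "lnr (\<lambda>v. M (reassoc v))" by (intro lnr_comp[OF lM] lnr_intros)
  \<comment> \<open>The bracketing \<open>(antipode H * id) * S\<close>, which collapses by the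
    antipode axiom.\<close>
  have "M (reassoc (tmap (comult H) id ?w)) = lin (\<lambda>(i, j). smul (counit H (bv i)) (S (bv j))) ?w"
    unfolding tmap_def lnr_lin_comp[OF lMr]
  proof (rule lin_cong_vsp[OF Dc[OF a]], clarify)
    fix i j assume ij: "i \<in> basis H" "j \<in> basis H"
    have "M (reassoc (tens v (bv j))) = mul H (lin (\<lambda>(p, q). mul H (antipode H (bv p)) (bv q)) v) (S (bv j))"
      if v: "v \<in> vsp (basis H \<times> basis H)" for v
    proof (rule lnr_ext[OF _ _ v])
      show "lnr (\<lambda>v. M (reassoc (tens v (bv j))))" by (intro lnr_comp[OF lM] lnr_intros)
      show "lnr (\<lambda>v. mul H (lin (\<lambda>(p, q). mul H (antipode H (bv p)) (bv q)) v) (S (bv j)))" by (intro lnr_intros)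
      fix pq assume "pq \<in> basis H \<times> basis H"
      then obtain p q where pq: "pq = (p, q)" "p \<in> basis H" "q \<in> basis H" by auto
      have "M (reassoc (tens (tens (bv p) (bv q)) (bv j))) = h (bv p) (bv q) (bv j)"
        by (simp only: reassoc_tens Mt)
      then show "M (reassoc (tens (bv pq) (bv j))) = mul H (lin (\<lambda>(p, q). mul H (antipode H (bv p)) (bv q)) (bv pq)) (S (bv j))"
        using assoc[of "antipode H (bv p)" "bv q" "S (bv j)"] pq ij by (simp add: h_def Ac cl del: antipode_bv mul_bv)
    qed
    from this[OF Dc[of "bv j"]] this[OF Dc[of "bv i"]]
    show "M (reassoc (tens (comult H (bv i)) (id (bv j)))) = smul (counit H (bv i)) (S (bv j))"
      using hopf ij un[OF cl[of "bv j"]] by (simp add: is_hopf_algebra_def mul_linear del: antipode_bv mul_bv comult_bv)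
  qed
  also have "\<dots> = S (lin (\<lambda>(i, j). smul (bcounit H i) (bv j)) ?w)"
    unfolding lnr_lin_comp[OF l] by (simp add: split_def lnr_smul[OF l] del: smul_single)
  also have "\<dots> = S a" using coalg a by (simp add: is_coalgebra_def)
  finally have "M (reassoc (tmap (comult H) id ?w)) = S a" .
  moreover have "reassoc (tmap (comult H) id ?w) = tmap id (comult H) ?w"
    using coalg a by (simp add: is_coalgebra_def)
  ultimately show ?thesis using 1 by simp
qed

section \<open>Scalars indexed by bits\<close>

text \<open>Bits serve as exponents, that is as elements of the field with two elements; addition
  and multiplication must stay visible for ring identities to apply.\<close>

declare add_bit_eq_xor [simp del] mult_bit_eq_and [simp del]

lemma UNIV_bit: "(UNIV :: bit set) = {0, 1}"
  by (auto intro: bit_not_zero_iff[THEN iffD1])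

instance bit :: finite
  by standard (simp add: UNIV_bit)

lemma sum_bit: "(\<Sum>b\<in>(UNIV :: bit set). g b) = g 0 + g 1"
  by (simp add: UNIV_bit)

lemma sum_UNIV_prod: "(\<Sum>t\<in>(UNIV :: ('a \<times> 'b) set). g t) = (\<Sum>a\<in>UNIV. \<Sum>b\<in>UNIV. g (a, b))"
  by (simp add: sum.cartesian_product)

lemma bit_simps [simp]:
  fixes a b :: bit
  shows "a * a = a" "a * (a * b) = a * b" "a + a = 0" "a + (a + b) = b" "a + (b + a) = b" "- a = a"
  by (cases a; cases b; simp)+

lemma bit_eq_iff_add: "a = b \<longleftrightarrow> a + b = 0" for a b :: bit
  by (cases a; cases b; simp)

definition sg :: "bit \<Rightarrow> 'k::field" where "sg b = (if b = 0 then 1 else -1)"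

lemma sg_simps [simp]:
  "sg 0 = 1" "sg 1 = -1" "sg a * sg a = 1" "sg a * (sg a * r) = r"
  by (auto simp: sg_def)

lemma sg_add: "sg (a + b) = sg a * sg b"
  by (cases a; cases b; simp)

lemma sg_nonzero [simp]: "sg a \<noteq> 0"
  by (simp add: sg_def)

text \<open>\<open>w\<close> is needed because \<open>u\<close> squares to \<open>im\<close> where
  the idempotent labelled 1 acts, so the monomial matrices of \<open>u\<close> there contain a
  square root of \<open>im\<close>.\<close>

locale quartic =
  fixes im w :: "'k::field_char_0"
  assumes im2: "im * im = -1" and w2: "w * w = im"
begin

lemma im2' [simp]: "im * im = -1" "im * (im * r) = - r"
  using im2 by (simp_all add: mult.assoc[symmetric])

lemma im_nonzero [simp]: "im \<noteq> 0"
  by (metis im2 mult_zero_left zero_neq_neg_one)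

lemma w_nonzero [simp]: "w \<noteq> 0"
  by (metis w2 mult_zero_left im_nonzero)

text \<open>A power of \<open>im\<close> whose exponent is the lift of the bit to 0 or 1, hence not
  multiplicative in \<open>b\<close>.\<close>

definition iu :: "bit \<Rightarrow> 'k" where "iu b = (if b = 0 then 1 else im)"

definition wu :: "bit \<Rightarrow> 'k" where "wu b = (if b = 0 then 1 else w)"

lemma iu_simps [simp]:
  "iu 0 = 1" "iu 1 = im" "iu a * iu a = sg a" "iu a * (iu a * r) = sg a * r"
  by (auto simp: iu_def sg_def)

text \<open>The sign is the carry of binary addition: two exponents 1 add up to 0 as bits, while
  \<open>im * im = -1\<close>.\<close>

lemma iu_add: "iu (a + b) = iu a * iu b * sg (a * b)"
  by (cases a; cases b; simp)

lemma wu_simps [simp]: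
  "wu 0 = 1" "wu 1 = w" "wu a * wu a = iu a" "wu a * (wu a * r) = iu a * r"
  using w2 by (auto simp: iu_def wu_def mult.assoc[symmetric])

text \<open>Here the carry is \<open>w * w = im\<close>; it is compensated by its inverse
  \<open>- im\<close>, which is \<open>iu (a * b) * sg (a * b)\<close> for
  \<open>a = b = 1\<close>.\<close>

lemma wu_add: "wu (a + b) = wu a * wu b * iu (a * b) * sg (a * b)"
  by (cases a; cases b; simp add: w2)

lemmas phase_simps = sg_add iu_add wu_add distrib_left distrib_right mult_ac add_ac

lemma iu_nonzero [simp]: "iu a \<noteq> 0" and wu_nonzero [simp]: "wu a \<noteq> 0"
  by (simp_all add: iu_def wu_def)

end

section \<open>The structure of \<open>H\<^sub>8\<close>\<close>

lemma free_mul [simp]: "mul free_alg (bv u) (bv v) = bv (u @ v)"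
  by (simp add: free_alg_def)

lemma free_space [simp]: "space free_alg = UNIV"
  by (simp add: free_alg_def)

lemma free_mul_Nil: "mul free_alg (bv []) p = p" "mul free_alg p (bv []) = p"
proof -
  show "mul free_alg (bv []) p = p"
    by (rule lnr_ext[of _ _ p UNIV]) (auto intro: lnr_intros simp del: mul_bv)
  show "mul free_alg p (bv []) = p"
    by (rule lnr_ext[of _ _ p UNIV]) (auto intro: lnr_intros simp del: mul_bv)
qed

declare pm.scale_minus_left [simp del]

lemma mul_minus: "mul A (- a) b = - mul A a b" "mul A a (- b) = - mul A a b"
  using mul_linear(3)[of A "-1" a b] mul_linear(4)[of A a "-1" b] by (simp_all add: pm.scale_minus_left)

locale h8 = quartic im w for im w :: "'k::field_char_0" +
  fixes H :: "('i, 'k) hopf" and x y z :: "'i \<Rightarrow>\<^sub>0 'k"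
  assumes H8: "is_H8 H x y z"
begin

abbreviation prod (infixl "\<star>" 70) where "a \<star> b \<equiv> mul H a b"
abbreviation one ("\<one>\<^sub>H") where "\<one>\<^sub>H \<equiv> unt H"

lemma fd: "is_fd_hopf_algebra H" and hopf: "is_hopf_algebra H" and alg: "is_algebra H"
  and pres: "presented_by H (case_gen8 x y z) H8_relations"
  and coalg: "is_coalgebra H"
  using H8 by (auto simp: is_H8_def is_fd_hopf_algebra_def is_hopf_algebra_def)

lemma fin: "finite (basis H)"
  using fd by (simp add: is_fd_hopf_algebra_def)

lemma gen_closed [simp, intro]: "x \<in> space H" "y \<in> space H" "z \<in> space H"
proof -
  have "case_gen8 x y z g \<in> space H" for g using pres unfolding presented_by_def by blast
  from this[of GX] this[of GY] this[of GZ] show "x \<in> space H" "y \<in> space H" "z \<in> space H" by simp_all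
qed

lemma mul_closed [simp, intro]: "a \<in> space H \<Longrightarrow> b \<in> space H \<Longrightarrow> a \<star> b \<in> space H"
  unfolding mul_def by (rule lin_closed[OF tens_closed]) (use alg in \<open>auto simp: is_algebra_def\<close>)

lemma one_closed [simp, intro]: "\<one>\<^sub>H \<in> space H"
  using alg by (simp add: is_algebra_def)

lemma assoc: "a \<in> space H \<Longrightarrow> b \<in> space H \<Longrightarrow> c \<in> space H \<Longrightarrow> a \<star> b \<star> c = a \<star> (b \<star> c)"
  and mul_one: "a \<in> space H \<Longrightarrow> \<one>\<^sub>H \<star> a = a" "a \<in> space H \<Longrightarrow> a \<star> \<one>\<^sub>H = a"
  using alg by (auto simp: is_algebra_def)

abbreviation "ev \<equiv> free_eval H (case_gen8 x y z)"

lemma lnr_ev: "lnr ev"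
  unfolding free_eval_def by (rule lnr_lin)

lemma ev_simps: "ev (bv (g # u)) = case_gen8 x y z g \<star> ev (bv u)" "ev (bv []) = \<one>\<^sub>H"
  by (simp_all add: free_eval_def)

text \<open>With empty words on both sides a relation is itself one of the generators of the
  ideal.\<close>

lemma relation: "r \<in> H8_relations \<Longrightarrow> ev r = 0"
proof -
  assume "r \<in> H8_relations"
  then have "mul free_alg (mul free_alg (bv []) r) (bv []) \<in> ideal_generated free_alg H8_relations"
    unfolding ideal_generated_def by (intro pm.span_base) auto
  then have "r \<in> {p. ev p = 0}" using pres by (simp add: presented_by_def free_mul_Nil)
  then show ?thesis by simp
qed

text \<open>Evaluation nests words to the right and ends in the unit, so relations first appear
  applied to the unit. \<open>relations\<close> carries them over to an arbitrary \<open>v\<close>,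
  the form in which they work as rewrite rules.\<close>

lemma relations1:
  "x \<star> (x \<star> \<one>\<^sub>H) = \<one>\<^sub>H" "y \<star> (y \<star> \<one>\<^sub>H) = \<one>\<^sub>H" "y \<star> (x \<star> \<one>\<^sub>H) = x \<star> (y \<star> \<one>\<^sub>H)"
  "z \<star> (x \<star> \<one>\<^sub>H) = y \<star> (z \<star> \<one>\<^sub>H)" "z \<star> (y \<star> \<one>\<^sub>H) = x \<star> (z \<star> \<one>\<^sub>H)"
  "z \<star> (z \<star> \<one>\<^sub>H) = smul (1/2) (\<one>\<^sub>H + x \<star> \<one>\<^sub>H + y \<star> \<one>\<^sub>H - x \<star> (y \<star> \<one>\<^sub>H))"
  using relation[of "bv [GX, GX] - bv []"] relation[of "bv [GY, GY] - bv []"] relation[of "bv [GX, GY] - bv [GY, GX]"]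
    relation[of "bv [GZ, GX] - bv [GY, GZ]"] relation[of "bv [GZ, GY] - bv [GX, GZ]"]
    relation[of "bv [GZ, GZ] - smul (1/2) (bv [] + bv [GX] + bv [GY] - bv [GX, GY])"]
  unfolding H8_relations_def
  by (simp_all add: lnr_diff[OF lnr_ev] lnr_add[OF lnr_ev] lnr_smul[OF lnr_ev] ev_simps del: smul_single)

lemma lift1:
  assumes "a \<star> (b \<star> \<one>\<^sub>H) = c \<star> (d \<star> \<one>\<^sub>H)" "a \<in> space H" "b \<in> space H" "c \<in> space H" "d \<in> space H" "v \<in> space H"
  shows "a \<star> (b \<star> v) = c \<star> (d \<star> v)"
proof -
  have "a \<star> (b \<star> \<one>\<^sub>H) \<star> v = c \<star> (d \<star> \<one>\<^sub>H) \<star> v" by (simp only: assms(1))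
  then show ?thesis using assms(2-) by (simp add: assoc mul_one)
qed

lemma relations:
  assumes "v \<in> space H"
  shows "x \<star> (x \<star> v) = v" "y \<star> (y \<star> v) = v" "y \<star> (x \<star> v) = x \<star> (y \<star> v)"
  "z \<star> (x \<star> v) = y \<star> (z \<star> v)" "z \<star> (y \<star> v) = x \<star> (z \<star> v)"
  "z \<star> (z \<star> v) = smul (1/2) (v + x \<star> v + y \<star> v - x \<star> (y \<star> v))"
proof -
  have "x \<star> (x \<star> \<one>\<^sub>H) \<star> v = \<one>\<^sub>H \<star> v" "y \<star> (y \<star> \<one>\<^sub>H) \<star> v = \<one>\<^sub>H \<star> v"
    by (simp_all only: relations1)
  then show "x \<star> (x \<star> v) = v" "y \<star> (y \<star> v) = v"
    using assms by (simp_all add: assoc mul_one)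
  show "y \<star> (x \<star> v) = x \<star> (y \<star> v)" "z \<star> (x \<star> v) = y \<star> (z \<star> v)" "z \<star> (y \<star> v) = x \<star> (z \<star> v)"
    by (rule lift1; use assms relations1 in simp)+
  have "z \<star> (z \<star> \<one>\<^sub>H) \<star> v = smul (1/2) (\<one>\<^sub>H + x \<star> \<one>\<^sub>H + y \<star> \<one>\<^sub>H - x \<star> (y \<star> \<one>\<^sub>H)) \<star> v"
    by (simp only: relations1)
  then show "z \<star> (z \<star> v) = smul (1/2) (v + x \<star> v + y \<star> v - x \<star> (y \<star> v))"
    using assms by (simp add: assoc mul_one mul_linear)
qed

section \<open>The monomial basis of \<open>H\<close> and its multiplication table\<close>

text \<open>The factor \<open>((1 + im) + (1 - im) x) / 2\<close> is a square root of
  \<open>x\<close>. The square of \<open>z\<close> is \<open>x\<close> on the part where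
  \<open>x y = 1\<close> and 1 on the part where \<open>x y = -1\<close>; on the first part
  \<open>z\<close> commutes with \<open>x\<close>, on the second it anticommutes. So
  \<open>u\<close> has square 1 on the first part and \<open>im\<close> on the second.\<close>

definition u :: "'i \<Rightarrow>\<^sub>0 'k"
  where "u = smul (1/2) (smul (1 + im) (z \<star> \<one>\<^sub>H) + smul (1 - im) (x \<star> (z \<star> \<one>\<^sub>H)))"

definition upow :: "bit \<Rightarrow> ('i \<Rightarrow>\<^sub>0 'k)" where "upow c = (if c = 0 then \<one>\<^sub>H else u)"

text \<open>\<open>k \<alpha> m c = x\<^sup>m e\<^sub>\<alpha> u\<^sup>c\<close> with the idempotents \<open>e\<^sub>\<alpha> = (1 + (-1)\<^sup>\<alpha> x y) / 2\<close>.\<close>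

definition k :: "bit \<Rightarrow> bit \<Rightarrow> bit \<Rightarrow> ('i \<Rightarrow>\<^sub>0 'k)"
  where "k a m c = (let v = smul (1/2) (upow c + smul (sg a) (x \<star> (y \<star> upow c))) in if m = 0 then v else x \<star> v)"

lemma u_closed [simp, intro]: "u \<in> space H" and upow_closed [simp, intro]: "upow c \<in> space H"
  and k_closed [simp, intro]: "k a m c \<in> space H"
  by (auto simp: u_def upow_def k_def Let_def intro!: vsp_intros)

lemma x_k: "x \<star> k a m c = k a (m + 1) c"
  by (cases m) (simp_all add: k_def mul_linear relations)

text \<open>Under the idempotent labelled \<open>a\<close> the product \<open>x y\<close> is the
  sign \<open>sg a\<close>, and \<open>x\<close> is an involution.\<close>

lemma y_k: "y \<star> k a m c = smul (sg a) (k a (m + 1) c)"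
  by (cases m; cases a; rule poly_mapping_eqI;
      simp add: k_def mul_linear relations lookup_add lookup_minus; simp add: field_simps)

lemma z_k_aux: "v \<in> space H \<Longrightarrow> u \<star> v = smul (1/2) (smul (1 + im) (z \<star> v) + smul (1 - im) (x \<star> (z \<star> v)))"
  by (simp add: u_def mul_linear assoc mul_one)

text \<open>For \<open>a = 1\<close> the element \<open>u\<close> anticommutes with \<open>x\<close>
  and has square \<open>im\<close>; for \<open>a = 0\<close> it commutes with \<open>x\<close> and
  has square 1.\<close>

lemma u_k: "u \<star> k a m c = smul (sg (a * m) * iu (a * c)) (k a m (c + 1))"
  unfolding z_k_aux[OF k_closed]
  by (cases a; cases m; cases c; rule poly_mapping_eqI;
      simp add: k_def upow_def u_def mul_linear relations lookup_add lookup_minus; simp add: field_simps)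

text \<open>The factor \<open>((1 - im) + (1 + im) x) / 2\<close> is inverse to the one in the
  definition of \<open>u\<close>.\<close>

lemma z_eq: "v \<in> space H \<Longrightarrow> z \<star> v = smul (1/2) (smul (1 - im) (u \<star> v) + smul (1 + im) (x \<star> (u \<star> v)))"
  by (rule poly_mapping_eqI; simp add: z_k_aux mul_linear relations lookup_add; simp add: field_simps)

lemma one_k: "\<one>\<^sub>H = k 0 0 0 + k 1 0 0"
  by (rule poly_mapping_eqI) (simp add: k_def upow_def lookup_add lookup_minus field_simps)

lemma u_k_sum: "u = k 0 0 1 + k 1 0 1"
  by (rule poly_mapping_eqI) (simp add: k_def upow_def lookup_add lookup_minus field_simps)

lemma k_mul: "k a m c \<star> k a' m' c' =
    (if a = a' then smul (sg (a * c * m') * iu (a * c * c')) (k a (m + m') (c + c')) else 0)"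
proof -
  have up: "upow c \<star> k a' m' c' = smul (sg (a' * c * m') * iu (a' * c * c')) (k a' m' (c + c'))" for a' m' c'
    by (cases c) (simp_all add: upow_def mul_one u_k mult_ac add_ac)
  define v where "v = smul (1/2) (upow c + smul (sg a) (x \<star> (y \<star> upow c)))"
  have v: "k a m c = (if m = 0 then v else x \<star> v)" "v \<in> space H"
    by (auto simp: v_def k_def Let_def intro!: vsp_intros)
  have "v \<star> k a' m' c' = (if a = a' then smul (sg (a' * c * m') * iu (a' * c * c')) (k a' m' (c + c')) else 0)"
    unfolding v_def
    by (cases a; cases a'; rule poly_mapping_eqI)
      (simp_all add: mul_linear mul_minus assoc up x_k y_k lookup_add lookup_minus)
  then have "k a m c \<star> k a' m' c' = (let r = (if a = a' then smul (sg (a' * c * m') * iu (a' * c * c')) (k a' m' (c + c')) else 0)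
      in if m = 0 then r else x \<star> r)"
    using v by (simp add: assoc)
  then show ?thesis
    by (cases m) (auto simp: mul_linear x_k add_ac)
qed

subsection \<open>Linear independence\<close>

text \<open>The operators by which the generators act on the basis \<open>k \<alpha> m c\<close>, on a formal copy of that basis.\<close>

definition opX :: "(bit \<times> bit \<times> bit \<Rightarrow>\<^sub>0 'k) \<Rightarrow> (bit \<times> bit \<times> bit \<Rightarrow>\<^sub>0 'k)"
  where "opX = lin (\<lambda>(a, m, c). bv (a, m + 1, c))"

definition opY :: "(bit \<times> bit \<times> bit \<Rightarrow>\<^sub>0 'k) \<Rightarrow> (bit \<times> bit \<times> bit \<Rightarrow>\<^sub>0 'k)"
  where "opY = lin (\<lambda>(a, m, c). smul (sg a) (bv (a, m + 1, c)))"

definition opU :: "(bit \<times> bit \<times> bit \<Rightarrow>\<^sub>0 'k) \<Rightarrow> (bit \<times> bit \<times> bit \<Rightarrow>\<^sub>0 'k)"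
  where "opU = lin (\<lambda>(a, m, c). smul (sg (a * m) * iu (a * c)) (bv (a, m, c + 1)))"

definition opZ :: "(bit \<times> bit \<times> bit \<Rightarrow>\<^sub>0 'k) \<Rightarrow> (bit \<times> bit \<times> bit \<Rightarrow>\<^sub>0 'k)"
  where "opZ v = smul (1/2) (smul (1 - im) (opU v) + smul (1 + im) (opX (opU v)))"

definition op :: "gen8 \<Rightarrow> (bit \<times> bit \<times> bit \<Rightarrow>\<^sub>0 'k) \<Rightarrow> (bit \<times> bit \<times> bit \<Rightarrow>\<^sub>0 'k)"
  where "op = case_gen8 opX opY opZ"

definition act :: "(gen8 list \<Rightarrow>\<^sub>0 'k) \<Rightarrow> (bit \<times> bit \<times> bit \<Rightarrow>\<^sub>0 'k) \<Rightarrow> (bit \<times> bit \<times> bit \<Rightarrow>\<^sub>0 'k)"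
  where "act p v = lin (\<lambda>w. foldr op w v) p"

definition \<Theta> :: "(bit \<times> bit \<times> bit \<Rightarrow>\<^sub>0 'k) \<Rightarrow> ('i \<Rightarrow>\<^sub>0 'k)"
  where "\<Theta> = lin (\<lambda>(a, m, c). k a m c)"

text \<open>The formal counterpart of the unit, see \<open>one_k\<close>.\<close>

definition v0 :: "bit \<times> bit \<times> bit \<Rightarrow>\<^sub>0 'k"
  where "v0 = bv (0, 0, 0) + bv (1, 0, 0)"

lemma lnr_op: "lnr opX" "lnr opY" "lnr opU" "lnr opZ" "lnr (op g)"
proof -
  show 1: "lnr opX" "lnr opY" "lnr opU" unfolding opX_def opY_def opU_def by (rule lnr_lin)+
  show 2: "lnr opZ" unfolding opZ_def[abs_def]
    by (intro lnr_intros lnr_comp[OF 1(1)] lnr_comp[OF 1(3)])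
  show "lnr (op g)" unfolding op_def by (cases g) (simp_all add: 1 2)
qed

lemma \<Theta>_op: "\<Theta> (opX v) = x \<star> \<Theta> v" "\<Theta> (opY v) = y \<star> \<Theta> v" "\<Theta> (opU v) = u \<star> \<Theta> v" "\<Theta> (opZ v) = z \<star> \<Theta> v"
  "\<Theta> v \<in> space H"
proof -
  have l: "lnr \<Theta>" unfolding \<Theta>_def by (rule lnr_lin)
  have b: "\<Theta> (bv (a, m, c)) = k a m c" for a m c by (simp add: \<Theta>_def)
  show c: "\<Theta> v \<in> space H" for v
    by (rule lnr_closed[OF l, of v UNIV]) (auto simp: b)
  show X: "\<Theta> (opX v) = x \<star> \<Theta> v" for v
    by (rule lnr_ext[of _ _ v UNIV]) (auto intro!: lnr_intros lnr_comp[OF l] lnr_op l simp: opX_def b x_k)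
  show "\<Theta> (opY v) = y \<star> \<Theta> v"
    by (rule lnr_ext[of _ _ v UNIV])
      (auto intro!: lnr_intros lnr_comp[OF l] lnr_op l simp: opY_def b y_k lnr_smul[OF l] simp del: smul_single)
  show U: "\<Theta> (opU v) = u \<star> \<Theta> v"
    by (rule lnr_ext[of _ _ v UNIV])
      (auto intro!: lnr_intros lnr_comp[OF l] lnr_op l simp: opU_def b u_k lnr_smul[OF l] simp del: smul_single)
  show "\<Theta> (opZ v) = z \<star> \<Theta> v"
    by (simp add: opZ_def lnr_smul[OF l] lnr_add[OF l] X U z_eq c)
qed

lemma lnr_\<Theta>: "lnr \<Theta>" unfolding \<Theta>_def by (rule lnr_lin)

lemma lnr_foldr_op: "lnr (foldr op ws)"
  by (induction ws) (auto simp: id_def[symmetric] comp_def intro: lnr_comp[OF lnr_op(5)])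

lemma lnr_act: "lnr (\<lambda>p. act p v)" "lnr (act p)"
proof -
  show "lnr (\<lambda>p. act p v)" unfolding act_def by (rule lnr_lin)
  show "lnr (act p)" unfolding act_def[abs_def] lin_def
    by (intro lnr_intros lnr_foldr_op)
qed

lemma act_bv: "act (bv ws) v = foldr op ws v"
  by (simp add: act_def)

text \<open>\<open>\<Theta>\<close> intertwines the formal operators with left multiplications and
  sends \<open>v0\<close> to the unit, so evaluation factors through the formal copy.\<close>

lemma ev_act: "ev p = \<Theta> (act p v0)"
proof (rule lnr_ext[of _ _ p UNIV])
  show "lnr ev" by (rule lnr_ev)
  show "lnr (\<lambda>p. \<Theta> (act p v0))" by (rule lnr_comp[OF lnr_\<Theta> lnr_act(1)])
  fix w :: "gen8 list"
  show "ev (bv w) = \<Theta> (act (bv w) v0)"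
  proof (induction w)
    case Nil
    then show ?case by (simp add: ev_simps act_bv one_k v0_def lnr_add[OF lnr_\<Theta>]) (simp add: \<Theta>_def)
  next
    case (Cons g w)
    then show ?case by (cases g) (simp_all add: ev_simps act_bv op_def \<Theta>_op)
  qed
qed simp

lemma act_mul: "act (mul free_alg p q) v = act p (act q v)"
proof (rule lnr_ext[of _ _ p UNIV])
  show "lnr (\<lambda>p. act (mul free_alg p q) v)" by (intro lnr_comp[OF lnr_act(1)] lnr_intros)
  show "lnr (\<lambda>p. act p (act q v))" by (rule lnr_act)
  fix a :: "gen8 list"
  show "act (mul free_alg (bv a) q) v = act (bv a) (act q v)"
  proof (rule lnr_ext[of _ _ q UNIV])
    show "lnr (\<lambda>q. act (mul free_alg (bv a) q) v)" by (intro lnr_comp[OF lnr_act(1)] lnr_intros)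
    show "lnr (\<lambda>q. act (bv a) (act q v))" by (intro lnr_comp[OF lnr_act(2)] lnr_act)
  qed (simp_all add: act_bv del: mul_bv)
qed simp

text \<open>Checked on the eight formal basis vectors; this makes the formal copy a module over the
  presented algebra.\<close>

lemma act_relation:
  assumes "r \<in> H8_relations"
  shows "act r v = 0"
proof (rule lnr_ext[of _ _ v UNIV])
  show "lnr (act r)" by (rule lnr_act)
  show "lnr (\<lambda>v. 0 :: bit \<times> bit \<times> bit \<Rightarrow>\<^sub>0 'k)" by (intro lnr_intros)
  fix t :: "bit \<times> bit \<times> bit"
  obtain a m c where t: "t = (a, m, c)" by (cases t)
  have X: "opX (bv (a, m, c)) = bv (a, m + 1, c)" for a m c by (simp add: opX_def)
  have Y: "opY (bv (a, m, c)) = smul (sg a) (bv (a, m + 1, c))" for a m c by (simp add: opY_def)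
  have U: "opU (bv (a, m, c)) = smul (sg (a * m) * iu (a * c)) (bv (a, m, c + 1))" for a m c
    by (simp add: opU_def)
  note lo = lnr_op[THEN lnr_add] lnr_op[THEN lnr_smul] lnr_op[THEN lnr_diff]
  show "act r (bv t) = 0"
    using assms unfolding H8_relations_def t
    apply (elim insertE emptyE)
         apply (simp_all add: lnr_diff[OF lnr_act(1)] lnr_add[OF lnr_act(1)] lnr_smul[OF lnr_act(1)] act_bv op_def
            opZ_def X Y U lo add_ac del: smul_single)
    by (cases a; cases m; cases c; rule poly_mapping_eqI;
        simp add: lookup_add lookup_minus lookup_single lookup_double when_def; simp add: field_simps)+
qed simp

text \<open>The vector \<open>v0\<close> is cyclic, so every formal vector is
  \<open>act p v0\<close> for some \<open>p\<close>. If its image \<open>ev p\<close> vanishes, the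
  presentation puts \<open>p\<close> into the ideal of relations, which acts as zero.\<close>

lemma \<Theta>_inj: "\<Theta> v = 0 \<Longrightarrow> v = 0"
proof -
  assume v: "\<Theta> v = 0"
  let ?S = "range (\<lambda>p. act p v0)"
  have sub: "pm.subspace ?S"
    unfolding pm.subspace_def
    by (auto simp: lnr_add[OF lnr_act(1), symmetric] lnr_smul[OF lnr_act(1), symmetric] lnr_0[OF lnr_act(1)] intro: range_eqI[of _ _ 0])
  have cl: "opX s \<in> ?S" "opY s \<in> ?S" "opZ s \<in> ?S" if s: "s \<in> ?S" for s
  proof -
    obtain p where p: "s = act p v0" using s by blast
    have "op g s = act (mul free_alg (bv [g]) p) v0" for g by (simp add: act_mul act_bv p del: mul_bv)
    then have "op g s \<in> ?S" for g by blast
    from this[of GX] this[of GY] this[of GZ] show "opX s \<in> ?S" "opY s \<in> ?S" "opZ s \<in> ?S" by (simp_all add: op_def)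
  qed
  \<comment> \<open>\<open>opU\<close> is expressed through the generators, so the cyclic submodule
    is stable under it.\<close>
  have U: "opU s = smul (1/2) (smul (1 + im) (opZ s) + smul (1 - im) (opX (opZ s)))" for s
  proof -
    have XX: "opX (opX s) = s" for s
      by (rule lnr_ext[OF lnr_comp[OF lnr_op(1) lnr_op(1)] lnr_id, of s UNIV]) (auto simp: opX_def add_ac)
    show ?thesis
      by (rule poly_mapping_eqI; simp add: opZ_def lnr_add[OF lnr_op(1)] lnr_smul[OF lnr_op(1)] XX lookup_add;
          simp add: field_simps)
  qed
  have clU: "opU s \<in> ?S" if "s \<in> ?S" for s
    unfolding U by (intro pm.subspace_scale[OF sub] pm.subspace_add[OF sub] cl that)
  have v0S: "v0 \<in> ?S" using act_bv[of "[]" v0] by (metis foldr.simps(1) id_apply rangeI)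
  have b1: "bv (a, 0, 0) \<in> ?S" for a
  proof -
    \<comment> \<open>The idempotent labelled \<open>a\<close>, written in \<open>x\<close> and
      \<open>y\<close>, cuts out one component of \<open>v0\<close>.\<close>
    have "bv (a, 0, 0) = smul (1/2) (v0 + smul (sg a) (opX (opY v0)))"
      by (cases a; rule poly_mapping_eqI;
          simp add: v0_def lnr_add[OF lnr_op(1)] lnr_add[OF lnr_op(2)] lnr_smul[OF lnr_op(1)];
          simp add: opX_def opY_def lin_single lookup_add lookup_single lookup_double when_def)
    then show ?thesis by (simp only:) (intro pm.subspace_scale[OF sub] pm.subspace_add[OF sub] cl v0S)
  qed
  have b2: "bv (a, 0, c) \<in> ?S" for a c
    using b1[of a] clU[OF b1[of a]] by (cases c) (simp_all add: opX_def opY_def opU_def)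
  have b3: "bv (a, m, c) \<in> ?S" for a m c
    using b2[of a c] cl(1)[OF b2[of a c]] by (cases m) (simp_all add: opX_def opY_def opU_def)
  have "v \<in> ?S"
    using span_closed[OF lnr_id _ sub, of v "range bv"] b3
    by (subst sum_expand[of UNIV v]) (auto intro!: pm.subspace_sum[OF sub] pm.subspace_scale[OF sub] simp del: smul_single)
  then obtain p where p: "v = act p v0" by blast
  then have "p \<in> ideal_generated free_alg H8_relations"
    using v pres by (auto simp: ev_act presented_by_def)
  then have "act p v0 \<in> {0}"
    unfolding ideal_generated_def
    by (rule span_closed[OF lnr_act(1)])
      (auto simp: act_mul act_relation lnr_0[OF lnr_act(2)])
  then show ?thesis using p by simp
qed

lemma \<Theta>_sum: "\<Theta> t = (\<Sum>(a, m, c)\<in>UNIV. smul (Poly_Mapping.lookup t (a, m, c)) (k a m c))"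
  unfolding \<Theta>_def by (subst lin_superset[of UNIV]) (auto simp: split_def)

text \<open>Spanning comes from surjectivity of evaluation, independence from
  \<open>\<Theta>_inj\<close>.\<close>

lemma k_frame_ex: "\<exists>f. dframe (basis H) UNIV (\<lambda>(a, m, c). k a m c) f"
proof (rule dframe_ex_indep[OF fin])
  show "space H \<subseteq> pm.span (range (\<lambda>(a, m, c). k a m c))"
  proof
    fix v assume "v \<in> space H"
    then obtain p where "v = ev p" using pres unfolding presented_by_def by blast
    then have "v = \<Theta> (act p v0)" by (simp add: ev_act)
    also have "\<dots> \<in> pm.span (range (\<lambda>(a, m, c). k a m c))"
      unfolding \<Theta>_sum split_def
      by (intro pm.span_sum pm.span_scale pm.span_base) (auto intro!: range_eqI[of _ _ "(_, _, _)"])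
    finally show "v \<in> pm.span (range (\<lambda>(a, m, c). k a m c))" .
  qed
  fix e :: "bit \<times> bit \<times> bit \<Rightarrow> 'k" assume e: "(\<Sum>t\<in>UNIV. smul (e t) (case t of (a, m, c) \<Rightarrow> k a m c)) = 0"
  have "Poly_Mapping.lookup (\<Sum>t\<in>UNIV. Poly_Mapping.single t (e t)) t = e t" for t
    by (simp add: lookup_sum_single)
  then have "\<Theta> (\<Sum>t\<in>UNIV. Poly_Mapping.single t (e t)) = 0"
    using e by (simp add: \<Theta>_sum split_def)
  then have "(\<Sum>t\<in>UNIV. Poly_Mapping.single t (e t)) = 0" by (rule \<Theta>_inj)
  then have "Poly_Mapping.lookup (\<Sum>t\<in>UNIV. Poly_Mapping.single t (e t)) t = 0" for t by simp
  then show "\<forall>t\<in>UNIV. e t = 0" by (simp add: lookup_sum_single)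
qed auto

definition f :: "bit \<Rightarrow> bit \<Rightarrow> bit \<Rightarrow> ('i \<Rightarrow>\<^sub>0 'k)"
  where "f a m c = (SOME f. dframe (basis H) UNIV (\<lambda>(a, m, c). k a m c) f) (a, m, c)"

lemma k_frame: "dframe (basis H) UNIV (\<lambda>(a, m, c). k a m c) (\<lambda>(a, m, c). f a m c)"
proof -
  have "(\<lambda>(a, m, c). f a m c) = (SOME f. dframe (basis H) UNIV (\<lambda>(a, m, c). k a m c) f)"
    by (auto simp: f_def)
  then show ?thesis using someI_ex[OF k_frame_ex] by simp
qed

lemma f_closed [simp, intro]: "f a m c \<in> space H"
  using dframeD(4)[OF k_frame, of "(a, m, c)"] by simp

lemma f_k [simp]: "pairing (f a m c) (k a' m' c') = (if a = a' \<and> m = m' \<and> c = c' then 1 else 0)"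
  using dframeD(5)[OF k_frame, of "(a, m, c)" "(a', m', c')"] by simp

lemma k_ext: "lnr \<phi> \<Longrightarrow> lnr \<psi> \<Longrightarrow> (\<And>a m c. \<phi> (k a m c) = \<psi> (k a m c)) \<Longrightarrow> v \<in> space H \<Longrightarrow> \<phi> v = \<psi> v"
  by (rule dframe_ext[OF k_frame]) auto

subsection \<open>Coalgebra structure\<close>

lemma comult_gen: "comult H x = tens x x" "comult H y = tens y y"
  "comult H z = mul (tensor_alg H H) (smul (1/2) (tens (\<one>\<^sub>H + y) \<one>\<^sub>H + tens (\<one>\<^sub>H - y) x)) (tens z z)"
  and counit_gen: "counit H x = 1" "counit H y = 1" "counit H z = 1"
  using H8 by (auto simp: is_H8_def)

lemma comult_mul: "a \<in> space H \<Longrightarrow> b \<in> space H \<Longrightarrow> comult H (a \<star> b) = mul (tensor_alg H H) (comult H a) (comult H b)"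
  and counit_mul: "a \<in> space H \<Longrightarrow> b \<in> space H \<Longrightarrow> counit H (a \<star> b) = counit H a * counit H b"
  and comult_one: "comult H \<one>\<^sub>H = tens \<one>\<^sub>H \<one>\<^sub>H" and counit_one: "counit H \<one>\<^sub>H = 1"
  using hopf by (auto simp: is_hopf_algebra_def)

lemma comult_linear: "comult H (v + v') = comult H v + comult H v'" "comult H (smul c v) = smul c (comult H v)"
  by (simp_all add: lnr_add[OF lnr_comult'] lnr_smul[OF lnr_comult'])

lemma z_k_sum: "z = smul (1/2) (smul (1 - im) (k 0 0 1 + k 1 0 1) + smul (1 + im) (k 0 1 1 + k 1 1 1))"
proof -
  have "z = z \<star> \<one>\<^sub>H" by (simp add: mul_one)
  also have "\<dots> = smul (1/2) (smul (1 - im) u + smul (1 + im) (x \<star> u))" using z_eq[OF one_closed] by (simp add: mul_one)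
  finally show ?thesis by (simp add: u_k_sum mul_linear x_k)
qed

lemma comult_u: "comult H u = tens (k 0 0 1) (k 0 0 1 + k 1 0 1) + tens (k 1 0 1) (k 0 1 1 + k 1 1 1)"
proof -
  let ?A = "z + y \<star> z" and ?B = "z - y \<star> z"
  have y: "y \<star> z = smul (1/2) (smul (1 - im) (k 0 1 1 - k 1 1 1) + smul (1 + im) (k 0 0 1 - k 1 0 1))"
    by (subst z_k_sum, rule poly_mapping_eqI) (simp add: mul_linear mul_minus y_k lookup_add lookup_minus)
  \<comment> \<open>The terms of the coproduct of \<open>u\<close> are collected by their second
    factor, \<open>z\<close> or \<open>x z\<close>; these are the two first factors that
    arise.\<close>
  have AB: "smul (1 + im) ?A + smul (1 - im) (x \<star> ?B) = smul 2 (smul (1 + im) (k 0 0 1) + smul (1 - im) (k 1 0 1))"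
    "smul (1 + im) ?B + smul (1 - im) (x \<star> ?A) = smul 2 (smul (1 - im) (k 0 0 1) + smul (1 + im) (k 1 0 1))"
    unfolding y by (subst z_k_sum, subst (2) z_k_sum, rule poly_mapping_eqI,
      simp add: mul_linear mul_minus x_k lookup_add lookup_minus, simp add: field_simps)+
  have z: "comult H z = smul (1/2) (tens ?A z + tens ?B (x \<star> z))"
    by (simp add: comult_gen mul_linear mul_one)
  have "comult H u = smul (1/2) (smul (1 + im) (comult H z) + smul (1 - im) (mul (tensor_alg H H) (tens x x) (comult H z)))"
    by (simp add: u_def mul_one comult_linear comult_mul comult_gen(1))
  also have "\<dots> = smul (1/2) (smul (1 + im) (smul (1/2) (tens ?A z + tens ?B (x \<star> z)))
      + smul (1 - im) (smul (1/2) (tens (x \<star> ?A) (x \<star> z) + tens (x \<star> ?B) z)))"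
    unfolding z mul_linear(2,4) mul_tensor_alg by (simp only: relations gen_closed)
  also have "\<dots> = smul (1/4) (tens (smul (1 + im) ?A + smul (1 - im) (x \<star> ?B)) z
      + tens (smul (1 + im) ?B + smul (1 - im) (x \<star> ?A)) (x \<star> z))"
    unfolding tens_linear by (rule poly_mapping_eqI) (simp add: lookup_add lookup_minus field_simps)
  also have "\<dots> = tens (k 0 0 1) (smul (1/2) (smul (1 + im) z + smul (1 - im) (x \<star> z)))
      + tens (k 1 0 1) (smul (1/2) (smul (1 - im) z + smul (1 + im) (x \<star> z)))"
    unfolding AB tens_linear by (rule poly_mapping_eqI) (simp add: lookup_add lookup_minus field_simps)
  also have "smul (1/2) (smul (1 + im) z + smul (1 - im) (x \<star> z)) = u"
    by (simp add: u_def mul_one)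
  also have "smul (1/2) (smul (1 - im) z + smul (1 + im) (x \<star> z)) = x \<star> u"
    by (simp add: u_def mul_one mul_linear relations add_ac)
  finally show ?thesis by (simp add: u_k_sum mul_linear x_k)
qed

lemma comult_upow: "comult H (upow c) = (\<Sum>a\<in>UNIV. \<Sum>b\<in>UNIV. tens (k a 0 c) (k b (c * a) c))"
proof (cases "c = 0")
  case True
  then show ?thesis using comult_one by (simp add: upow_def sum_bit tens_linear one_k add_ac)
next
  case False
  then have "c = 1" by simp
  then show ?thesis by (simp add: sum_bit upow_def comult_u tens_linear add_ac)
qed

text \<open>\<open>x\<close> is group-like, and the labels of the idempotents add up under the
  coproduct because \<open>x y\<close> is group-like. The term \<open>c * b\<close> is the extra
  factor \<open>x\<close> which \<open>comult_u\<close> attaches to the second leg on the part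
  \<open>b = 1\<close>.\<close>

lemma k_comult: "comult H (k a m c) = (\<Sum>b\<in>UNIV. tens (k b m c) (k (a + b) (m + c * b) c))"
proof -
  define v where "v = smul (1/2) (upow c + smul (sg a) (x \<star> (y \<star> upow c)))"
  have v: "k a m c = (if m = 0 then v else x \<star> v)" "v \<in> space H"
    by (auto simp: v_def k_def Let_def intro!: vsp_intros)
  have "comult H v = (\<Sum>b\<in>UNIV. tens (k b 0 c) (k (a + b) (c * b) c))"
    by (cases a; rule tens_eqI; simp add: v_def comult_linear comult_mul comult_gen(1,2) comult_upow sum_bit mul_linear mul_minus
        mul_tensor_alg x_k y_k lookup_add; simp add: field_simps)
  then show ?thesis
    unfolding v(1) by (cases m) (simp_all add: v(2) comult_mul comult_gen(1) mul_linear x_k add_ac)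
qed

lemma k_counit: "counit H (k a m c) = (if a = 0 then 1 else 0)"
proof -
  have l: "counit H (v + v') = counit H v + counit H v'" "counit H (smul d v) = d * counit H v" for v v' d
    by (simp_all add: lfn_add[OF lfn_comp(4)] lfn_smul[OF lfn_comp(4)])
  have "counit H u = 1" by (simp add: u_def mul_one l counit_mul counit_gen)
  then have "counit H (upow c) = 1" by (simp add: upow_def counit_one)
  then show ?thesis by (cases a; cases m) (simp_all add: k_def l counit_mul counit_gen)
qed

text \<open>\<open>is_H8\<close> does not prescribe the antipode. The candidate \<open>S\<close>,
  given on the basis, is shown to be a right convolution inverse of the identity and is then
  identified by \<open>antipode_unique\<close>.\<close>

lemma k_antipode: "antipode H (k a m c) = smul (iu (a * c) * sg (a * c * m)) (k a (m + a * c) c)"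
proof -
  define S where "S v = (\<Sum>(a, m, c)\<in>UNIV. smul (pairing (f a m c) v)
    (smul (iu (a * c) * sg (a * c * m)) (k a (m + a * c) c)))" for v
  have l: "lnr S" unfolding S_def split_def by (intro lnr_intros)
  have Sk: "S (k a m c) = smul (iu (a * c) * sg (a * c * m)) (k a (m + a * c) c)" for a m c
  proof -
    have "S (k a m c) = (\<Sum>t\<in>UNIV. if t = (a, m, c) then smul (iu (a * c) * sg (a * c * m)) (k a (m + a * c) c) else 0)"
      unfolding S_def split_def by (intro sum.cong) auto
    then show ?thesis by simp
  qed
  have "S (k a m c) = antipode H (k a m c)"
  proof (rule antipode_unique[OF hopf l])
    show "S v \<in> space H" for v unfolding S_def by (auto intro!: vsp_sum vsp_intros)
    have lin: "lin (\<lambda>(i, j). bv i \<star> S (bv j)) (tens v v') = v \<star> S v'" for v v'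
      by (rule lin_bilinear[of "\<lambda>v v'. v \<star> S v'"]) (intro lnr_intros lnr_comp[OF l])+
    fix v assume v: "v \<in> space H"
    show "lin (\<lambda>(i, j). bv i \<star> S (bv j)) (comult H v) = smul (counit H v) \<one>\<^sub>H"
    proof (rule k_ext[OF _ _ _ v])
      fix a m c
      show "lin (\<lambda>(i, j). bv i \<star> S (bv j)) (comult H (k a m c)) = smul (counit H (k a m c)) \<one>\<^sub>H"
        by (cases a; cases m; cases c; simp add: k_comult lnr_add[OF lnr_lin] lin sum_bit Sk mul_linear k_mul k_counit one_k)
    qed (intro lnr_intros)+
  qed simp
  then show ?thesis by (simp add: Sk)
qed

lemma involutive: "v \<in> space H \<Longrightarrow> antipode H (antipode H v) = v"
proof (rule k_ext[of "\<lambda>v. antipode H (antipode H v)" "\<lambda>v. v"])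
  fix a m c
  show "antipode H (antipode H (k a m c)) = k a m c"
    by (cases a; cases m; cases c; simp add: k_antipode lnr_smul[OF lnr_antipode'])
qed (intro lnr_intros)+

end

section \<open>The structure of \<open>D(H\<^sub>8)\<close>\<close>

lemma bit_solve: "b + c = a \<longleftrightarrow> b = a + c" for a b c :: bit
  by (cases a; cases b; cases c; simp)

context h8
begin

sublocale dd: fd_hopf_involutive H
  by standard (simp_all add: fd involutive)

abbreviation "D \<equiv> dd.D"

section \<open>Structure constants of the dual of \<open>H\<close>\<close>

lemma f_ext: "p \<in> space H \<Longrightarrow> q \<in> space H \<Longrightarrow> (\<And>a m c. pairing p (k a m c) = pairing q (k a m c)) \<Longrightarrow> p = q"
  by (rule dframe_pairing_ext'[OF k_frame]) auto

text \<open>The structure constants of the dual are transposes: here of \<open>k_comult\<close>, in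
  \<open>f_comult\<close> of \<open>k_mul\<close>.\<close>

lemma f_mul: "mul (dual H) (f a m d) (f a' m' d') = (if d = d' \<and> m' = m + d * a then f (a + a') m d else 0)"
proof (rule f_ext)
  fix b n c
  have "pairing (mul (dual H) (f a m d) (f a' m' d')) (k b n c)
      = (\<Sum>b'\<in>UNIV. if b' = a then if m = n \<and> d = c \<and> a' = b + a \<and> m' = n + c * a \<and> d' = c then 1 else 0 else 0)"
    unfolding pairing_mul_dual[OF fin k_closed] k_comult pairing_linear
    by (intro sum.cong) auto
  also have "\<dots> = pairing (if d = d' \<and> m' = m + d * a then f (a + a') m d else 0) (k b n c)"
    by (auto simp: pairing_linear bit_solve add_ac)
  finally show "pairing (mul (dual H) (f a m d) (f a' m' d')) (k b n c)
      = pairing (if d = d' \<and> m' = m + d * a then f (a + a') m d else 0) (k b n c)" .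
qed (auto intro: mul_dual_closed[OF fin])

lemma f_unt: "unt (dual H) = (\<Sum>m\<in>UNIV. \<Sum>d\<in>UNIV. f 0 m d)"
proof (rule f_ext)
  fix b n c
  show "pairing (unt (dual H)) (k b n c) = pairing (\<Sum>m\<in>UNIV. \<Sum>d\<in>UNIV. f 0 m d) (k b n c)"
    by (cases b; cases n; cases c; simp add: pairing_unt_dual[OF fin k_closed] pairing_linear k_counit sum_bit)
qed (auto intro: unt_dual_closed)

lemma f_one: "pairing (f a m d) (unt H) = (if m = 0 \<and> d = 0 then 1 else 0)"
  by (cases a) (simp_all add: one_k pairing_linear)

lemma f_comult: "comult (dual H) (f a m d) = (\<Sum>m1\<in>UNIV. \<Sum>c1\<in>UNIV.
    smul (sg (a * c1 * (m + m1)) * iu (a * c1 * (d + c1))) (tens (f a m1 c1) (f a (m + m1) (d + c1))))"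
proof (rule dframe_pairing_ext'[OF dframe_tens[OF k_frame k_frame]])
  fix t :: "(bit \<times> bit \<times> bit) \<times> bit \<times> bit \<times> bit"
  obtain b1 n1 e1 b2 n2 e2 where t: "t = ((b1, n1, e1), (b2, n2, e2))" by (metis prod.exhaust)
  have "pairing (\<Sum>m1\<in>UNIV. \<Sum>c1\<in>UNIV. smul (sg (a * c1 * (m + m1)) * iu (a * c1 * (d + c1))) (tens (f a m1 c1) (f a (m + m1) (d + c1))))
      (tens (k b1 n1 e1) (k b2 n2 e2))
    = (\<Sum>m1\<in>UNIV. \<Sum>c1\<in>UNIV. if c1 = e1 then if m1 = n1 then
        if a = b1 \<and> a = b2 \<and> m + n1 = n2 \<and> d + e1 = e2 then sg (a * e1 * n2) * iu (a * e1 * e2) else 0 else 0 else 0)"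
    unfolding pairing_linear by (intro sum.cong refl) auto
  also have "\<dots> = pairing (comult (dual H) (f a m d)) (tens (k b1 n1 e1) (k b2 n2 e2))"
    by (auto simp: pairing_comult_dual[OF fin] k_mul pairing_linear bit_solve add_ac)
  finally show "pairing (comult (dual H) (f a m d)) (case t of (t1, t2) \<Rightarrow> tens (case t1 of (a, m, c) \<Rightarrow> k a m c) (case t2 of (a, m, c) \<Rightarrow> k a m c))
    = pairing (\<Sum>m1\<in>UNIV. \<Sum>c1\<in>UNIV. smul (sg (a * c1 * (m + m1)) * iu (a * c1 * (d + c1))) (tens (f a m1 c1) (f a (m + m1) (d + c1))))
      (case t of (t1, t2) \<Rightarrow> tens (case t1 of (a, m, c) \<Rightarrow> k a m c) (case t2 of (a, m, c) \<Rightarrow> k a m c))"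
    by (simp add: t)
qed (auto intro!: comult_dual_closed vsp_sum vsp_intros tens_closed)

lemma f_antipode: "antipode (dual H) (f a m d) = smul (iu (a * d) * sg (a * d * (m + a * d))) (f a (m + a * d) d)"
proof (rule f_ext)
  fix b n c
  show "pairing (antipode (dual H) (f a m d)) (k b n c)
      = pairing (smul (iu (a * d) * sg (a * d * (m + a * d))) (f a (m + a * d) d)) (k b n c)"
    by (auto simp: pairing_antipode_dual[OF fin k_closed] k_antipode pairing_linear bit_solve)
qed (auto intro: antipode_dual_closed)

text \<open>The threefold product inside \<open>coad\<close> vanishes unless all idempotent labels
  agree; matching the remaining exponents determines the new middle index.\<close>

lemma coad_k: "dd.coad (k a1 n1 c) (f a m d) (k a3 n3 c) = (if a1 = a \<and> a3 = a
    then smul (iu (a * c) * sg (a * c * n3) * sg (a * c * (m + n1 + n3 + a * c)) * iu (a * c * d) * sg (a * (c + d) * n1) * iu (a * (c + d) * c))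
      (f a (m + n1 + n3 + a * c) d) else 0)"
proof (rule f_ext)
  fix b r e
  have *: "a = b \<and> m = n1 + (n3 + (r + b * c)) \<and> d = c + (e + c) \<longleftrightarrow> a = b \<and> r = m + n1 + n3 + a * c \<and> e = d"
    by (auto simp: add_ac)
  show "pairing (dd.coad (k a1 n1 c) (f a m d) (k a3 n3 c)) (k b r e) = pairing (if a1 = a \<and> a3 = a
    then smul (iu (a * c) * sg (a * c * n3) * sg (a * c * (m + n1 + n3 + a * c)) * iu (a * c * d) * sg (a * (c + d) * n1) * iu (a * (c + d) * c))
      (f a (m + n1 + n3 + a * c) d) else 0) (k b r e)"
    unfolding dd.pairing_coad[OF k_closed] k_antipode
    using * by (auto simp: mul_linear k_mul pairing_linear add_ac)
qed (auto intro: dd.coad_closed)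

section \<open>Structure constants of the double\<close>

definition F :: "bit \<Rightarrow> bit \<Rightarrow> bit \<Rightarrow> bit \<Rightarrow> bit \<Rightarrow> bit \<Rightarrow> ('i \<times> 'i \<Rightarrow>\<^sub>0 'k)"
  where "F a m d b n c = tens (f a m d) (k b n c)"

text \<open>The dual basis of \<open>F\<close>, with the bidual of \<open>H\<close> identified with
  \<open>H\<close>.\<close>

definition G :: "bit \<Rightarrow> bit \<Rightarrow> bit \<Rightarrow> bit \<Rightarrow> bit \<Rightarrow> bit \<Rightarrow> ('i \<times> 'i \<Rightarrow>\<^sub>0 'k)"
  where "G a m d b n c = tens (k a m d) (f b n c)"

lemma F_frame: "dframe (basis D) UNIV (\<lambda>((a, m, d), (b, n, c)). F a m d b n c) (\<lambda>((a, m, d), (b, n, c)). G a m d b n c)"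
  using dframe_tens[OF dframe_sym[OF k_frame] k_frame] by (simp add: F_def G_def split_def)

lemma F_closed [simp, intro]: "F a m d b n c \<in> space D" and G_closed [simp, intro]: "G a m d b n c \<in> space D"
  by (auto simp: F_def G_def)

lemma G_F [simp]: "pairing (G a m d b n c) (F a' m' d' b' n' c')
    = (if a = a' \<and> m = m' \<and> d = d' \<and> b = b' \<and> n = n' \<and> c = c' then 1 else 0)"
  by (auto simp: F_def G_def pairing_commute[of "k _ _ _"])

lemma F_ext: "lnr \<phi> \<Longrightarrow> lnr \<psi> \<Longrightarrow> (\<And>a m d b n c. \<phi> (F a m d b n c) = \<psi> (F a m d b n c)) \<Longrightarrow> v \<in> space D \<Longrightarrow> \<phi> v = \<psi> v"
  by (rule dframe_ext[OF F_frame]) auto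

lemma F_fn_ext: "lfn \<phi> \<Longrightarrow> lfn \<psi> \<Longrightarrow> (\<And>a m d b n c. \<phi> (F a m d b n c) = \<psi> (F a m d b n c)) \<Longrightarrow> v \<in> space D \<Longrightarrow> \<phi> v = \<psi> v"
  by (rule dframe_fn_ext[OF F_frame]) auto

lemma k_comult2: "tmap id (comult H) (comult H (k b n c)) = (\<Sum>(b1, b2)\<in>UNIV.
    tens (k b1 n c) (tens (k b2 (n + c * b1) c) (k (b + b1 + b2) (n + c * b1 + c * b2) c)))"
  by (simp add: k_comult sum_UNIV_prod lnr_sum[OF lnr_tmap[OF lnr_id]] tens_linear)

text \<open>Of the four terms of the iterated coproduct of \<open>k b n c\<close> at most one
  survives: the coadjoint action forces the label \<open>a'\<close> on the first leg, and the
  product in \<open>H\<close> forces the label \<open>b\<close> on the second.\<close>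

lemma F_mul: "mul D (F a m d b n c) (F a' m' d' b' n' c') = (if d = d' \<and> b = b' \<and> m' = m + d * a + b * c
    then smul (iu (b * c * c') * sg (b * c * n' + d * n * a' + c * a' * m')) (F (a + a') m d b (n + c * a' + n') (c + c')) else 0)"
proof -
  have "mul D (F a m d b n c) (F a' m' d' b' n' c') = (\<Sum>b1\<in>UNIV. \<Sum>b2\<in>UNIV.
    tens (mul (dual H) (f a m d) (dd.coad (k b1 n c) (f a' m' d') (k (b + b1 + b2) (n + c * b1 + c * b2) c)))
      (k b2 (n + c * b1) c \<star> k b' n' c'))"
    using dd.double_mul_sum[where p = "f a m d" and h = "k b n c" and q = "f a' m' d'" and g = "k b' n' c'",
        OF f_closed k_closed f_closed k_closed k_comult2[unfolded split_def]]
    by (simp add: F_def dd.D_mul sum_UNIV_prod)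
  also have "\<dots> = (\<Sum>b1\<in>UNIV. \<Sum>b2\<in>UNIV. if b2 = b then if b1 = a' then
      tens (mul (dual H) (f a m d) (dd.coad (k a' n c) (f a' m' d') (k a' (n + c * a' + c * b) c)))
      (k b (n + c * a') c \<star> k b' n' c') else 0 else 0)"
    by (intro sum.cong refl) (auto simp: coad_k mul_linear tens_linear bit_solve add_ac)
  also have "\<dots> = tens (mul (dual H) (f a m d) (dd.coad (k a' n c) (f a' m' d') (k a' (n + c * a' + c * b) c)))
      (k b (n + c * a') c \<star> k b' n' c')" by simp
  also have "\<dots> = (if d = d' \<and> b = b' \<and> m' = m + d * a + b * c
    then smul (iu (b * c * c') * sg (b * c * n' + d * n * a' + c * a' * m')) (F (a + a') m d b (n + c * a' + n') (c + c')) else 0)"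
  proof -
    have m: "m' + n + (n + c * a' + c * b) + a' * c = m' + b * c" by (simp add: add_ac mult_ac)
    show ?thesis
      unfolding coad_k m by (auto simp: mul_linear tens_linear f_mul k_mul F_def bit_solve phase_simps)
  qed
  finally show ?thesis .
qed

lemma F_unt: "unt D = (\<Sum>m\<in>UNIV. \<Sum>d\<in>UNIV. \<Sum>b\<in>UNIV. F 0 m d b 0 0)"
  by (simp add: dd.D_unt f_unt one_k sum_bit F_def tens_linear add_ac)

lemma F_counit: "counit D (F a m d b n c) = (if m = 0 \<and> d = 0 \<and> b = 0 then 1 else 0)"
  by (simp add: F_def dd.D_counit f_one k_counit)

lemma F_comult: "comult D (F a m d b n c) = (\<Sum>m1\<in>UNIV. \<Sum>c1\<in>UNIV. \<Sum>b1\<in>UNIV.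
    smul (sg (a * c1 * (m + m1)) * iu (a * c1 * (d + c1)))
      (tens (F a (m + m1) (d + c1) b1 n c) (F a m1 c1 (b + b1) (n + c * b1) c)))"
  by (simp add: F_def dd.D_comult f_comult k_comult tens_linear lnr_sum[OF dd.lnr_shuffle] lnr_smul[OF dd.lnr_shuffle]
      dd.shuffle_tens pm.scale_sum_right sum_bit pm.scale_right_distrib tens_linear lnr_add[OF dd.lnr_shuffle])

text \<open>The antipode is a product of two factors that each contain a unit; after expanding both
  units a single product of basis elements is nonzero.\<close>

lemma F_antipode: "antipode D (F a m d b n c) = smul (iu (a * d) * sg (a * d * (m + a * d)) * iu (b * c) * sg (b * c * n)
      * sg (d * (n + b * c) * a + c * a * (m + a * d))) (F a (m + a * d + b * c) d b (n + b * c + c * a) c)"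
proof -
  have "antipode D (F a m d b n c) = smul (iu (b * c) * sg (b * c * n) * iu (a * d) * sg (a * d * (m + a * d)))
     (\<Sum>m0\<in>UNIV. \<Sum>d0\<in>UNIV. \<Sum>b0\<in>UNIV. mul D (F 0 m0 d0 b (n + b * c) c) (F a (m + a * d) d b0 0 0))"
    unfolding F_def dd.D_antipode f_antipode k_antipode f_unt one_k
    by (simp add: dd.D_mul tens_linear mul_linear sum_bit pm.scale_right_distrib mult_ac add_ac)
  also have "\<dots> = smul (iu (b * c) * sg (b * c * n) * iu (a * d) * sg (a * d * (m + a * d)))
     (\<Sum>m0\<in>UNIV. \<Sum>d0\<in>UNIV. \<Sum>b0\<in>UNIV. if b0 = b then if d0 = d then if m0 = m + a * d + b * c then
       smul (sg (d * (n + b * c) * a + c * a * (m + a * d))) (F a (m + a * d + b * c) d b (n + b * c + c * a) c) else 0 else 0 else 0)"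
    by (intro arg_cong[where f = "smul _"] sum.cong refl) (auto simp: F_mul bit_solve mult_ac)
  also have "\<dots> = smul (iu (a * d) * sg (a * d * (m + a * d)) * iu (b * c) * sg (b * c * n)
      * sg (d * (n + b * c) * a + c * a * (m + a * d))) (F a (m + a * d + b * c) d b (n + b * c + c * a) c)"
    by (simp add: mult_ac)
  finally show ?thesis .
qed

end

subsection \<open>Irreducible representations\<close>

type_synonym rep_index = "bit \<times> bit \<times> bit + (bit \<times> bit \<times> bit) \<times> bit"

text \<open>\<open>Inl\<close> labels characters, \<open>Inr\<close> two-dimensional
  representations. The central character \<open>(0, 0, 0)\<close> is excluded from the latter,
  because the eight characters fill its block; each of the other seven blocks carries two
  representations.\<close>

definition reps :: "rep_index set"
  where "reps = range Inl \<union> Inr ` ((- {(0, 0, 0)}) \<times> UNIV)"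

definition rep_rows :: "rep_index \<Rightarrow> bit set"
  where "rep_rows l = (case l of Inl _ \<Rightarrow> {0} | Inr _ \<Rightarrow> UNIV)"

lemma card_bit [simp]: "card (UNIV :: bit set) = 2"
  by (simp add: UNIV_bit)

lemma card_UNIV_prod: "card (UNIV :: ('a \<times> 'b) set) = card (UNIV :: 'a set) * card (UNIV :: 'b set)"
  by (simp add: card_cartesian_product flip: UNIV_Times_UNIV)

lemma card_reps: "card {l \<in> reps. card (rep_rows l) = 1} = 8" "card {l \<in> reps. card (rep_rows l) = 2} = 14"
  "card (mix reps rep_rows) = 64" "finite reps"
proof -
  let ?X = "(- {(0, 0, 0)}) \<times> UNIV :: ((bit \<times> bit \<times> bit) \<times> bit) set"
  have cX: "card ?X = 14" by (simp add: card_cartesian_product Compl_eq_Diff_UNIV card_Diff_subset card_UNIV_prod)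
  have "{l \<in> reps. card (rep_rows l) = 1} = range Inl" "{l \<in> reps. card (rep_rows l) = 2} = Inr ` ?X"
    by (auto simp: reps_def rep_rows_def)
  then show "card {l \<in> reps. card (rep_rows l) = 1} = 8" "card {l \<in> reps. card (rep_rows l) = 2} = 14"
    by (simp_all add: card_image cX card_UNIV_prod)
  show f: "finite reps" by (simp add: reps_def)
  have "card (mix reps rep_rows) = (\<Sum>l\<in>reps. card (rep_rows l) * card (rep_rows l))"
    unfolding mix_def using f by (subst card_SigmaI) (auto simp: card_cartesian_product)
  also have "\<dots> = (\<Sum>l\<in>range Inl. card (rep_rows l) * card (rep_rows l)) + (\<Sum>l\<in>Inr ` ?X. card (rep_rows l) * card (rep_rows l))"
    unfolding reps_def by (rule sum.union_disjoint) auto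
  also have "\<dots> = 64" by (simp add: sum.reindex rep_rows_def cX card_UNIV_prod)
  finally show "card (mix reps rep_rows) = 64" .
qed

lemma sum_bit_shift: "(\<Sum>b\<in>UNIV. g (b + e)) = (\<Sum>b\<in>UNIV. g b)" for e :: bit
  by (cases e) (simp_all add: sum_bit add_ac)

context h8
begin

text \<open>The matrix coefficients of the irreducible representations, on the basis \<open>F\<close>. A two-dimensional
  representation is monomial: it is indexed by the central character \<open>(b, d, \<delta>)\<close> and a sign \<open>e\<close>.\<close>

definition mc :: "rep_index \<Rightarrow> bit \<Rightarrow> bit \<Rightarrow> bit \<Rightarrow> bit \<Rightarrow> bit \<Rightarrow> bit \<Rightarrow> bit \<Rightarrow> bit \<Rightarrow> 'k" where
  "mc l r s a m d b n c = (case l of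
    Inl (l1, l2, l3) \<Rightarrow> if d = 0 \<and> b = 0 \<and> m = l1 then sg (n * m + l2 * a + l3 * c) else 0
  | Inr ((b', d', \<delta>), e) \<Rightarrow> if d \<noteq> d' \<or> b \<noteq> b' then 0
    else if d' = 1 then (if m = r \<and> s = r + a + b * c
      then sg (n * (\<delta> + 1 + b + r + a) + \<delta> * c * (r + a + b) + e * c) * wu (b * c) * iu (b * \<delta> * c) else 0)
    else if b' = 1 then (if m = r \<and> s = r + c then sg (n * (\<delta> + 1 + r) + \<delta> * a * r + e * a) * wu c else 0)
    else (if m = e \<and> s = r + c then sg (n * (1 + m) + a * r) else 0))"

lemma mc_simps [simp]:
  "mc (Inl (l1, l2, l3)) r s a m d b n c = (if d = 0 \<and> b = 0 \<and> m = l1 then sg (n * m + l2 * a + l3 * c) else 0)"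
  "mc (Inr ((b', 1, \<delta>), e)) r s a m d b n c = (if d = 1 \<and> b = b' \<and> m = r \<and> s = r + a + b * c
    then sg (n * (\<delta> + 1 + b + r + a) + \<delta> * c * (r + a + b) + e * c) * wu (b * c) * iu (b * \<delta> * c) else 0)"
  "mc (Inr ((1, 0, \<delta>), e)) r s a m d b n c = (if d = 0 \<and> b = 1 \<and> m = r \<and> s = r + c
    then sg (n * (\<delta> + 1 + r) + \<delta> * a * r + e * a) * wu c else 0)"
  "mc (Inr ((0, 0, \<delta>), e)) r s a m d b n c = (if d = 0 \<and> b = 0 \<and> m = e \<and> s = r + c
    then sg (n * (1 + m) + a * r) else 0)"
  by (auto simp: mc_def)

definition fE :: "rep_index \<times> bit \<times> bit \<Rightarrow> ('i \<times> 'i \<Rightarrow>\<^sub>0 'k)"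
  where "fE = (\<lambda>(l, r, s). \<Sum>((a, m, d), (b, n, c))\<in>UNIV. smul (mc l r s a m d b n c) (G a m d b n c))"

lemma fE_closed: "fE t \<in> space D"
  by (auto simp: fE_def simp del: dd.D_basis intro!: vsp_sum vsp_intros split: prod.split)

lemma fE_F [simp]: "pairing (fE (l, r, s)) (F a m d b n c) = mc l r s a m d b n c"
proof -
  have "pairing (fE (l, r, s)) (F a m d b n c)
    = (\<Sum>t\<in>UNIV. if t = ((a, m, d), (b, n, c)) then mc l r s a m d b n c else 0)"
    unfolding fE_def split_conv pairing_linear by (intro sum.cong refl) (auto simp: pairing_linear split: if_splits)
  then show ?thesis by simp
qed

lemma F_closed_ext: "lnr \<phi> \<Longrightarrow> pm.subspace S \<Longrightarrow> (\<And>a m d b n c. \<phi> (F a m d b n c) \<in> S) \<Longrightarrow> v \<in> space D \<Longrightarrow> \<phi> v \<in> S"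
  by (rule dframe_closed[OF F_frame]) auto

lemma D_mul_closed:
  assumes "v1 \<in> space D" "v2 \<in> space D"
  shows "mul D v1 v2 \<in> space D"
proof (rule F_closed_ext[OF _ vsp_subspace _ assms(1)])
  fix a m d b n c
  show "mul D (F a m d b n c) v2 \<in> space D"
    by (rule F_closed_ext[OF _ vsp_subspace _ assms(2)]) (auto simp: F_mul simp del: dd.D_basis intro!: lnr_intros)
qed (intro lnr_intros)

text \<open>The matrices are monomial: row \<open>r\<close> has at most one nonzero entry, so the
  sum over \<open>q\<close> reduces to one column \<open>?q\<close>. The three cases are the three
  shapes of two-dimensional matrices in \<open>mc\<close>.\<close>

lemma mc_mul:
  assumes "l \<in> reps" "r \<in> rep_rows l" "s \<in> rep_rows l"
  shows "pairing (fE (l, r, s)) (mul D (F a m d b n c) (F a' m' d' b' n' c'))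
    = (\<Sum>q\<in>rep_rows l. mc l r q a m d b n c * mc l q s a' m' d' b' n' c')"
proof (cases l)
  case (Inl h)
  then show ?thesis using assms
    by (cases h) (auto simp: rep_rows_def F_mul pairing_linear phase_simps)
next
  case (Inr ge)
  obtain B D' \<delta> e where ge: "ge = ((B, D', \<delta>), e)" by (metis prod.exhaust)
  consider "D' = 1" | "D' = 0" "B = 1" | "D' = 0" "B = 0" by (cases D'; cases B) auto
  then show ?thesis
  proof cases
    case 1
    let ?q = "r + a + b * c"
    have *: "mc l r q a m d b n c * mc l q s a' m' d' b' n' c' = (if q = ?q then mc l r ?q a m d b n c * mc l ?q s a' m' d' b' n' c' else 0)" for q
      by (auto simp: Inr ge 1)
    have "(\<Sum>q\<in>rep_rows l. mc l r q a m d b n c * mc l q s a' m' d' b' n' c')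
        = (\<Sum>q\<in>rep_rows l. if q = ?q then mc l r ?q a m d b n c * mc l ?q s a' m' d' b' n' c' else 0)"
      by (intro sum.cong refl *)
    also have "\<dots> = mc l r ?q a m d b n c * mc l ?q s a' m' d' b' n' c'"
      by (simp add: rep_rows_def Inr)
    also have "\<dots> = pairing (fE (l, r, s)) (mul D (F a m d b n c) (F a' m' d' b' n' c'))"
    \<comment> \<open>If all index conditions hold, only the phases remain to be compared; otherwise
      both sides vanish.\<close>
    proof (cases "d = D' \<and> b = B \<and> m = r \<and> d' = D' \<and> b' = B \<and> m' = ?q \<and> s = ?q + a' + b * c'")
      case True
      then show ?thesis by (simp add: Inr ge 1 F_mul pairing_linear phase_simps)
    next
      case False
      then show ?thesis by (auto simp: Inr ge 1 F_mul pairing_linear distrib_left add_ac)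
    qed
    finally show ?thesis ..
  next
    case 2
    let ?q = "r + c"
    have *: "mc l r q a m d b n c * mc l q s a' m' d' b' n' c' = (if q = ?q then mc l r ?q a m d b n c * mc l ?q s a' m' d' b' n' c' else 0)" for q
      by (auto simp: Inr ge 2)
    have "(\<Sum>q\<in>rep_rows l. mc l r q a m d b n c * mc l q s a' m' d' b' n' c')
        = (\<Sum>q\<in>rep_rows l. if q = ?q then mc l r ?q a m d b n c * mc l ?q s a' m' d' b' n' c' else 0)"
      by (intro sum.cong refl *)
    also have "\<dots> = mc l r ?q a m d b n c * mc l ?q s a' m' d' b' n' c'"
      by (simp add: rep_rows_def Inr)
    also have "\<dots> = pairing (fE (l, r, s)) (mul D (F a m d b n c) (F a' m' d' b' n' c'))"
    proof (cases "d = D' \<and> b = B \<and> m = r \<and> d' = D' \<and> b' = B \<and> m' = ?q \<and> s = ?q + c'")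
      case True
      then show ?thesis by (simp add: Inr ge 2 F_mul pairing_linear phase_simps)
    next
      case False
      then show ?thesis by (auto simp: Inr ge 2 F_mul pairing_linear distrib_left add_ac)
    qed
    finally show ?thesis ..
  next
    case 3
    let ?q = "r + c"
    have *: "mc l r q a m d b n c * mc l q s a' m' d' b' n' c' = (if q = ?q then mc l r ?q a m d b n c * mc l ?q s a' m' d' b' n' c' else 0)" for q
      by (auto simp: Inr ge 3)
    have "(\<Sum>q\<in>rep_rows l. mc l r q a m d b n c * mc l q s a' m' d' b' n' c')
        = (\<Sum>q\<in>rep_rows l. if q = ?q then mc l r ?q a m d b n c * mc l ?q s a' m' d' b' n' c' else 0)"
      by (intro sum.cong refl *)
    also have "\<dots> = mc l r ?q a m d b n c * mc l ?q s a' m' d' b' n' c'"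
      by (simp add: rep_rows_def Inr)
    also have "\<dots> = pairing (fE (l, r, s)) (mul D (F a m d b n c) (F a' m' d' b' n' c'))"
    proof (cases "d = D' \<and> b = B \<and> m = e \<and> d' = D' \<and> b' = B \<and> m' = e \<and> s = ?q + c'")
      case True
      then show ?thesis by (simp add: Inr ge 3 F_mul pairing_linear phase_simps)
    next
      case False
      then show ?thesis by (auto simp: Inr ge 3 F_mul pairing_linear distrib_left add_ac)
    qed
    finally show ?thesis ..
  qed
qed

section \<open>Completeness of the matrix coefficients\<close>

lemma D_ext: "p \<in> space D \<Longrightarrow> q \<in> space D \<Longrightarrow> (\<And>a m d b n c. pairing p (F a m d b n c) = pairing q (F a m d b n c)) \<Longrightarrow> p = q"
  by (rule dframe_pairing_ext'[OF F_frame]) auto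

text \<open>The inverse of \<open>wu b\<close>; for \<open>b = 1\<close> it is
  \<open>- im * w\<close>.\<close>

definition cwu :: "bit \<Rightarrow> 'k" where "cwu b = wu b * iu b * sg b"

lemma cwu_simps [simp]: "cwu 0 = 1" "w * cwu 1 = 1" "cwu 1 * w = 1" "w * (cwu 1 * r) = r"
  using w2 im2' by (auto simp: cwu_def mult_ac)

text \<open>Fourier inversion on each block.\<close>

lemma G_fE1: "G a m 1 b n c = smul (1/4) (\<Sum>\<delta>\<in>UNIV. \<Sum>e\<in>UNIV.
    smul (sg (n * (\<delta> + 1 + b + m + a) + \<delta> * c * (m + a + b) + e * c) * cwu (b * c) * iu (b * \<delta> * c) * sg (b * \<delta> * c))
      (fE (Inr ((b, 1, \<delta>), e), m, m + a + b * c)))"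
proof (rule D_ext)
  fix a' m' d' b' n' c'
  show "pairing (G a m 1 b n c) (F a' m' d' b' n' c') = pairing (smul (1/4) (\<Sum>\<delta>\<in>UNIV. \<Sum>e\<in>UNIV.
    smul (sg (n * (\<delta> + 1 + b + m + a) + \<delta> * c * (m + a + b) + e * c) * cwu (b * c) * iu (b * \<delta> * c) * sg (b * \<delta> * c))
      (fE (Inr ((b, 1, \<delta>), e), m, m + a + b * c)))) (F a' m' d' b' n' c')"
  proof (cases "d' = 1 \<and> b' = b \<and> m' = m \<and> a' + b * c' = a + b * c")
    case True
    then have a': "a' = a + b * c + b * c'" by (simp add: bit_solve)
    show ?thesis
      using True unfolding a' pairing_linear
      by (cases b; cases c; cases c'; cases n; cases n'; simp add: sum_bit sg_add)
  next
    case False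
    then show ?thesis
      by (auto simp: pairing_linear bit_solve add_ac intro!: sum.neutral)
  qed
qed (auto intro!: vsp_intros vsp_sum fE_closed simp del: dd.D_basis)

lemma G_fE2: "G a m 0 1 n c = smul (1/4) (\<Sum>\<delta>\<in>UNIV. \<Sum>e\<in>UNIV.
    smul (sg (n * (\<delta> + 1 + m) + \<delta> * a * m + e * a) * cwu c) (fE (Inr ((1, 0, \<delta>), e), m, m + c)))"
proof (rule D_ext)
  fix a' m' d' b' n' c'
  show "pairing (G a m 0 1 n c) (F a' m' d' b' n' c') = pairing (smul (1/4) (\<Sum>\<delta>\<in>UNIV. \<Sum>e\<in>UNIV.
    smul (sg (n * (\<delta> + 1 + m) + \<delta> * a * m + e * a) * cwu c) (fE (Inr ((1, 0, \<delta>), e), m, m + c)))) (F a' m' d' b' n' c')"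
  proof (cases "d' = 0 \<and> b' = 1 \<and> m' = m \<and> c' = c")
    case True
    then show ?thesis
      unfolding pairing_linear
      by (cases a; cases a'; cases c; cases n; cases n'; simp add: sum_bit sg_add)
  next
    case False
    then show ?thesis
      by (auto simp: pairing_linear bit_solve add_ac intro!: sum.neutral)
  qed
qed (auto intro!: vsp_intros vsp_sum fE_closed simp del: dd.D_basis)

text \<open>Both kinds of representations contribute. For equal \<open>a\<close> and
  \<open>c\<close> the two-dimensional ones give \<open>sg ((n + n') * (1 + m))\<close> and the
  characters \<open>sg ((n + n') * m)\<close>, each with weight 1/2; these signs agree for
  \<open>n = n'\<close> and cancel otherwise.\<close>

lemma G_fE3: "G a m 0 0 n c = smul (1/4) (\<Sum>r\<in>UNIV. smul (sg (n * (1 + m) + a * r)) (fE (Inr ((0, 0, 1), m), r, r + c)))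
    + smul (1/8) (\<Sum>l2\<in>UNIV. \<Sum>l3\<in>UNIV. smul (sg (n * m + l2 * a + l3 * c)) (fE (Inl (m, l2, l3), 0, 0)))"
proof (rule D_ext)
  fix a' m' d' b' n' c'
  show "pairing (G a m 0 0 n c) (F a' m' d' b' n' c') = pairing
    (smul (1/4) (\<Sum>r\<in>UNIV. smul (sg (n * (1 + m) + a * r)) (fE (Inr ((0, 0, 1), m), r, r + c)))
    + smul (1/8) (\<Sum>l2\<in>UNIV. \<Sum>l3\<in>UNIV. smul (sg (n * m + l2 * a + l3 * c)) (fE (Inl (m, l2, l3), 0, 0)))) (F a' m' d' b' n' c')"
  proof (cases "d' = 0 \<and> b' = 0 \<and> m' = m")
    case True
    then show ?thesis
      unfolding pairing_linear
      by (cases a; cases a'; cases c; cases c'; cases n; cases n'; cases m; simp add: sum_bit sg_add)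
  next
    case False
    then show ?thesis
      by (auto simp: pairing_linear)
  qed
qed (auto intro!: vsp_intros vsp_sum fE_closed simp del: dd.D_basis)

lemma G_span: "G a m d b n c \<in> pm.span (fE ` mix reps rep_rows)"
proof -
  have m1: "fE (Inr (g, e), r, s) \<in> pm.span (fE ` mix reps rep_rows)" if "g \<noteq> (0, 0, 0)" for g e r s
    by (rule pm.span_base) (use that in \<open>auto simp: reps_def rep_rows_def\<close>)
  have m2: "fE (Inl h, 0, 0) \<in> pm.span (fE ` mix reps rep_rows)" for h
    by (rule pm.span_base) (auto simp: reps_def rep_rows_def)
  consider "d = 1" | "d = 0" "b = 1" | "d = 0" "b = 0" by (cases d; cases b) auto
  then show ?thesis
    by cases (simp_all only: G_fE1 G_fE2 G_fE3, (intro pm.span_add pm.span_scale pm.span_sum m1 m2; simp)+)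
qed

text \<open>The basis \<open>G\<close> has 64 elements and lies in the span of the 64 functionals
  \<open>fE\<close>, so the latter form a basis too.\<close>

lemma E_frame_ex: "\<exists>E. dframe (basis D) (mix reps rep_rows) E fE"
proof -
  have "\<exists>f'. dframe (basis D) (mix reps rep_rows) fE f'"
  proof (rule dframe_ex_card[OF dframe_sym[OF F_frame]])
    show "finite (mix reps rep_rows)" using card_reps(3) card.infinite by fastforce
    show "card (mix reps rep_rows) = card (UNIV :: ((bit \<times> bit \<times> bit) \<times> bit \<times> bit \<times> bit) set)"
      by (simp add: card_reps card_UNIV_prod)
  qed (auto simp: G_span simp del: dd.D_basis intro: fE_closed)
  then show ?thesis using dframe_sym by blast
qed

definition E :: "rep_index \<times> bit \<times> bit \<Rightarrow> ('i \<times> 'i \<Rightarrow>\<^sub>0 'k)"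
  where "E = (SOME E. dframe (basis D) (mix reps rep_rows) E fE)"

lemma E_frame: "dframe (basis D) (mix reps rep_rows) E fE"
  unfolding E_def by (rule someI_ex[OF E_frame_ex])

sublocale rep: mat_alg D reps rep_rows E fE
proof
  show "finite reps" by (rule card_reps)
  show "finite (rep_rows l)" "rep_rows l \<noteq> {}" for l by (auto simp: rep_rows_def split: sum.split)
  show "dframe (basis D) (mix reps rep_rows) E fE" by (rule E_frame)
  show "mul D u v \<in> space D" if "u \<in> space D" "v \<in> space D" for u v by (rule D_mul_closed[OF that])
  show "unt D \<in> space D" unfolding F_unt by (intro vsp_sum F_closed)
  fix l r s assume l: "(l, r, s) \<in> mix reps rep_rows"
  then have l': "l \<in> reps" "r \<in> rep_rows l" "s \<in> rep_rows l" by auto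
  show "pairing (fE (l, r, s)) (unt D) = (if r = s then 1 else 0)"
  proof (cases l)
    case (Inl h)
    then show ?thesis using l' by (cases h; cases "fst h") (auto simp: F_unt pairing_linear sum_bit rep_rows_def)
  next
    case (Inr ge)
    obtain B D' \<delta> e where ge: "ge = ((B, D', \<delta>), e)" by (metis prod.exhaust)
    show ?thesis
      by (cases B; cases D'; cases e; cases r; cases s; simp add: Inr ge F_unt pairing_linear sum_bit)
  qed
  fix u v assume u: "u \<in> space D" and v: "v \<in> space D"
  show "pairing (fE (l, r, s)) (mul D u v) = (\<Sum>q\<in>rep_rows l. pairing (fE (l, r, q)) u * pairing (fE (l, q, s)) v)"
  proof (rule F_fn_ext[OF _ _ _ u])
    show "lfn (\<lambda>u. pairing (fE (l, r, s)) (mul D u v))" by (intro lnr_intros)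
    show "lfn (\<lambda>u. \<Sum>q\<in>rep_rows l. pairing (fE (l, r, q)) u * pairing (fE (l, q, s)) v)"
      by (simp add: lfn_def pairing_linear algebra_simps sum.distrib sum_distrib_left)
    fix a m d b n c
    show "pairing (fE (l, r, s)) (mul D (F a m d b n c) v) = (\<Sum>q\<in>rep_rows l. pairing (fE (l, r, q)) (F a m d b n c) * pairing (fE (l, q, s)) v)"
    proof (rule F_fn_ext[OF _ _ _ v])
      show "lfn (\<lambda>v. pairing (fE (l, r, s)) (mul D (F a m d b n c) v))" by (intro lnr_intros)
      show "lfn (\<lambda>v. \<Sum>q\<in>rep_rows l. pairing (fE (l, r, q)) (F a m d b n c) * pairing (fE (l, q, s)) v)"
        by (simp add: lfn_def pairing_linear algebra_simps sum.distrib sum_distrib_left)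
    qed (simp add: mc_mul[OF l'])
  qed
qed

end

subsection \<open>Irreducible corepresentations\<close>

text \<open>A tensor product of an irreducible corepresentation of the dual (first label) with one
  of \<open>H\<close> (second label).\<close>

type_synonym corep_index = "(bit \<times> bit) option \<times> (bit \<times> bit) option"

definition rows1 :: "(bit \<times> bit) option \<Rightarrow> bit set"
  where "rows1 h = (case h of None \<Rightarrow> UNIV | Some _ \<Rightarrow> {0})"

definition corep_rows :: "corep_index \<Rightarrow> (bit \<times> bit) set"
  where "corep_rows l = rows1 (fst l) \<times> rows1 (snd l)"

lemma sum_UNIV_option: "(\<Sum>h\<in>UNIV. g h) = g None + (\<Sum>a\<in>UNIV. g (Some a))" for g :: "'a::finite option \<Rightarrow> 'b::comm_monoid_add"
  by (simp add: UNIV_option_conv sum.reindex)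

lemma card_rows1: "card (rows1 h) = (if h = None then 2 else 1)"
  by (cases h) (simp_all add: rows1_def)

lemma card_corep_rows: "card (corep_rows l) = (if fst l = None then 2 else 1) * (if snd l = None then 2 else 1)"
  by (simp add: corep_rows_def card_cartesian_product card_rows1)

lemma card_coreps: "card {l. card (corep_rows l) = 1} = 16" "card {l. card (corep_rows l) = 2} = 8"
  "card {l. card (corep_rows l) = 4} = 1" "card (mix UNIV corep_rows) = 64"
proof -
  have c: "card {h :: (bit \<times> bit) option. h \<noteq> None} = 4"
  proof -
    have "{h :: (bit \<times> bit) option. h \<noteq> None} = range Some" by (auto simp: not_None_eq)
    then show ?thesis by (simp add: card_image card_UNIV_prod)
  qed
  define S where "S = {h :: (bit \<times> bit) option. h \<noteq> None}"
  have cS: "card S = 4" and fS: "finite S" using c by (simp_all add: S_def)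
  have "{l. card (corep_rows l) = 1} = S \<times> S"
    "{l. card (corep_rows l) = 2} = ({None} \<times> S) \<union> (S \<times> {None})"
    "{l. card (corep_rows l) = 4} = {None} \<times> {None}"
    by (auto simp: S_def card_corep_rows simp del: not_None_eq split: if_splits) (metis not_None_eq surj_pair)
  moreover have "card (({None} \<times> S) \<union> (S \<times> {None})) = 8"
    by (subst card_Un_disjoint) (auto simp: card_cartesian_product cS fS, simp_all add: S_def)
  ultimately show "card {l. card (corep_rows l) = 1} = 16" "card {l. card (corep_rows l) = 2} = 8"
    "card {l. card (corep_rows l) = 4} = 1"
    by (simp_all add: card_cartesian_product cS)
  have "card (mix UNIV corep_rows) = (\<Sum>l\<in>UNIV. card (corep_rows l) * card (corep_rows l))"
    unfolding mix_def by (subst card_SigmaI) (auto simp: card_cartesian_product corep_rows_def rows1_def split: option.split)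
  then show "card (mix UNIV corep_rows) = 64"
    by (simp add: card_corep_rows sum_UNIV_prod sum_UNIV_option card_UNIV_prod)
qed

lemma span_tens:
  assumes "v \<in> pm.span B" "v' \<in> pm.span C" "\<And>b c. b \<in> B \<Longrightarrow> c \<in> C \<Longrightarrow> tens b c \<in> pm.span S"
  shows "tens v v' \<in> pm.span S"
proof (rule span_closed[OF lnr_tens1 assms(1) pm.subspace_span])
  fix b assume b: "b \<in> B"
  show "tens b v' \<in> pm.span S"
    by (rule span_closed[OF lnr_tens2 assms(2) pm.subspace_span]) (rule assms(3)[OF b])
qed

context h8
begin

text \<open>The irreducible corepresentations of \<open>H\<^sub>8\<close> and of its dual; \<open>None\<close> is the two-dimensional one.\<close>

definition hh :: "(bit \<times> bit) option \<Rightarrow> bit \<Rightarrow> bit \<Rightarrow> ('i \<Rightarrow>\<^sub>0 'k)" where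
  "hh h r s = (case h of None \<Rightarrow> k (r + s) r 1 | Some (j, n) \<Rightarrow> \<Sum>a\<in>UNIV. smul (sg (a * j)) (k a n 0))"

definition pp :: "(bit \<times> bit) option \<Rightarrow> bit \<Rightarrow> bit \<Rightarrow> ('i \<Rightarrow>\<^sub>0 'k)" where
  "pp h r s = (case h of None \<Rightarrow> \<Sum>m\<in>UNIV. smul (sg (m * r) * iu ((1 + r) * s)) (f 1 m (r + s))
    | Some (j, n) \<Rightarrow> \<Sum>m\<in>UNIV. \<Sum>c\<in>UNIV. smul (sg (j * m + n * c)) (f 0 m c))"

lemma hh_closed: "hh h r s \<in> space H" and pp_closed: "pp h r s \<in> space H"
  by (auto simp: hh_def pp_def split: option.split prod.split intro!: vsp_sum vsp_intros)

lemma hh_comult: "r \<in> rows1 h \<Longrightarrow> s \<in> rows1 h \<Longrightarrow> comult H (hh h r s) = (\<Sum>q\<in>rows1 h. tens (hh h r q) (hh h q s))"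
proof (cases h)
  case None
  \<comment> \<open>The substitution \<open>q = r + b\<close> turns the sum of
    \<open>k_comult\<close> into a matrix product.\<close>
  have "(\<Sum>b\<in>UNIV. tens (k b r 1) (k (r + s + b) (r + b) 1)) = (\<Sum>q\<in>UNIV. tens (k (r + q) r 1) (k (q + s) q 1))"
    using sum_bit_shift[of "\<lambda>b. tens (k b r 1) (k (r + s + b) (r + b) 1)" r] by (simp add: add_ac)
  then show ?thesis by (simp add: None hh_def rows1_def k_comult)
next
  case (Some jn)
  obtain j n where jn: "jn = (j, n)" by (cases jn)
  assume "r \<in> rows1 h" "s \<in> rows1 h"
  then have rs: "r = 0" "s = 0" by (simp_all add: Some rows1_def)
  show ?thesis
    by (cases j; rule poly_mapping_eqI)
      (simp_all add: Some jn rs hh_def rows1_def k_comult lnr_sum[OF lnr_comult'] lnr_smul[OF lnr_comult'] comult_linear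
        sum_bit tens_linear lookup_add lookup_minus algebra_simps)
qed

lemma hh_counit: "r \<in> rows1 h \<Longrightarrow> s \<in> rows1 h \<Longrightarrow> counit H (hh h r s) = (if r = s then 1 else 0)"
  by (cases h; cases r; cases s)
    (auto simp: hh_def rows1_def lfn_sum[OF lfn_comp(4)] lfn_add[OF lfn_comp(4)] lfn_smul[OF lfn_comp(4)] k_counit sum_bit)

lemma pp_comult: "r \<in> rows1 h \<Longrightarrow> s \<in> rows1 h \<Longrightarrow> comult (dual H) (pp h r s) = (\<Sum>q\<in>rows1 h. tens (pp h r q) (pp h q s))"
proof (cases h)
  case None
  show ?thesis
    by (cases r; cases s; rule poly_mapping_eqI)
      (simp_all add: None pp_def rows1_def f_comult lnr_add[OF lnr_comult'] lnr_smul[OF lnr_comult']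
        sum_bit tens_linear lookup_add lookup_minus algebra_simps)
next
  case (Some jn)
  obtain j n where jn: "jn = (j, n)" by (cases jn)
  assume "r \<in> rows1 h" "s \<in> rows1 h"
  then have rs: "r = 0" "s = 0" by (simp_all add: Some rows1_def)
  show ?thesis
    by (cases j; cases n; rule poly_mapping_eqI)
      (simp_all add: Some jn rs pp_def rows1_def f_comult lnr_add[OF lnr_comult'] lnr_smul[OF lnr_comult']
        sum_bit tens_linear lookup_add lookup_minus algebra_simps)
qed

lemma pp_counit: "r \<in> rows1 h \<Longrightarrow> s \<in> rows1 h \<Longrightarrow> pairing (pp h r s) \<one>\<^sub>H = (if r = s then 1 else 0)"
  by (cases h; cases r; cases s) (auto simp: pp_def rows1_def pairing_linear f_one sum_bit)

text \<open>Fourier inversion over the sign \<open>j\<close> recovers the elements with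
  \<open>c = 0\<close>; those with \<open>c = 1\<close> are matrix coefficients already.\<close>

lemma k_span: "k a n c \<in> pm.span {hh h r s |h r s. r \<in> rows1 h \<and> s \<in> rows1 h}" (is "_ \<in> pm.span ?B")
proof (cases "c = 0")
  case True
  have "k a n 0 = smul (1/2) (\<Sum>j\<in>UNIV. smul (sg (a * j)) (hh (Some (j, n)) 0 0))"
    by (cases a; rule poly_mapping_eqI; simp add: hh_def sum_bit lookup_add lookup_minus)
  moreover have "hh (Some (j, n)) 0 0 \<in> pm.span ?B" for j
    by (rule pm.span_base) (force simp: rows1_def)
  ultimately show ?thesis using True by (simp only:) (intro pm.span_scale pm.span_sum)
next
  case False
  then have "k a n c = hh None n (n + a)" by (simp add: hh_def)
  moreover have "hh None r s \<in> pm.span ?B" for r s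
    by (rule pm.span_base) (force simp: rows1_def)
  ultimately show ?thesis by simp
qed

lemma f_span: "f a m c \<in> pm.span {pp h r s |h r s. r \<in> rows1 h \<and> s \<in> rows1 h}" (is "_ \<in> pm.span ?B")
proof (cases "a = 0")
  case True
  have "f 0 m c = smul (1/4) (\<Sum>j\<in>UNIV. \<Sum>n\<in>UNIV. smul (sg (j * m + n * c)) (pp (Some (j, n)) 0 0))"
    by (cases m; cases c; rule poly_mapping_eqI; simp add: pp_def sum_bit lookup_add lookup_minus)
  moreover have "pp (Some (j, n)) 0 0 \<in> pm.span ?B" for j n
    by (rule pm.span_base) (force simp: rows1_def)
  ultimately show ?thesis using True by (simp only:) (intro pm.span_scale pm.span_sum)
next
  case False
  have "f 1 m c = smul (1/2) (\<Sum>r\<in>UNIV. smul (sg (m * r) * iu ((1 + r) * (r + c)) * sg ((1 + r) * (r + c))) (pp None r (r + c)))"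
    by (cases m; cases c; rule poly_mapping_eqI; simp add: pp_def sum_bit lookup_add lookup_minus algebra_simps)
  moreover have "pp None r s \<in> pm.span ?B" for r s
    by (rule pm.span_base) (force simp: rows1_def)
  ultimately show ?thesis using False by (simp only: bit_not_zero_iff) (intro pm.span_scale pm.span_sum)
qed

text \<open>Row and column of the factor \<open>pp\<close> are exchanged because the double contains
  the dual with the opposite coproduct.\<close>

definition P :: "corep_index \<times> (bit \<times> bit) \<times> (bit \<times> bit) \<Rightarrow> ('i \<times> 'i \<Rightarrow>\<^sub>0 'k)"
  where "P = (\<lambda>(l, r, s). tens (pp (fst l) (fst s) (fst r)) (hh (snd l) (snd r) (snd s)))"

lemma P_frame_ex: "\<exists>g. dframe (basis D) (mix UNIV corep_rows) P g"
proof (rule dframe_ex_card[OF F_frame])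
  show "finite (mix UNIV corep_rows)" using card_coreps(4) card.infinite by fastforce
  show "card (mix UNIV corep_rows) = card (UNIV :: ((bit \<times> bit \<times> bit) \<times> bit \<times> bit \<times> bit) set)"
    by (simp add: card_coreps card_UNIV_prod)
  show "P t \<in> space D" for t by (auto simp: P_def split_def intro: pp_closed hh_closed)
  fix t :: "(bit \<times> bit \<times> bit) \<times> bit \<times> bit \<times> bit"
  have "F a m d b n c \<in> pm.span (P ` mix UNIV corep_rows)" for a m d b n c
    unfolding F_def
  proof (rule span_tens[OF f_span k_span], clarify)
    fix h r s h' r' s' assume "r \<in> rows1 h" "s \<in> rows1 h" "r' \<in> rows1 h'" "s' \<in> rows1 h'"
    then show "tens (pp h r s) (hh h' r' s') \<in> pm.span (P ` mix UNIV corep_rows)"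
      by (intro pm.span_base image_eqI[of _ _ "((h, h'), (s, r'), (r, s'))"]) (auto simp: P_def corep_rows_def)
  qed
  then show "(\<lambda>((a, m, d), (b, n, c)). F a m d b n c) t \<in> pm.span (P ` mix UNIV corep_rows)"
    by (auto split: prod.split)
qed

definition fP :: "corep_index \<times> (bit \<times> bit) \<times> (bit \<times> bit) \<Rightarrow> ('i \<times> 'i \<Rightarrow>\<^sub>0 'k)"
  where "fP = (SOME g. dframe (basis D) (mix UNIV corep_rows) P g)"

sublocale corep: comat D UNIV corep_rows P fP
proof
  show "finite (corep_rows l)" "corep_rows l \<noteq> {}" for l
    by (auto simp: corep_rows_def rows1_def split: option.split)
  show "dframe (basis D) (mix UNIV corep_rows) P fP"
    unfolding fP_def by (rule someI_ex[OF P_frame_ex])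
  fix l r s assume "(l, r, s) \<in> mix UNIV corep_rows"
  then have rows: "fst r \<in> rows1 (fst l)" "snd r \<in> rows1 (snd l)" "fst s \<in> rows1 (fst l)" "snd s \<in> rows1 (snd l)"
    by (auto simp: corep_rows_def)
  show "counit D (P (l, r, s)) = (if r = s then 1 else 0)"
    using rows by (auto simp: P_def dd.D_counit pp_counit hh_counit prod_eq_iff)
  have "comult D (P (l, r, s)) = (\<Sum>q\<in>rows1 (fst l). \<Sum>q'\<in>rows1 (snd l). tens (P (l, r, (q, q'))) (P (l, (q, q'), s)))"
    using rows by (simp add: P_def dd.D_comult pp_comult hh_comult tens_linear lnr_sum[OF dd.lnr_shuffle] dd.shuffle_tens)
      (rule sum.swap)
  then show "comult D (P (l, r, s)) = (\<Sum>q\<in>corep_rows l. tens (P (l, r, q)) (P (l, q, s)))"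
    by (simp add: corep_rows_def sum.cartesian_product split_def)
qed simp

subsection \<open>Hopf algebra axioms\<close>

text \<open>The product of the coproducts is a sixfold sum. Nonvanishing of both tensor factors
  fixes the three summation indices of the second coproduct, and the remaining constraint
  \<open>?C\<close> is the condition for the original product to be nonzero.\<close>

lemma D_comult_mul_F: "comult D (mul D (F a m d b n c) (F a' m' d' b' n' c'))
    = mul (tensor_alg D D) (comult D (F a m d b n c)) (comult D (F a' m' d' b' n' c'))"
proof -
  let ?M = "\<lambda>m1 c1 b1. m1 + c1 * a + (b + b1) * c"
  let ?Y = "\<lambda>m1 c1 b1. smul (iu (b * c * c') * sg (b * c * n' + d * n * a' + c * a' * m')
     * (sg ((a + a') * c1 * (m + m1)) * iu ((a + a') * c1 * (d + c1))))
     (tens (F (a + a') (m + m1) (d + c1) b1 (n + c * a' + n') (c + c'))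
       (F (a + a') m1 c1 (b + b1) (n + c * a' + n' + (c + c') * b1) (c + c')))"
  let ?C = "d = d' \<and> b = b' \<and> m' = m + d * a + b * c"
  have "mul (tensor_alg D D) (comult D (F a m d b n c)) (comult D (F a' m' d' b' n' c'))
    = (\<Sum>m1\<in>UNIV. \<Sum>c1\<in>UNIV. \<Sum>b1\<in>UNIV. \<Sum>m1'\<in>UNIV. \<Sum>c1'\<in>UNIV. \<Sum>b1'\<in>UNIV.
      smul (sg (a * c1 * (m + m1)) * iu (a * c1 * (d + c1)) * (sg (a' * c1' * (m' + m1')) * iu (a' * c1' * (d' + c1'))))
      (tens (mul D (F a (m + m1) (d + c1) b1 n c) (F a' (m' + m1') (d' + c1') b1' n' c'))
        (mul D (F a m1 c1 (b + b1) (n + c * b1) c) (F a' m1' c1' (b' + b1') (n' + c' * b1') c'))))"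
    unfolding F_comult[of a m d b n c] mul_linear(9) mul_linear(3) unfolding F_comult mul_linear(10) mul_linear(4)
    by (simp only: mul_tensor_alg smul_smul pm.scale_sum_right)
  also have "\<dots> = (\<Sum>m1\<in>UNIV. \<Sum>c1\<in>UNIV. \<Sum>b1\<in>UNIV. \<Sum>m1'\<in>UNIV. \<Sum>c1'\<in>UNIV. \<Sum>b1'\<in>UNIV.
      if b1' = b1 then if c1' = c1 then if m1' = ?M m1 c1 b1 then if ?C then ?Y m1 c1 b1 else 0 else 0 else 0 else 0)"
  proof (intro sum.cong refl)
    fix m1 c1 b1 m1' c1' b1'
    show "smul (sg (a * c1 * (m + m1)) * iu (a * c1 * (d + c1)) * (sg (a' * c1' * (m' + m1')) * iu (a' * c1' * (d' + c1'))))
      (tens (mul D (F a (m + m1) (d + c1) b1 n c) (F a' (m' + m1') (d' + c1') b1' n' c'))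
        (mul D (F a m1 c1 (b + b1) (n + c * b1) c) (F a' m1' c1' (b' + b1') (n' + c' * b1') c')))
      = (if b1' = b1 then if c1' = c1 then if m1' = ?M m1 c1 b1 then if ?C then ?Y m1 c1 b1 else 0 else 0 else 0 else 0)"
    proof (cases "b1' = b1 \<and> c1' = c1 \<and> m1' = ?M m1 c1 b1 \<and> ?C")
      case True
      then show ?thesis by (simp add: F_mul tens_linear phase_simps)
    next
      case False
      \<comment> \<open>Linear equations over the field with two elements: if both products are
        nonzero, the summation indices match and \<open>?C\<close> holds.\<close>
      have "b1' = b1 \<and> c1' = c1 \<and> m1' = ?M m1 c1 b1 \<and> ?C"
        if *: "d + c1 = d' + c1'" "b1 = b1'" "m' + m1' = m + m1 + (d + c1) * a + b1 * c"
          "c1 = c1'" "b + b1 = b' + b1'" "m1' = m1 + c1 * a + (b + b1) * c"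
      proof -
        have "m' = m + m1 + (d + c1) * a + b1 * c + m1'" using *(3) by (simp add: bit_solve)
        then have "m' = m + d * a + b * c" unfolding *(6) by (simp add: distrib_right add_ac)
        then show ?thesis using * by (simp add: bit_solve)
      qed
      with False consider
        "\<not> (d + c1 = d' + c1' \<and> b1 = b1' \<and> m' + m1' = m + m1 + (d + c1) * a + b1 * c)"
        | "\<not> (c1 = c1' \<and> b + b1 = b' + b1' \<and> m1' = m1 + c1 * a + (b + b1) * c)"
        by blast
      then have "tens (mul D (F a (m + m1) (d + c1) b1 n c) (F a' (m' + m1') (d' + c1') b1' n' c'))
        (mul D (F a m1 c1 (b + b1) (n + c * b1) c) (F a' m1' c1' (b' + b1') (n' + c' * b1') c')) = 0"
      proof cases
        case 1
        show ?thesis unfolding F_mul if_not_P[OF 1] by (rule tens_linear)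
      next
        case 2
        show ?thesis unfolding F_mul if_not_P[OF 2] by (rule tens_linear)
      qed
      then show ?thesis using False by auto
    qed
  qed
  also have "\<dots> = (\<Sum>m1\<in>UNIV. \<Sum>c1\<in>UNIV. \<Sum>b1\<in>UNIV. if ?C then ?Y m1 c1 b1 else 0)"
    by simp
  also have "\<dots> = comult D (mul D (F a m d b n c) (F a' m' d' b' n' c'))"
  proof (cases ?C)
    case True
    show ?thesis
      unfolding F_mul if_P[OF True] lnr_smul[OF lnr_comult'] F_comult pm.scale_sum_right smul_smul ..
  next
    case False
    then show ?thesis unfolding F_mul by (simp only: if_False lnr_0[OF lnr_comult'] sum.neutral_const)
  qed
  finally show ?thesis ..
qed

lemma D_comult_mul: "v1 \<in> space D \<Longrightarrow> v2 \<in> space D \<Longrightarrow>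
  comult D (mul D v1 v2) = mul (tensor_alg D D) (comult D v1) (comult D v2)"
proof (rule F_ext[of "\<lambda>v1. comult D (mul D v1 v2)" "\<lambda>v1. mul (tensor_alg D D) (comult D v1) (comult D v2)"])
  assume v2: "v2 \<in> space D"
  fix a m d b n c
  show "comult D (mul D (F a m d b n c) v2) = mul (tensor_alg D D) (comult D (F a m d b n c)) (comult D v2)"
  proof (rule F_ext[OF _ _ _ v2])
    fix a' m' d' b' n' c'
    show "comult D (mul D (F a m d b n c) (F a' m' d' b' n' c'))
      = mul (tensor_alg D D) (comult D (F a m d b n c)) (comult D (F a' m' d' b' n' c'))"
      by (rule D_comult_mul_F)
  qed (intro lnr_intros)+
qed (intro lnr_intros)+

lemma D_comult_unt: "comult D (unt D) = tens (unt D) (unt D)"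
proof -
  have "comult D (unt D) = (\<Sum>m\<in>UNIV. \<Sum>d\<in>UNIV. \<Sum>b\<in>UNIV. \<Sum>m1\<in>UNIV. \<Sum>c1\<in>UNIV. \<Sum>b1\<in>UNIV.
      tens (F 0 (m + m1) (d + c1) b1 0 0) (F 0 m1 c1 (b + b1) 0 0))"
    by (simp add: F_unt F_comult lnr_sum[OF lnr_comult'])
  also have "\<dots> = tens (unt D) (unt D)"
    by (simp add: F_unt sum_bit tens_linear add_ac)
  finally show ?thesis .
qed

lemma D_counit_mul: "v1 \<in> space D \<Longrightarrow> v2 \<in> space D \<Longrightarrow> counit D (mul D v1 v2) = counit D v1 * counit D v2"
proof (rule F_fn_ext[of "\<lambda>v1. counit D (mul D v1 v2)" "\<lambda>v1. counit D v1 * counit D v2"])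
  assume v2: "v2 \<in> space D"
  fix a m d b n c
  show "counit D (mul D (F a m d b n c) v2) = counit D (F a m d b n c) * counit D v2"
  proof (rule F_fn_ext[OF _ _ _ v2])
    fix a' m' d' b' n' c'
    show "counit D (mul D (F a m d b n c) (F a' m' d' b' n' c')) = counit D (F a m d b n c) * counit D (F a' m' d' b' n' c')"
      by (auto simp: F_mul F_counit lfn_smul[OF lfn_comp(4)] lfn_0[OF lfn_comp(4)])
  qed (intro lnr_intros)+
qed (intro lnr_intros)+

lemma D_counit_unt: "counit D (unt D) = 1"
  by (simp add: F_unt F_counit lfn_add[OF lfn_comp(4)] sum_bit)

lemma D_antipode_closed: "v \<in> space D \<Longrightarrow> antipode D v \<in> space D"
  by (rule F_closed_ext[OF lnr_antipode' vsp_subspace]) (auto simp: F_antipode simp del: dd.D_basis)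

text \<open>A translation of \<open>m\<close> that depends only on \<open>d\<close> and
  \<open>b\<close> permutes the summands of \<open>unt D\<close>; the left antipode law produces the
  unit in such a translated form.\<close>

lemma unt_shift: "(\<Sum>m\<in>UNIV. \<Sum>d\<in>UNIV. \<Sum>b\<in>UNIV. F 0 (m + g d b) d b 0 0) = unt D"
proof -
  have "(\<Sum>m\<in>UNIV. \<Sum>d\<in>UNIV. \<Sum>b\<in>UNIV. F 0 (m + g d b) d b 0 0)
      = (\<Sum>d\<in>UNIV. \<Sum>m\<in>UNIV. \<Sum>b\<in>UNIV. F 0 (m + g d b) d b 0 0)"
    by (rule sum.swap)
  also have "\<dots> = (\<Sum>d\<in>UNIV. \<Sum>b\<in>UNIV. \<Sum>m\<in>UNIV. F 0 (m + g d b) d b 0 0)"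
    by (rule sum.cong[OF refl], rule sum.swap)
  also have "\<dots> = (\<Sum>d\<in>UNIV. \<Sum>b\<in>UNIV. \<Sum>m\<in>UNIV. F 0 m d b 0 0)"
    by (intro sum.cong refl sum_bit_shift)
  also have "\<dots> = unt D" by (simp add: F_unt sum_bit add_ac)
  finally show ?thesis .
qed

lemma D_antipode_left: "v \<in> space D \<Longrightarrow> lin (\<lambda>(i, j). mul D (antipode D (bv i)) (bv j)) (comult D v) = smul (counit D v) (unt D)"
proof (rule F_ext[of "\<lambda>v. lin (\<lambda>(i, j). mul D (antipode D (bv i)) (bv j)) (comult D v)" "\<lambda>v. smul (counit D v) (unt D)"])
  fix a m d b n c
  have "lin (\<lambda>(i, j). mul D (antipode D (bv i)) (bv j)) (comult D (F a m d b n c)) =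
    (\<Sum>m1\<in>UNIV. \<Sum>c1\<in>UNIV. \<Sum>b1\<in>UNIV. if m = 0 \<and> d = 0 \<and> b = 0 then F 0 (m1 + (a * c1 + b1 * c)) c1 b1 0 0 else 0)"
    unfolding F_comult lnr_sum[OF lnr_lin] lnr_smul[OF lnr_lin] antipode_left_tens F_antipode mul_linear F_mul
    by (intro sum.cong refl) (auto simp: phase_simps bit_solve)
  also have "\<dots> = smul (counit D (F a m d b n c)) (unt D)"
    using unt_shift[of "\<lambda>c1 b1. a * c1 + b1 * c"] by (simp add: F_counit)
  finally show "lin (\<lambda>(i, j). mul D (antipode D (bv i)) (bv j)) (comult D (F a m d b n c)) = smul (counit D (F a m d b n c)) (unt D)" .
qed (intro lnr_intros)+

lemma D_antipode_right: "v \<in> space D \<Longrightarrow> lin (\<lambda>(i, j). mul D (bv i) (antipode D (bv j))) (comult D v) = smul (counit D v) (unt D)"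
proof (rule F_ext[of "\<lambda>v. lin (\<lambda>(i, j). mul D (bv i) (antipode D (bv j))) (comult D v)" "\<lambda>v. smul (counit D v) (unt D)"])
  fix a m d b n c
  have "lin (\<lambda>(i, j). mul D (bv i) (antipode D (bv j))) (comult D (F a m d b n c)) =
    (\<Sum>m1\<in>UNIV. \<Sum>c1\<in>UNIV. \<Sum>b1\<in>UNIV. if m = 0 \<and> d = 0 \<and> b = 0 then F 0 m1 c1 b1 0 0 else 0)"
    unfolding F_comult lnr_sum[OF lnr_lin] lnr_smul[OF lnr_lin] antipode_right_tens F_antipode mul_linear F_mul
    by (intro sum.cong refl) (auto simp: phase_simps bit_solve)
  also have "\<dots> = smul (counit D (F a m d b n c)) (unt D)"
    by (simp add: F_counit F_unt)
  finally show "lin (\<lambda>(i, j). mul D (bv i) (antipode D (bv j))) (comult D (F a m d b n c)) = smul (counit D (F a m d b n c)) (unt D)" .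
qed (intro lnr_intros)+

lemma D_hopf: "is_fd_hopf_algebra D"
  unfolding is_fd_hopf_algebra_def is_hopf_algebra_def
proof (intro conjI ballI)
  show "is_algebra D" by (rule rep.is_algebra)
  show "is_coalgebra D" by (rule corep.is_coalgebra)
  show "finite (basis D)" using fin by simp
  fix i assume "i \<in> basis D"
  then show "bantipode D i \<in> space D" using D_antipode_closed[of "bv i"] by simp
qed (rule D_comult_mul D_comult_unt D_counit_mul D_counit_unt D_antipode_left D_antipode_right; assumption)+

lemma D_algebra_type: "of_algebra_type D [(1, 8), (2, 14)]"
  unfolding of_algebra_type_def
proof (intro conjI allI impI ballI)
  fix dn :: "nat \<times> nat" assume "dn \<in> set [(1, 8), (2, 14)]"
  then show "case dn of (d, n) \<Rightarrow> finite (irrep_classes D d) \<and> card (irrep_classes D d) = n"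
    using rep.card_irrep_classes[of 1] rep.card_irrep_classes[of 2] card_reps by auto
next
  fix d \<alpha> assume "irreducible_rep D d \<alpha>"
  then obtain l where "d = card (rep_rows l)" using rep.irrep_dim by blast
  then show "d \<in> fst ` set [(1, 8), (2, 14)]" by (cases l) (simp_all add: rep_rows_def)
qed (rule D_hopf rep.semisimple)+

lemma D_coalgebra_type: "of_coalgebra_type D [(1, 16), (2, 8), (4, 1)]"
  unfolding of_coalgebra_type_def
proof (intro conjI allI impI ballI)
  fix dn :: "nat \<times> nat" assume "dn \<in> set [(1, 16), (2, 8), (4, 1)]"
  then show "case dn of (d, n) \<Rightarrow> finite (irred_corep_classes D d) \<and> card (irred_corep_classes D d) = n"
    using corep.card_corep_classes[of 1] corep.card_corep_classes[of 2] corep.card_corep_classes[of 4] card_coreps by auto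
next
  fix d \<delta> assume "irreducible_corep D d \<delta>"
  then obtain l where "d = card (corep_rows l)" using corep.corep_dim by blast
  then show "d \<in> fst ` set [(1, 16), (2, 8), (4, 1)]" by (simp add: card_corep_rows split: if_splits)
qed (rule D_hopf rep.semisimple)+

end

section \<open>Group algebras and function algebras\<close>

lemma lookup_reassoc: "Poly_Mapping.lookup (reassoc v) (i, j, l) = Poly_Mapping.lookup v ((i, j), l)"
  for v :: "('a \<times> 'b) \<times> 'c \<Rightarrow>\<^sub>0 'k::field"
proof -
  have "pairing (bv (i, j, l)) (reassoc v) = pairing (bv ((i, j), l)) v"
  proof (rule lfn_ext)
    fix t :: "('a \<times> 'b) \<times> 'c"
    show "pairing (bv (i, j, l)) (reassoc (bv t)) = pairing (bv ((i, j), l)) (bv t)"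
      by (cases t) (auto simp: reassoc_def lookup_single when_def split: if_splits)
  qed (intro lnr_intros)+
  then show ?thesis by simp
qed

lemma lnr_restrict_ext: "lfn g \<Longrightarrow> lfn h \<Longrightarrow> v \<in> vsp I \<Longrightarrow> (\<And>i. i \<in> I \<Longrightarrow> g (bv i) = h (bv i)) \<Longrightarrow> g v = h v"
  using lfn_eq_lfun[of g v] lfn_eq_lfun[of h v] by (auto simp: lfun_def vsp_def intro!: sum.cong)

lemma lfn_lookup [lnr_intros]: "lnr f \<Longrightarrow> lfn (\<lambda>v. Poly_Mapping.lookup (f v) i)" "lfn (\<lambda>v. Poly_Mapping.lookup v i)"
  "lfn (\<lambda>v. 0)"
  by (simp_all add: lnr_def lfn_def lookup_add)

lemma lfn_if [lnr_intros]: "lfn g \<Longrightarrow> lfn (\<lambda>v. if Q then g v else 0)"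
  by (simp add: lfn_def)

lemma mul_tensor_bv: "mul (tensor_alg A B) (bv (i, j)) (bv (i', j')) = tens (bmult A i i') (bmult B j j')"
  by (simp add: tensor_alg_def)

lemma tmap_bv: "tmap g h (bv (i, j)) = tens (g (bv i)) (h (bv j))"
  by (simp add: tmap_def)

lemma lnr_reassoc' [simp]: "lnr reassoc" and lnr_tmap' [simp]: "lnr (tmap g h)"
  unfolding reassoc_def tmap_def by (rule lnr_lin)+

context group
begin

abbreviation (input) "kG \<equiv> group_algebra G"
abbreviation (input) "fG \<equiv> function_algebra G"

lemma kG_simps [simp]:
  "basis kG = carrier G" "mul kG (bv g) (bv h) = bv (g \<otimes> h)" "unt kG = bv \<one>"
  "comult kG (bv g) = bv (g, g)" "counit kG (bv g) = 1" "antipode kG (bv g) = bv (inv g)"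
  "bmult kG g h = bv (g \<otimes> h)" "bcomult kG g = bv (g, g)" "bcounit kG g = 1" "bantipode kG g = bv (inv g)"
  by (simp_all add: group_algebra_def)

lemma kG_hopf:
  assumes fin: "finite (carrier G)"
  shows "is_fd_hopf_algebra kG"
proof -
  have assoc: "mul kG (mul kG a b) c = mul kG a (mul kG b c)" if a: "a \<in> space kG" and b: "b \<in> space kG" and c: "c \<in> space kG" for a b c
  proof (rule lnr_ext[OF _ _ a])
    fix g assume g: "g \<in> basis kG"
    show "mul kG (mul kG (bv g) b) c = mul kG (bv g) (mul kG b c)"
    proof (rule lnr_ext[OF _ _ b])
      fix h assume h: "h \<in> basis kG"
      show "mul kG (mul kG (bv g) (bv h)) c = mul kG (bv g) (mul kG (bv h) c)"
        by (rule lnr_ext[OF _ _ c]) (use g h in \<open>auto intro!: lnr_intros simp: m_assoc simp del: mul_bv\<close>)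
    qed (intro lnr_intros)+
  qed (intro lnr_intros)+
  have cm: "comult kG (mul kG a b) = mul (tensor_alg kG kG) (comult kG a) (comult kG b)" for a b
  proof (rule lnr_ext[of _ _ a UNIV])
    fix g
    show "comult kG (mul kG (bv g) b) = mul (tensor_alg kG kG) (comult kG (bv g)) (comult kG b)"
    proof (rule lnr_ext[of _ _ b UNIV])
      fix h
      show "comult kG (mul kG (bv g) (bv h)) = mul (tensor_alg kG kG) (comult kG (bv g)) (comult kG (bv h))"
        unfolding kG_simps mul_tensor_bv by simp
    qed (auto intro!: lnr_intros)
  qed (auto intro!: lnr_intros)
  have em: "counit kG (mul kG a b) = counit kG a * counit kG b" for a b
    by (rule lfn_bilinear_eq[of "\<lambda>a b. counit kG (mul kG a b)" "\<lambda>a b. counit kG a * counit kG b"])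
      (auto intro!: lnr_intros)
  show ?thesis
    unfolding is_fd_hopf_algebra_def is_hopf_algebra_def is_algebra_def is_coalgebra_def
  proof (intro conjI ballI)
    fix a assume a: "a \<in> space kG"
    show "mul kG (unt kG) a = a" "mul kG a (unt kG) = a"
      by (rule lnr_ext[OF _ _ a]; auto intro!: lnr_intros simp del: mul_bv)+
    show "reassoc (tmap (comult kG) id (comult kG a)) = tmap id (comult kG) (comult kG a)"
      by (rule lnr_ext[OF _ _ a]; auto intro!: lnr_intros simp: tmap_def reassoc_def)
    show "lin (\<lambda>(i, j). smul (bcounit kG i) (bv j)) (comult kG a) = a"
      "lin (\<lambda>(i, j). smul (bcounit kG j) (bv i)) (comult kG a) = a"
      by (rule lnr_ext[OF _ _ a]; auto intro!: lnr_intros)+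
    show "lin (\<lambda>(i, j). mul kG (antipode kG (bv i)) (bv j)) (comult kG a) = smul (counit kG a) (unt kG)"
      "lin (\<lambda>(i, j). mul kG (bv i) (antipode kG (bv j))) (comult kG a) = smul (counit kG a) (unt kG)"
      by (rule lnr_ext[OF _ _ a]; auto intro!: lnr_intros simp del: smul_single)+
  qed (auto simp: fin assoc cm em)
qed

lemma kG_cocommutative: "cocommutative kG"
  unfolding cocommutative_def
proof
  fix a assume a: "a \<in> space kG"
  show "flip (comult kG a) = comult kG a"
    by (rule lnr_ext[OF _ _ a]; auto intro!: lnr_intros simp: flip_def)
qed

section \<open>The function algebra of a finite group\<close>

context
  assumes fin: "finite (carrier G)"
begin

lemma fG_basis [simp]: "basis fG = carrier G"
  by (simp add: function_algebra_def)

lemma fG_mul: "g \<in> carrier G \<Longrightarrow> h \<in> carrier G \<Longrightarrow> mul fG (bv g) (bv h) = (if g = h then bv g else 0)"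
  by (rule poly_mapping_eqI)
    (auto simp: function_algebra_def dual_def lookup_sum_single[OF fin] lookup_single when_def)

lemma fG_unt: "unt fG = (\<Sum>g\<in>carrier G. bv g)"
  by (simp add: function_algebra_def dual_def)

lemma fG_counit: "counit fG (bv g) = (if g = \<one> then 1 else 0)"
  by (simp add: function_algebra_def dual_def lookup_single when_def)

lemma fG_comult: "g \<in> carrier G \<Longrightarrow> comult fG (bv g) = (\<Sum>h\<in>carrier G. bv (h, inv h \<otimes> g))"
proof (rule poly_mapping_eqI)
  fix ij :: "'a \<times> 'a" assume g: "g \<in> carrier G"
  obtain i j where ij: "ij = (i, j)" by (cases ij)
  have "Poly_Mapping.lookup (comult fG (bv g)) (i, j) = (if i \<in> carrier G \<and> j \<in> carrier G \<and> i \<otimes> j = g then 1 else 0)"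
    using fin by (auto simp: function_algebra_def dual_def lookup_sum_single split_def lookup_single when_def)
  also have "\<dots> = (if i \<in> carrier G \<and> j = inv i \<otimes> g then 1 else 0)"
    using g inv_solve_left[of j i g] by auto
  also have "\<dots> = (\<Sum>h\<in>carrier G. if h = i then (if j = inv i \<otimes> g then 1 else 0) else 0)"
    using fin by simp
  also have "\<dots> = Poly_Mapping.lookup (\<Sum>h\<in>carrier G. bv (h, inv h \<otimes> g)) (i, j)"
    unfolding lookup_sum by (intro sum.cong) (auto simp: lookup_single when_def)
  finally show "Poly_Mapping.lookup (comult fG (bv g)) ij = Poly_Mapping.lookup (\<Sum>h\<in>carrier G. bv (h, inv h \<otimes> g)) ij"
    by (simp add: ij)
qed

lemma fG_antipode: "g \<in> carrier G \<Longrightarrow> antipode fG (bv g) = bv (inv g)"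
proof (rule poly_mapping_eqI)
  fix h assume g: "g \<in> carrier G"
  have "Poly_Mapping.lookup (antipode fG (bv g)) h = (if h \<in> carrier G \<and> inv h = g then 1 else 0)"
    by (simp add: function_algebra_def dual_def lookup_sum_single[OF fin] lookup_single when_def)
  also have "h \<in> carrier G \<and> inv h = g \<longleftrightarrow> inv g = h"
    by (metis g inv_closed inv_inv)
  finally show "Poly_Mapping.lookup (antipode fG (bv g)) h = Poly_Mapping.lookup (bv (inv g)) h"
    by (simp add: lookup_single when_def)
qed

text \<open>Elements of the function algebra are determined by their values, so the Hopf algebra
  axioms are verified pointwise with this rule and \<open>fG_lookup_comult\<close>.\<close>

lemma fG_lookup_mul: "p \<in> space fG \<Longrightarrow> q \<in> space fG \<Longrightarrow>
  Poly_Mapping.lookup (mul fG p q) g = Poly_Mapping.lookup p g * Poly_Mapping.lookup q g"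
proof (rule lnr_restrict_ext[of "\<lambda>p. Poly_Mapping.lookup (mul fG p q) g" "\<lambda>p. Poly_Mapping.lookup p g * Poly_Mapping.lookup q g" p "basis fG"])
  fix i assume q: "q \<in> space fG" and i: "i \<in> basis fG"
  show "Poly_Mapping.lookup (mul fG (bv i) q) g = Poly_Mapping.lookup (bv i) g * Poly_Mapping.lookup q g"
    by (rule lnr_restrict_ext[OF _ _ q])
      (use i in \<open>auto intro!: lnr_intros simp: fG_mul lookup_single when_def simp del: mul_bv\<close>)
qed (auto intro!: lnr_intros)

lemma fG_mul_closed: "mul fG p q \<in> space fG"
  unfolding function_algebra_def using mul_dual_closed[of kG p q] fin by simp

lemma fG_lookup_comult: "p \<in> space fG \<Longrightarrow> Poly_Mapping.lookup (comult fG p) (g, h)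
    = (if g \<in> carrier G \<and> h \<in> carrier G then Poly_Mapping.lookup p (g \<otimes> h) else 0)"
proof (rule lnr_restrict_ext[of "\<lambda>p. Poly_Mapping.lookup (comult fG p) (g, h)" _ p "basis fG"])
  fix i assume "i \<in> basis fG"
  then show "Poly_Mapping.lookup (comult fG (bv i)) (g, h)
      = (if g \<in> carrier G \<and> h \<in> carrier G then Poly_Mapping.lookup (bv i) (g \<otimes> h) else 0)"
    using fin by (auto simp: function_algebra_def dual_def lookup_sum_single split_def lookup_single when_def)
next
  show "lfn (\<lambda>p. if g \<in> carrier G \<and> h \<in> carrier G then Poly_Mapping.lookup p (g \<otimes> h) else 0)"
    by (cases "g \<in> carrier G \<and> h \<in> carrier G") (auto simp: lfn_def lookup_add)
qed (auto intro!: lnr_intros)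

lemma fG_comult_closed: "p \<in> space fG \<Longrightarrow> comult fG p \<in> vsp (carrier G \<times> carrier G)"
  unfolding function_algebra_def using comult_dual_closed[of p kG] by simp

lemma fG_counit_lookup: "counit fG p = Poly_Mapping.lookup p \<one>"
  by (rule lfn_ext) (auto intro!: lnr_intros simp: fG_counit lookup_single when_def simp del: counit_bv)

lemma fG_closed: "unt fG \<in> space fG" "bmult fG i j \<in> space fG"
  using fG_mul_closed[of "bv i" "bv j"] by (auto simp: fG_unt)

lemma fG_hopf: "is_fd_hopf_algebra fG"
proof -
  have unt: "Poly_Mapping.lookup (unt fG) g = (if g \<in> carrier G then 1 else 0)" for g
    by (simp add: fG_unt lookup_sum_single[OF fin])
  have uc: "unt fG \<in> space fG" by (auto simp: fG_unt)
  have assoc: "mul fG (mul fG a b) c = mul fG a (mul fG b c)" if "a \<in> space fG" "b \<in> space fG" "c \<in> space fG" for a b c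
    by (rule poly_mapping_eqI) (use that in \<open>simp add: fG_lookup_mul fG_mul_closed del: fG_basis\<close>)
  have tm: "Poly_Mapping.lookup (mul (tensor_alg fG fG) v v') (g, h) = Poly_Mapping.lookup v (g, h) * Poly_Mapping.lookup v' (g, h)"
    if v: "v \<in> vsp (carrier G \<times> carrier G)" and v': "v' \<in> vsp (carrier G \<times> carrier G)" for v v' g h
  proof (rule lnr_restrict_ext[OF _ _ v])
    fix ij assume "ij \<in> carrier G \<times> carrier G"
    then obtain i j where ij: "ij = (i, j)" "i \<in> carrier G" "j \<in> carrier G" by auto
    show "Poly_Mapping.lookup (mul (tensor_alg fG fG) (bv ij) v') (g, h) = Poly_Mapping.lookup (bv ij) (g, h) * Poly_Mapping.lookup v' (g, h)"
    proof (rule lnr_restrict_ext[OF _ _ v'])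
      fix ij' assume "ij' \<in> carrier G \<times> carrier G"
      then obtain i' j' where ij': "ij' = (i', j')" "i' \<in> carrier G" "j' \<in> carrier G" by auto
      show "Poly_Mapping.lookup (mul (tensor_alg fG fG) (bv ij) (bv ij')) (g, h) = Poly_Mapping.lookup (bv ij) (g, h) * Poly_Mapping.lookup (bv ij') (g, h)"
        unfolding ij(1) ij'(1) mul_tensor_bv using ij ij'
        by (auto simp: fG_mul[simplified] lookup_single when_def tens_linear)
    qed (auto intro!: lnr_intros)
  qed (auto intro!: lnr_intros)
  have bc: "bmult fG i j \<in> space fG" for i j using fG_mul_closed[of "bv i" "bv j"] by simp
  have tmc: "mul (tensor_alg fG fG) v v' \<in> vsp (carrier G \<times> carrier G)" for v v' :: "'a \<times> 'a \<Rightarrow>\<^sub>0 'k::field"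
    unfolding mul_def lin_def tensor_alg_def using bc by (auto intro!: vsp_sum vsp_intros tens_closed split: prod.split)
  have cm: "comult fG (mul fG a b) = mul (tensor_alg fG fG) (comult fG a) (comult fG b)" if a: "a \<in> space fG" and b: "b \<in> space fG" for a b
  proof (rule tens_eqI)
    fix i j
    show "Poly_Mapping.lookup (comult fG (mul fG a b)) (i, j) = Poly_Mapping.lookup (mul (tensor_alg fG fG) (comult fG a) (comult fG b)) (i, j)"
      using tm[OF fG_comult_closed[OF a] fG_comult_closed[OF b]] a b
      by (simp add: fG_lookup_comult fG_mul_closed fG_lookup_mul del: fG_basis)
  qed
  have t1: "Poly_Mapping.lookup (tmap (comult fG) id v) ((g, h), l) = (if g \<in> carrier G \<and> h \<in> carrier G then Poly_Mapping.lookup v (g \<otimes> h, l) else 0)"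
    if v: "v \<in> vsp (carrier G \<times> carrier G)" for v g h l
  proof (rule lnr_restrict_ext[OF _ _ v])
    fix ij assume "ij \<in> carrier G \<times> carrier G"
    then obtain i j where ij: "ij = (i, j)" "i \<in> carrier G" "j \<in> carrier G" by auto
    show "Poly_Mapping.lookup (tmap (comult fG) id (bv ij)) ((g, h), l) = (if g \<in> carrier G \<and> h \<in> carrier G then Poly_Mapping.lookup (bv ij) (g \<otimes> h, l) else 0)"
      unfolding ij(1) tmap_bv using ij(2,3) by (auto simp: fG_lookup_comult lookup_single when_def simp del: comult_bv)
  qed (intro lnr_intros)+
  have t2: "Poly_Mapping.lookup (tmap id (comult fG) v) (l, g, h) = (if g \<in> carrier G \<and> h \<in> carrier G then Poly_Mapping.lookup v (l, g \<otimes> h) else 0)"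
    if v: "v \<in> vsp (carrier G \<times> carrier G)" for v g h l
  proof (rule lnr_restrict_ext[OF _ _ v])
    fix ij assume "ij \<in> carrier G \<times> carrier G"
    then obtain i j where ij: "ij = (i, j)" "i \<in> carrier G" "j \<in> carrier G" by auto
    show "Poly_Mapping.lookup (tmap id (comult fG) (bv ij)) (l, g, h) = (if g \<in> carrier G \<and> h \<in> carrier G then Poly_Mapping.lookup (bv ij) (l, g \<otimes> h) else 0)"
      unfolding ij(1) tmap_bv using ij(2,3) by (auto simp: fG_lookup_comult lookup_single when_def simp del: comult_bv)
  qed (intro lnr_intros)+
  show ?thesis
    unfolding is_fd_hopf_algebra_def is_hopf_algebra_def is_algebra_def is_coalgebra_def
  proof (intro conjI ballI)
    fix a assume a: "a \<in> space fG"
    have ac: "comult fG a \<in> vsp (carrier G \<times> carrier G)" by (rule fG_comult_closed[OF a])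
    show "mul fG (unt fG) a = a" "mul fG a (unt fG) = a"
      by (rule poly_mapping_eqI; use a lookup_vsp[OF a] in \<open>simp add: fG_lookup_mul uc unt del: fG_basis\<close>; simp)+
    show "reassoc (tmap (comult fG) id (comult fG a)) = tmap id (comult fG) (comult fG a)"
    proof (rule poly_mapping_eqI)
      fix t :: "'a \<times> 'a \<times> 'a"
      obtain i j l where t: "t = (i, j, l)" by (cases t)
      show "Poly_Mapping.lookup (reassoc (tmap (comult fG) id (comult fG a))) t = Poly_Mapping.lookup (tmap id (comult fG) (comult fG a)) t"
        unfolding t lookup_reassoc t1[OF ac] t2[OF ac] fG_lookup_comult[OF a] by (auto simp: m_assoc)
    qed
    have l1: "Poly_Mapping.lookup (lin (\<lambda>(i, j). smul (bcounit fG i) (bv j)) v) g = Poly_Mapping.lookup v (\<one>, g)" for v g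
      by (rule lfn_ext) (auto intro!: lnr_intros simp: lookup_single when_def fG_counit[simplified] split: if_splits)
    have l2: "Poly_Mapping.lookup (lin (\<lambda>(i, j). smul (bcounit fG j) (bv i)) v) g = Poly_Mapping.lookup v (g, \<one>)" for v g
      by (rule lfn_ext) (auto intro!: lnr_intros simp: lookup_single when_def fG_counit[simplified] split: if_splits)
    show "lin (\<lambda>(i, j). smul (bcounit fG i) (bv j)) (comult fG a) = a"
      by (rule poly_mapping_eqI) (use lookup_vsp[OF a] in \<open>auto simp: l1 fG_lookup_comult[OF a] simp del: smul_single\<close>)
    show "lin (\<lambda>(i, j). smul (bcounit fG j) (bv i)) (comult fG a) = a"
      by (rule poly_mapping_eqI) (use lookup_vsp[OF a] in \<open>auto simp: l2 fG_lookup_comult[OF a] simp del: smul_single\<close>)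
    have sw: "inv i = j \<longleftrightarrow> i = inv j" if "i \<in> carrier G" "j \<in> carrier G" for i j
      by (metis inv_inv that)
    have s1: "Poly_Mapping.lookup (lin (\<lambda>(i, j). mul fG (antipode fG (bv i)) (bv j)) v) g = (if g \<in> carrier G then Poly_Mapping.lookup v (inv g, g) else 0)"
      if v: "v \<in> vsp (carrier G \<times> carrier G)" for v g
    proof (rule lnr_restrict_ext[OF _ _ v])
      fix ij assume "ij \<in> carrier G \<times> carrier G"
      then obtain i j where ij: "ij = (i, j)" "i \<in> carrier G" "j \<in> carrier G" by auto
      show "Poly_Mapping.lookup (lin (\<lambda>(i, j). mul fG (antipode fG (bv i)) (bv j)) (bv ij)) g = (if g \<in> carrier G then Poly_Mapping.lookup (bv ij) (inv g, g) else 0)"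
        using ij(2,3) unfolding ij(1) lin_bv prod.case fG_antipode[OF ij(2)] fG_mul[OF inv_closed[OF ij(2)] ij(3)] sw[OF ij(2,3)]
        by (auto simp: lookup_single when_def)
    qed (intro lnr_intros)+
    have s2: "Poly_Mapping.lookup (lin (\<lambda>(i, j). mul fG (bv i) (antipode fG (bv j))) v) g = (if g \<in> carrier G then Poly_Mapping.lookup v (g, inv g) else 0)"
      if v: "v \<in> vsp (carrier G \<times> carrier G)" for v g
    proof (rule lnr_restrict_ext[OF _ _ v])
      fix ij assume "ij \<in> carrier G \<times> carrier G"
      then obtain i j where ij: "ij = (i, j)" "i \<in> carrier G" "j \<in> carrier G" by auto
      show "Poly_Mapping.lookup (lin (\<lambda>(i, j). mul fG (bv i) (antipode fG (bv j))) (bv ij)) g = (if g \<in> carrier G then Poly_Mapping.lookup (bv ij) (g, inv g) else 0)"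
        using ij(2,3) unfolding ij(1) lin_bv prod.case fG_antipode[OF ij(3)] fG_mul[OF ij(2) inv_closed[OF ij(3)]]
        by (auto simp: lookup_single when_def)
    qed (intro lnr_intros)+
    show "lin (\<lambda>(i, j). mul fG (antipode fG (bv i)) (bv j)) (comult fG a) = smul (counit fG a) (unt fG)"
      by (rule poly_mapping_eqI) (auto simp: s1[OF ac] fG_lookup_comult[OF a] unt fG_counit_lookup simp del: antipode_bv mul_bv)
    show "lin (\<lambda>(i, j). mul fG (bv i) (antipode fG (bv j))) (comult fG a) = smul (counit fG a) (unt fG)"
      by (rule poly_mapping_eqI) (auto simp: s2[OF ac] fG_lookup_comult[OF a] unt fG_counit_lookup simp del: antipode_bv mul_bv)
  next
    show "comult fG (unt fG) = tens (unt fG) (unt fG)"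
      by (rule tens_eqI) (simp add: fG_lookup_comult[OF uc] unt)
    fix i assume i: "i \<in> basis fG"
    show "bcomult fG i \<in> vsp (basis fG \<times> basis fG)" using fG_comult_closed[of "bv i"] i by simp
    show "bantipode fG i \<in> space fG" using i by (simp add: fG_antipode[simplified])
  qed (auto simp: fin assoc cm uc fG_closed[simplified] fG_counit_lookup fG_lookup_mul unt)
qed

lemma fG_commutative: "commutative_alg fG"
  unfolding commutative_alg_def
  by (intro ballI poly_mapping_eqI) (simp add: fG_lookup_mul mult.commute)

end

end

section \<open>The central extension\<close>

context h8
begin

lemma finD: "finite (basis D)"
  using fin by simp

section \<open>The group of characters of the double\<close>

abbreviation "Ch \<equiv> group_likes (dual D)"

definition chi :: "bit \<times> bit \<times> bit \<Rightarrow> ('i \<times> 'i \<Rightarrow>\<^sub>0 'k)"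
  where "chi l = fE (Inl l, 0, 0)"

lemma chi_closed: "chi l \<in> space D"
  by (simp add: chi_def fE_closed del: dd.D_basis)

lemma chi_F [simp]: "pairing (chi (l1, l2, l3)) (F a m d b n c) = (if d = 0 \<and> b = 0 \<and> m = l1 then sg (n * m + l2 * a + l3 * c) else 0)"
  by (simp add: chi_def)

lemma Inl_mix: "(Inl l, 0, 0) \<in> mix reps rep_rows"
  by (simp add: reps_def rep_rows_def)

lemma inj_chi: "inj chi"
proof (rule injI)
  fix l l' assume "chi l = chi l'"
  then show "l = l'"
    using inj_onD[OF dframe_independent(2)[OF dframe_sym[OF E_frame]], of "(Inl l, 0, 0)" "(Inl l', 0, 0)"] Inl_mix
    by (simp add: chi_def)
qed

lemma chi_eq [simp]: "chi l = chi l' \<longleftrightarrow> l = l'"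
  using inj_chi by (simp add: inj_eq)

lemma chi_mul: "mul (dual D) (chi l) (chi l') = chi (l + l')"
proof (rule D_ext)
  fix a m d b n c
  obtain l1 l2 l3 where l: "l = (l1, l2, l3)" by (metis prod.exhaust)
  obtain l1' l2' l3' where l': "l' = (l1', l2', l3')" by (metis prod.exhaust)
  show "pairing (mul (dual D) (chi l) (chi l')) (F a m d b n c) = pairing (chi (l + l')) (F a m d b n c)"
    unfolding pairing_mul_dual[OF finD F_closed] F_comult pairing_linear pairing_tens l l'
    by (cases d; cases b; cases m; cases l1; cases l1'; simp add: sum_bit phase_simps)
qed (use mul_dual_closed[OF finD] chi_closed in auto)

lemma chi_unt: "unt (dual D) = chi 0"
proof (rule D_ext)
  fix a m d b n c
  show "pairing (unt (dual D)) (F a m d b n c) = pairing (chi 0) (F a m d b n c)"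
    by (simp add: pairing_unt_dual[OF finD F_closed] F_counit zero_prod_def)
qed (use unt_dual_closed[of D] chi_closed in auto)

text \<open>A group-like element of the dual is the same as an algebra map to the field, and the
  matrix coefficient of a one-dimensional representation is such a map.\<close>

lemma chi_grouplike: "chi l \<in> carrier Ch"
proof -
  have "comult (dual D) (chi l) = tens (chi l) (chi l)"
  proof (rule dframe_pairing_ext'[OF dframe_tens[OF F_frame F_frame]])
    fix t :: "((bit \<times> bit \<times> bit) \<times> bit \<times> bit \<times> bit) \<times> ((bit \<times> bit \<times> bit) \<times> bit \<times> bit \<times> bit)"
    have "pairing (comult (dual D) (chi l)) (tens v v') = pairing (chi l) v * pairing (chi l) v'"
      if "v \<in> space D" "v' \<in> space D" for v v'
      using pairing_comult_dual[OF finD that, of "chi l"] rep.f_mul[OF Inl_mix that, of l]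
      by (simp add: chi_def rep_rows_def)
    then show "pairing (comult (dual D) (chi l)) (case t of (t1, t2) \<Rightarrow> tens ((\<lambda>((a, m, d), (b, n, c)). F a m d b n c) t1) ((\<lambda>((a, m, d), (b, n, c)). F a m d b n c) t2))
      = pairing (tens (chi l) (chi l)) (case t of (t1, t2) \<Rightarrow> tens ((\<lambda>((a, m, d), (b, n, c)). F a m d b n c) t1) ((\<lambda>((a, m, d), (b, n, c)). F a m d b n c) t2))"
      by (auto simp del: dd.D_basis split: prod.split)
  qed (use comult_dual_closed[of "chi l" D] chi_closed in auto)
  moreover have "counit (dual D) (chi l) = 1"
    using rep.f_unt[OF Inl_mix, of l] by (simp add: counit_dual chi_def)
  ultimately show ?thesis using chi_closed by (simp add: group_likes_def del: dd.D_basis)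
qed

text \<open>A group-like \<open>g\<close> of the dual is multiplicative, so it kills the matrix units of the two-dimensional
  blocks and is a character on the remaining ones.\<close>

lemma grouplike_chi:
  assumes "g \<in> carrier Ch"
  shows "g \<in> range chi"
proof -
  have g: "g \<in> space D" "comult (dual D) g = tens g g" "counit (dual D) g = 1"
    using assms by (simp_all add: group_likes_def del: dd.D_basis)
  have mult: "pairing g (mul D v v') = pairing g v * pairing g v'" if "v \<in> space D" "v' \<in> space D" for v v'
    using pairing_comult_dual[OF finD that, of g] g(2) by simp
  define c where "c t = pairing g (E t)" for t
  have cc: "c (l, r, s) * c (l', r', s') = (if l = l' \<and> s = r' then c (l, r, s') else 0)"
    if "(l, r, s) \<in> mix reps rep_rows" "(l', r', s') \<in> mix reps rep_rows" for l r s l' r' s'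
    using mult[OF rep.E_closed[OF that(1)] rep.E_closed[OF that(2)]] rep.E_mul[OF that]
    by (auto simp: c_def pairing_linear split: if_splits)
  have Inr: "c (Inr ge, r, s) = 0" if ge: "Inr ge \<in> reps" for ge r s
  proof -
    have m: "(Inr ge, r, s) \<in> mix reps rep_rows" for r s using ge by (simp add: rep_rows_def)
    \<comment> \<open>An off-diagonal matrix unit has square zero.\<close>
    have "c (Inr ge, r, r + 1) * c (Inr ge, r, r + 1) = 0" for r
      using cc[OF m m, of r "r + 1" r "r + 1"] by (simp add: bit_solve)
    then have *: "c (Inr ge, r, r + 1) = 0" for r by simp
    \<comment> \<open>A diagonal matrix unit of a two-dimensional block is a product of two
      off-diagonal ones.\<close>
    have "c (Inr ge, r, r) = c (Inr ge, r, r + 1) * c (Inr ge, r + 1, r)" using cc[OF m m, of r "r + 1" "r + 1" r] by simp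
    then have "c (Inr ge, r, r) = 0" using * by simp
    then show ?thesis using *[of r] by (cases "s = r") (auto simp: bit_solve, metis add.commute bit_not_zero_iff bit_eq_iff_add bit_simps(4))
  qed
  have gE: "g = (\<Sum>t\<in>mix reps rep_rows. smul (c t) (fE t))"
    using dframeD(6)[OF dframe_sym[OF E_frame] g(1)] by (simp add: c_def pairing_commute[of g])
  have mixS: "finite (mix reps rep_rows)" using dframeD(2)[OF E_frame] .
  have sub: "(\<lambda>l. (Inl l, 0, 0)) ` UNIV \<subseteq> mix reps rep_rows" using Inl_mix by auto
  have zero: "c t = 0" if "t \<in> mix reps rep_rows - (\<lambda>l. (Inl l, 0, 0)) ` UNIV" for t
  proof -
    obtain l r s where t: "t = (l, r, s)" by (cases t)
    then show ?thesis using that Inr by (cases l) (auto simp: rep_rows_def)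
  qed
  have gS: "g = (\<Sum>l\<in>UNIV. smul (c (Inl l, 0, 0)) (chi l))"
  proof -
    have "g = (\<Sum>t\<in>(\<lambda>l. (Inl l, 0, 0)) ` UNIV. smul (c t) (fE t))"
      unfolding gE by (rule sum.mono_neutral_right[OF mixS sub]) (use zero in auto)
    also have "\<dots> = (\<Sum>l\<in>UNIV. smul (c (Inl l, 0, 0)) (chi l))"
      by (subst sum.reindex) (auto simp: inj_on_def chi_def)
    finally show ?thesis .
  qed
  have "g \<noteq> 0" using g(3) by (auto simp: counit_dual pairing_linear)
  then obtain l where l: "c (Inl l, 0, 0) \<noteq> 0"
    using gS by (metis (mono_tags, lifting) smul_0_left sum.neutral)
  \<comment> \<open>The remaining matrix units are orthogonal idempotents, so a multiplicative
    \<open>c\<close> that is nonzero at \<open>l\<close> is 1 there and vanishes at all other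
    labels.\<close>
  have "c (Inl l', 0, 0) = 0" if "l' \<noteq> l" for l' using cc[OF Inl_mix Inl_mix, of l' l] l that by simp
  moreover have "c (Inl l, 0, 0) = 1" using cc[OF Inl_mix Inl_mix, of l l] l by simp
  ultimately have "g = (\<Sum>l'\<in>UNIV. if l' = l then chi l else 0)"
    by (subst gS, intro sum.cong refl) auto
  then show ?thesis by simp
qed

lemma carrier_Ch: "carrier Ch = range chi"
  using chi_grouplike grouplike_chi by auto

lemma Ch_simps: "monoid.mult Ch = mul (dual D)" "monoid.one Ch = chi 0"
  by (simp_all add: group_likes_def chi_unt)

lemma add_self_triple: "l + l = 0" for l :: "bit \<times> bit \<times> bit"
  by (cases l) (simp add: zero_prod_def)

sublocale Ch: group Ch
proof (rule groupI)
  fix g h assume g: "g \<in> carrier Ch" and h: "h \<in> carrier Ch"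
  then show "g \<otimes>\<^bsub>Ch\<^esub> h \<in> carrier Ch" by (auto simp: carrier_Ch Ch_simps chi_mul)
  fix j assume "j \<in> carrier Ch"
  with g h show "g \<otimes>\<^bsub>Ch\<^esub> h \<otimes>\<^bsub>Ch\<^esub> j = g \<otimes>\<^bsub>Ch\<^esub> (h \<otimes>\<^bsub>Ch\<^esub> j)"
    by (auto simp: carrier_Ch Ch_simps chi_mul add_ac)
next
  fix g assume g: "g \<in> carrier Ch"
  then show "\<one>\<^bsub>Ch\<^esub> \<otimes>\<^bsub>Ch\<^esub> g = g" by (auto simp: carrier_Ch Ch_simps chi_mul)
  from g show "\<exists>h\<in>carrier Ch. h \<otimes>\<^bsub>Ch\<^esub> g = \<one>\<^bsub>Ch\<^esub>"
    by (intro bexI[of _ g]) (auto simp: carrier_Ch Ch_simps chi_mul add_self_triple)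
qed (auto simp: carrier_Ch Ch_simps)

lemma inv_chi: "inv\<^bsub>Ch\<^esub> (chi l) = chi l"
  by (rule Ch.inv_equality) (simp_all add: carrier_Ch Ch_simps chi_mul add_self_triple)

lemma fin_Ch: "finite (carrier Ch)"
  by (simp add: carrier_Ch)

lemma Ch_iso: "Ch \<cong> integer_mod_group 2 \<times>\<times> integer_mod_group 2 \<times>\<times> integer_mod_group 2"
proof -
  define bi :: "bit \<Rightarrow> int" where "bi b = (if b = 0 then 0 else 1)" for b
  have bi_add: "bi (b + b') = (bi b + bi b') mod 2" for b b' by (cases b; cases b'; simp add: bi_def)
  have bi_bij: "bij_betw bi UNIV {0..<2}"
    by (auto simp: bij_betw_def inj_on_def bi_def UNIV_bit atLeastLessThan_def)
  define h where "h g = (let l = the_inv chi g in (bi (fst l), bi (fst (snd l)), bi (snd (snd l))))" for g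
  have h: "h (chi (l1, l2, l3)) = (bi l1, bi l2, bi l3)" for l1 l2 l3
    by (simp add: h_def Let_def the_inv_f_f[OF inj_chi])
  have "h \<in> hom Ch (integer_mod_group 2 \<times>\<times> integer_mod_group 2 \<times>\<times> integer_mod_group 2)"
    by (rule homI) (auto simp: carrier_Ch Ch_simps chi_mul h bi_add carrier_integer_mod_group bi_def split: if_splits)
  moreover have "bij_betw h (carrier Ch) (carrier (integer_mod_group 2 \<times>\<times> integer_mod_group 2 \<times>\<times> integer_mod_group 2))"
  proof -
    have "bij_betw (\<lambda>(l1, l2, l3). (bi l1, bi l2, bi l3)) (UNIV \<times> UNIV \<times> UNIV) ({0..<2} \<times> {0..<2} \<times> {0..<2})"
      using bij_betw_map_prod[OF bi_bij bij_betw_map_prod[OF bi_bij bi_bij]] by (simp add: map_prod_def split_def)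
    then have "bij_betw ((\<lambda>(l1, l2, l3). (bi l1, bi l2, bi l3)) \<circ> the_inv chi) (range chi) ({0..<2} \<times> {0..<2} \<times> {0..<2})"
      using bij_betw_the_inv_into[OF inj_on_imp_bij_betw[OF inj_chi]] by (intro bij_betw_trans) auto
    then have "bij_betw h (range chi) ({0..<2} \<times> {0..<2} \<times> {0..<2})"
      by (simp add: h_def[abs_def] comp_def split_def Let_def)
    then show ?thesis by (simp add: carrier_Ch carrier_integer_mod_group)
  qed
  ultimately show ?thesis unfolding is_iso_def iso_def by blast
qed

subsection \<open>The central subalgebra\<close>

text \<open>The central idempotent of the block with central character \<open>(b, d, e)\<close>. The
  exponent \<open>e + d + b + m\<close> repeats the dependence of \<open>mc\<close> on
  \<open>n\<close>, so the element acts as the identity on the representations with this central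
  character and as zero on the others; the characters belong to \<open>(0, 0, 0)\<close>.\<close>

definition Bz :: "bit \<times> bit \<times> bit \<Rightarrow> ('i \<times> 'i \<Rightarrow>\<^sub>0 'k)"
  where "Bz = (\<lambda>(b, d, e). smul (1/2) (\<Sum>m\<in>UNIV. \<Sum>n\<in>UNIV. smul (sg (n * (e + d + b + m))) (F 0 m d b n 0)))"

lemma Bz_closed: "Bz l \<in> space D"
  by (auto simp: Bz_def simp del: dd.D_basis intro!: vsp_intros vsp_sum split: prod.split)

lemma F_Bz: "mul D (F a m d b n c) (Bz (b', d', e)) = (if b = b' \<and> d = d'
    then smul (1/2) (\<Sum>n'\<in>UNIV. smul (sg (n' * (e + d + b + m + d * a))) (F a m d b (n + n') c)) else 0)"
proof -
  have "mul D (F a m d b n c) (Bz (b', d', e)) = smul (1/2) (\<Sum>m'\<in>UNIV. \<Sum>n'\<in>UNIV. if m' = m + d * a + b * c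
     then if b = b' \<and> d = d' then smul (sg (n' * (e + d + b + m + d * a))) (F a m d b (n + n') c) else 0 else 0)"
    unfolding Bz_def prod.case mul_linear
    by (intro arg_cong[where f = "smul _"] sum.cong refl) (auto simp: F_mul phase_simps)
  then show ?thesis by (subst (asm) sum.swap) (cases "b = b' \<and> d = d'"; auto)
qed

text \<open>Here the matching condition is \<open>m' = m\<close>, whereas in \<open>F_Bz\<close> it
  is \<open>m' = m + d * a + b * c\<close>. The commutation signs of \<open>F_mul\<close> make up
  for the difference, so both products have the same right-hand side; this is the centrality of
  \<open>Bz\<close>.\<close>

lemma Bz_F: "mul D (Bz (b', d', e)) (F a m d b n c) = (if b = b' \<and> d = d'
    then smul (1/2) (\<Sum>n'\<in>UNIV. smul (sg (n' * (e + d + b + m + d * a))) (F a m d b (n + n') c)) else 0)"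
proof -
  have "mul D (Bz (b', d', e)) (F a m d b n c) = smul (1/2) (\<Sum>m'\<in>UNIV. \<Sum>n'\<in>UNIV. if m' = m
     then if b = b' \<and> d = d' then smul (sg (n' * (e + d + b + m + d * a))) (F a m d b (n + n') c) else 0 else 0)"
    unfolding Bz_def prod.case mul_linear
    by (intro arg_cong[where f = "smul _"] sum.cong refl) (auto simp: F_mul phase_simps)
  then show ?thesis by (subst (asm) sum.swap) (cases "b = b' \<and> d = d'"; auto)
qed

lemma Bz_central: "v \<in> space D \<Longrightarrow> mul D (Bz l) v = mul D v (Bz l)"
  by (cases l, rule F_ext) (auto intro!: lnr_intros simp: F_Bz Bz_F)

lemma Bz_mul: "mul D (Bz l) (Bz l') = (if l = l' then Bz l else 0)"
proof -
  obtain b d e where l: "l = (b, d, e)" by (metis prod.exhaust)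
  obtain b' d' e' where l': "l' = (b', d', e')" by (metis prod.exhaust)
  show ?thesis
  proof (cases "b = b' \<and> d = d'")
    case True
    have "mul D (Bz l) (Bz l') = smul (1/2) (\<Sum>m\<in>UNIV. \<Sum>n\<in>UNIV. smul (sg (n * (e + d + b + m)))
       (smul (1/2) (\<Sum>n'\<in>UNIV. smul (sg (n' * (e' + d + b + m))) (F 0 m d b (n + n') 0))))"
      using True unfolding l by (subst (1) Bz_def) (simp add: mul_linear l' F_Bz)
    also have "\<dots> = (if l = l' then Bz l else 0)"
      unfolding l l' Bz_def prod.case
      by (cases e; cases e'; rule poly_mapping_eqI; simp add: True sum_bit lookup_add lookup_minus sg_add; simp add: field_simps)
    finally show ?thesis .
  next
    case False
    then show ?thesis unfolding l by (subst (1) Bz_def) (auto simp: mul_linear l' F_Bz)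
  qed
qed

lemma Bz_unt: "(\<Sum>l\<in>UNIV. Bz l) = unt D"
  by (rule poly_mapping_eqI)
    (simp add: sum_UNIV_prod sum_bit Bz_def F_unt lookup_add lookup_minus; simp add: field_simps)

lemma Bz_counit: "counit D (Bz l) = (if l = 0 then 1 else 0)"
proof -
  obtain b d e where l: "l = (b, d, e)" by (metis prod.exhaust)
  show ?thesis
    by (cases b; cases d; cases e; simp add: l Bz_def F_counit lfn_smul[OF lfn_comp(4)] lfn_add[OF lfn_comp(4)] sum_bit zero_prod_def)
qed

lemma Bz_antipode: "antipode D (Bz l) = Bz l"
  by (cases l) (simp add: Bz_def F_antipode lnr_smul[OF lnr_antipode'] lnr_sum[OF lnr_antipode'])

text \<open>With \<open>Bz_mul\<close> this is the structure of delta functions on the group of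
  triples of bits, compare \<open>fCh_comult\<close>.\<close>

lemma Bz_comult: "comult D (Bz l) = (\<Sum>l'\<in>UNIV. tens (Bz l') (Bz (l + l')))"
proof -
  obtain b d e where l: "l = (b, d, e)" by (metis prod.exhaust)
  let ?g = "\<lambda>b1 d1. smul (1/2) (\<Sum>n\<in>UNIV. \<Sum>m1\<in>UNIV. \<Sum>m\<in>UNIV. smul (sg (n * (e + d + b + m1 + m)))
     (tens (F 0 m1 d1 b1 n 0) (F 0 m (d + d1) (b + b1) n 0)))"
  \<comment> \<open>Summing over the sign \<open>e1\<close> forces the exponents \<open>n\<close> of
    the two tensor factors to agree.\<close>
  have pt: "(\<Sum>e1\<in>UNIV. tens (Bz (b1, d1, e1)) (Bz (b + b1, d + d1, e + e1))) = ?g b1 d1" for b1 d1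
    by (rule poly_mapping_eqI)
      (simp add: Bz_def sum_bit tens_linear lookup_add lookup_minus sg_add add_ac; simp add: field_simps)
  have "comult D (Bz l) = smul (1/2) (\<Sum>m\<in>UNIV. \<Sum>n\<in>UNIV. \<Sum>m1\<in>UNIV. \<Sum>c1\<in>UNIV. \<Sum>b1\<in>UNIV. smul (sg (n * (e + d + b + m)))
     (tens (F 0 (m + m1) (d + c1) b1 n 0) (F 0 m1 c1 (b + b1) n 0)))"
    by (simp add: l Bz_def F_comult lnr_smul[OF lnr_comult'] lnr_sum[OF lnr_comult'] pm.scale_sum_right)
  also have "\<dots> = (\<Sum>b1\<in>UNIV. \<Sum>d1\<in>UNIV. ?g b1 d1)"
    by (cases d; simp add: sum_bit add_ac pm.scale_right_distrib sg_add)
  also have "\<dots> = (\<Sum>l'\<in>UNIV. tens (Bz l') (Bz (l + l')))"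
    by (simp add: sum_UNIV_prod pt l)
  finally show ?thesis .
qed

lemma Bz_nonzero: "Bz l \<noteq> 0"
proof
  obtain b d e where l: "l = (b, d, e)" by (metis prod.exhaust)
  assume "Bz l = 0"
  then have "pairing (G 0 0 d b 0 0) (Bz l) = 0" by (simp add: pairing_linear)
  moreover have "pairing (G 0 0 d b 0 0) (Bz l) = 1/2"
    by (simp add: l Bz_def pairing_linear sum_bit)
  ultimately show False by simp
qed

end

context h8
begin

abbreviation "kCh \<equiv> group_algebra Ch :: ('i \<times> 'i \<Rightarrow>\<^sub>0 'k, 'k) hopf"
abbreviation "fCh \<equiv> function_algebra Ch :: ('i \<times> 'i \<Rightarrow>\<^sub>0 'k, 'k) hopf"

lemma chi_carrier [simp]: "chi l \<in> carrier Ch"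
  by (simp add: carrier_Ch)

lemma chi_otimes [simp]: "chi l \<otimes>\<^bsub>Ch\<^esub> chi l' = chi (l + l')"
  by (simp add: Ch_simps chi_mul)

lemmas fCh = Ch.fG_mul[OF fin_Ch] Ch.fG_unt[OF fin_Ch] Ch.fG_counit[OF fin_Ch] Ch.fG_antipode[OF fin_Ch]

lemma basis_Ch [simp]: "basis fCh = range chi"
  using Ch.fG_basis[OF fin_Ch] by (simp add: carrier_Ch)

lemma fCh_comult: "comult fCh (bv (chi l)) = (\<Sum>l'\<in>UNIV. bv (chi l', chi (l + l')))"
proof -
  have "comult fCh (bv (chi l)) = (\<Sum>h\<in>carrier Ch. bv (h, inv\<^bsub>Ch\<^esub> h \<otimes>\<^bsub>Ch\<^esub> chi l))"
    by (rule Ch.fG_comult[OF fin_Ch]) simp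
  then show ?thesis by (simp add: carrier_Ch sum.reindex inj_chi inv_chi add_ac)
qed

lemma fCh_ext: "lnr \<phi> \<Longrightarrow> lnr \<psi> \<Longrightarrow> (\<And>l. \<phi> (bv (chi l)) = \<psi> (bv (chi l))) \<Longrightarrow> p \<in> space fCh \<Longrightarrow> \<phi> p = \<psi> p"
  by (rule lnr_ext[of \<phi> \<psi> p "range chi"]) auto

subsubsection \<open>The inclusion\<close>

definition iota :: "(('i \<times> 'i \<Rightarrow>\<^sub>0 'k) \<Rightarrow>\<^sub>0 'k) \<Rightarrow> ('i \<times> 'i \<Rightarrow>\<^sub>0 'k)"
  where "iota = lin (\<lambda>g. Bz (the_inv chi g))"

lemma iota_chi [simp]: "iota (bv (chi l)) = Bz l"
  by (simp add: iota_def the_inv_f_f[OF inj_chi])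

lemma lnr_iota: "lnr iota"
  unfolding iota_def by (rule lnr_lin)

lemma iota_closed: "iota p \<in> space D"
  unfolding iota_def lin_def by (intro vsp_sum vsp_intros Bz_closed)

lemma iota_hom: "hopf_hom fCh D iota"
  unfolding hopf_hom_def lmap_iff
proof (intro conjI ballI)
  show "iota (unt fCh) = unt D"
    by (simp add: fCh carrier_Ch sum.reindex inj_chi lnr_sum[OF lnr_iota] Bz_unt)
  fix p assume p: "p \<in> space fCh"
  show "comult D (iota p) = tmap iota iota (comult fCh p)"
  proof (rule fCh_ext[OF _ _ _ p])
    fix l
    have "tmap iota iota (comult fCh (bv (chi l))) = (\<Sum>l'\<in>UNIV. tmap iota iota (bv (chi l', chi (l + l'))))"
      unfolding fCh_comult by (rule lnr_sum[OF lnr_tmap'])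
    also have "\<dots> = comult D (iota (bv (chi l)))" by (simp add: Bz_comult tmap_bv)
    finally show "comult D (iota (bv (chi l))) = tmap iota iota (comult fCh (bv (chi l)))" ..
  qed (intro lnr_intros lnr_comp[OF _ lnr_iota])+
  show "counit D (iota p) = counit fCh p"
  proof (rule lnr_restrict_ext[OF _ _ p])
    show "lfn (\<lambda>p. counit D (iota p))" by (intro lnr_intros lnr_iota)
    show "lfn (counit fCh)" by (intro lnr_intros)
    fix i assume "i \<in> basis fCh"
    then show "counit D (iota (bv i)) = counit fCh (bv i)"
      by (auto simp: Bz_counit fCh Ch_simps simp del: counit_bv)
  qed
  show "antipode D (iota p) = iota (antipode fCh p)"
    by (rule fCh_ext[OF _ _ _ p])
      (auto intro!: lnr_intros lnr_comp[OF lnr_iota] lnr_iota simp: Bz_antipode fCh carrier_Ch inv_chi simp del: antipode_bv)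
  fix q assume q: "q \<in> space fCh"
  show "iota (mul fCh p q) = mul D (iota p) (iota q)"
  proof (rule fCh_ext[OF _ _ _ p])
    fix l
    show "iota (mul fCh (bv (chi l)) q) = mul D (iota (bv (chi l))) (iota q)"
      by (rule fCh_ext[OF _ _ _ q])
        (auto intro!: lnr_intros lnr_comp[OF lnr_iota] lnr_iota simp: Bz_mul fCh carrier_Ch lnr_0[OF lnr_iota] simp del: mul_bv)
  qed (intro lnr_intros lnr_comp[OF lnr_iota] lnr_iota)+
qed (use lnr_iota iota_closed in auto)

lemma iota_inj: "inj_on iota (space fCh)"
proof (rule inj_onI)
  fix p q assume p: "p \<in> space fCh" and q: "q \<in> space fCh" and e: "iota p = iota q"
  \<comment> \<open>Multiplication by \<open>Bz l\<close> isolates the coefficient of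
    \<open>p\<close> at \<open>chi l\<close>.\<close>
  have *: "mul D (Bz l) (iota p) = smul (Poly_Mapping.lookup p (chi l)) (Bz l)" if "p \<in> space fCh" for p l
  proof (rule fCh_ext[OF _ _ _ that])
    show "lnr (\<lambda>p. smul (Poly_Mapping.lookup p (chi l)) (Bz l))" by (intro lnr_intros)
    fix l'
    show "mul D (Bz l) (iota (bv (chi l'))) = smul (Poly_Mapping.lookup (bv (chi l')) (chi l)) (Bz l)"
      by (auto simp: Bz_mul lookup_single when_def)
  qed (intro lnr_intros lnr_iota)
  show "p = q"
  proof (rule poly_mapping_eqI)
    fix g
    show "Poly_Mapping.lookup p g = Poly_Mapping.lookup q g"
    proof (cases "g \<in> range chi")
      case True
      then obtain l where g: "g = chi l" by blast
      have "smul (Poly_Mapping.lookup p g) (Bz l) = smul (Poly_Mapping.lookup q g) (Bz l)"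
        by (simp only: g *[OF p, symmetric] *[OF q, symmetric] e)
      then show ?thesis using Bz_nonzero[of l] by simp
    next
      case False
      then show ?thesis using lookup_vsp[OF p] lookup_vsp[OF q] by simp
    qed
  qed
qed

lemma iota_central: "iota ` space fCh \<subseteq> alg_center D"
proof
  fix a assume "a \<in> iota ` space fCh"
  then obtain p where p: "p \<in> space fCh" "a = iota p" by blast
  have "mul D (iota p) v = mul D v (iota p)" if "v \<in> space D" for v
    by (rule fCh_ext[OF _ _ _ p(1)]) (use that in \<open>auto intro!: lnr_intros lnr_iota simp: Bz_central\<close>)
  then show "a \<in> alg_center D" using p iota_closed by (simp add: alg_center_def del: dd.D_basis)
qed

lemma iota_subspace: "pm.subspace (iota ` space fCh)"
  unfolding pm.subspace_def
proof (intro conjI ballI allI)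
  show "0 \<in> iota ` space fCh" using lnr_0[OF lnr_iota] by (metis imageI vsp_intros(1))
  fix a b c assume "a \<in> iota ` space fCh" "b \<in> iota ` space fCh"
  then obtain p q where "p \<in> space fCh" "q \<in> space fCh" "a = iota p" "b = iota q" by blast
  then show "a + b \<in> iota ` space fCh" "smul c a \<in> iota ` space fCh"
    by (auto simp: lnr_add[OF lnr_iota, symmetric] lnr_smul[OF lnr_iota, symmetric] simp del: basis_Ch intro!: imageI)
qed

text \<open>A central element can be moved out of both adjoint actions, which then reduce to
  multiplication by the counit.\<close>

lemma iota_normal: "normal_in D (iota ` space fCh)"
  unfolding normal_in_def
proof (intro ballI)
  fix v a assume v: "v \<in> space D" and a: "a \<in> iota ` space fCh"
  have aD: "a \<in> space D" and cen: "\<And>v. v \<in> space D \<Longrightarrow> mul D a v = mul D v a"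
    using iota_central a by (auto simp: alg_center_def)
  have cl: "antipode D (bv j) \<in> space D" if "j \<in> basis D" for j using that by (intro D_antipode_closed) auto
  have bc: "bv j \<in> space D" if "j \<in> basis D" for j using that by auto
  have "lin (\<lambda>(i, j). mul D (mul D (bv i) a) (antipode D (bv j))) (comult D v)
      = mul D a (lin (\<lambda>(i, j). mul D (bv i) (antipode D (bv j))) (comult D v))"
    unfolding lnr_lin_comp[OF lnr_mul2[OF lnr_id]]
    by (rule lin_cong_vsp[OF corep.comult_closed[OF v]])
      (auto simp: cen[OF bc, symmetric] rep.mul_assoc[OF aD bc cl] simp del: dd.D_basis antipode_bv)
  moreover have "lin (\<lambda>(i, j). mul D (mul D (antipode D (bv i)) a) (bv j)) (comult D v)
      = mul D a (lin (\<lambda>(i, j). mul D (antipode D (bv i)) (bv j)) (comult D v))"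
    unfolding lnr_lin_comp[OF lnr_mul2[OF lnr_id]]
    by (rule lin_cong_vsp[OF corep.comult_closed[OF v]])
      (auto simp: cen[OF cl, symmetric] rep.mul_assoc[OF aD cl bc] simp del: dd.D_basis antipode_bv)
  ultimately show "lin (\<lambda>(i, j). mul D (mul D (bv i) a) (antipode D (bv j))) (comult D v) \<in> iota ` space fCh \<and>
      lin (\<lambda>(i, j). mul D (mul D (antipode D (bv i)) a) (bv j)) (comult D v) \<in> iota ` space fCh"
    using pm.subspace_scale[OF iota_subspace a] rep.mul_unt(2)[OF aD]
    by (simp add: D_antipode_left[OF v] D_antipode_right[OF v] mul_linear del: dd.D_basis basis_Ch antipode_bv)
qed

subsubsection \<open>The projection\<close>

text \<open>The values of the characters on \<open>F\<close> form a function on the character group.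
  \<open>piF\<close> is the element of the group algebra which has that function as its Fourier
  transform for the bicharacter \<open>sg (l1 * l1' + l2 * l2' + l3 * l3')\<close>; so the quotient
  on which the characters live is a group algebra as well as a function algebra.\<close>

definition piF :: "bit \<Rightarrow> bit \<Rightarrow> bit \<Rightarrow> bit \<Rightarrow> bit \<Rightarrow> bit \<Rightarrow> (('i \<times> 'i \<Rightarrow>\<^sub>0 'k) \<Rightarrow>\<^sub>0 'k)" where
  "piF a m d b n c = (if d = 0 \<and> b = 0 then smul (1/2) (\<Sum>l\<in>UNIV. smul (sg (l * m + n * m)) (bv (chi (l, a, c)))) else 0)"

definition proj :: "('i \<times> 'i \<Rightarrow>\<^sub>0 'k) \<Rightarrow> (('i \<times> 'i \<Rightarrow>\<^sub>0 'k) \<Rightarrow>\<^sub>0 'k)"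
  where "proj v = (\<Sum>((a, m, d), (b, n, c))\<in>UNIV. smul (pairing (G a m d b n c) v) (piF a m d b n c))"

lemma lnr_proj': "lnr proj"
  unfolding proj_def split_def by (intro lnr_intros)

lemma proj_F [simp]: "proj (F a m d b n c) = piF a m d b n c"
proof -
  have "proj (F a m d b n c) = (\<Sum>t\<in>UNIV. if t = ((a, m, d), (b, n, c)) then piF a m d b n c else 0)"
    unfolding proj_def by (intro sum.cong refl) (auto split: if_splits)
  then show ?thesis by simp
qed

lemma piF_closed: "piF a m d b n c \<in> space kCh"
  by (auto simp: piF_def simp del: smul_single intro!: vsp_intros vsp_sum)

lemma proj_closed: "proj v \<in> space kCh"
  by (auto simp: proj_def simp del: Ch.kG_simps intro!: vsp_sum vsp_intros piF_closed)

lemma piF_mul: "proj (mul D (F a m d b n c) (F a' m' d' b' n' c')) = mul kCh (piF a m d b n c) (piF a' m' d' b' n' c')"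
proof (cases "d = 0 \<and> b = 0 \<and> d' = 0 \<and> b' = 0")
  case True
  show ?thesis
    by (cases m; cases m'; rule poly_mapping_eqI;
        simp add: True F_mul lnr_smul[OF lnr_proj'] lnr_0[OF lnr_proj'] piF_def sum_bit mul_linear lookup_double lookup_add lookup_minus phase_simps
          del: smul_single; simp add: field_simps)
next
  case False
  then show ?thesis by (auto simp: F_mul lnr_smul[OF lnr_proj'] lnr_0[OF lnr_proj'] piF_def mul_linear)
qed

lemma proj_hom: "hopf_hom D kCh proj"
  unfolding hopf_hom_def lmap_iff
proof (intro conjI ballI)
  show "proj (unt D) = unt kCh"
    unfolding F_unt lnr_sum[OF lnr_proj'] proj_F
    by (rule poly_mapping_eqI; simp only: lookup_sum;
        simp add: piF_def sum_bit Ch.kG_simps(3) Ch_simps zero_prod_def lookup_double lookup_add lookup_minus del: smul_single; simp add: field_simps)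
  fix v assume v: "v \<in> space D"
  show "comult kCh (proj v) = tmap proj proj (comult D v)"
  proof (rule F_ext[OF _ _ _ v])
    fix a m d b n c
    have "tmap proj proj (comult D (F a m d b n c)) = (\<Sum>m1\<in>UNIV. \<Sum>c1\<in>UNIV. \<Sum>b1\<in>UNIV.
      smul (sg (a * c1 * (m + m1)) * iu (a * c1 * (d + c1)))
      (tens (piF a (m + m1) (d + c1) b1 n c) (piF a m1 c1 (b + b1) (n + c * b1) c)))"
      by (simp add: F_comult lnr_sum[OF lnr_tmap'] lnr_smul[OF lnr_tmap'] lnr_proj')
    also have "\<dots> = comult kCh (piF a m d b n c)"
      by (cases d; cases b; cases m; rule poly_mapping_eqI;
        simp add: piF_def sum_bit tens_linear lnr_add[OF lnr_comult'] lnr_smul[OF lnr_comult'] lnr_0[OF lnr_comult']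
          Ch.kG_simps(4) lookup_double lookup_add lookup_minus phase_simps del: smul_single comult_bv; simp add: field_simps)
    finally show "comult kCh (proj (F a m d b n c)) = tmap proj proj (comult D (F a m d b n c))" by simp
  qed (intro lnr_intros lnr_comp[OF _ lnr_proj'])+
  show "counit kCh (proj v) = counit D v"
  proof (rule F_fn_ext[OF _ _ _ v])
    fix a m d b n c
    show "counit kCh (proj (F a m d b n c)) = counit D (F a m d b n c)"
      by (cases m) (simp_all add: piF_def F_counit lfn_smul[OF lfn_comp(4)] lfn_add[OF lfn_comp(4)] lfn_0[OF lfn_comp(4)] sum_bit
          Ch.kG_simps(5) sg_add del: smul_single counit_bv)
  qed (intro lnr_intros lnr_proj')+
  show "antipode kCh (proj v) = proj (antipode D v)"
  proof (rule F_ext[OF _ _ _ v])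
    fix a m d b n c
    have "antipode kCh (piF a m d b n c) = piF a m d b n c"
      unfolding piF_def
      by (simp only: if_distrib[of "antipode kCh"] lnr_0[OF lnr_antipode'] lnr_smul[OF lnr_antipode'] lnr_sum[OF lnr_antipode']
          Ch.kG_simps(6) inv_chi)
    moreover have "proj (antipode D (F a m d b n c)) = piF a m d b n c"
    proof (cases "d = 0 \<and> b = 0")
      case True
      \<comment> \<open>The shift of \<open>n\<close> by \<open>c * a\<close> in
        \<open>F_antipode\<close> compensates the sign that accompanies it.\<close>
      have ph: "sg (c * a * m) * sg (l * m + (n + c * a) * m) = (sg (l * m + n * m) :: 'k)" for l
        by (cases a; cases c; cases m; simp add: sg_add)
      from True have "proj (antipode D (F a m d b n c)) = smul (sg (c * a * m)) (piF a m 0 0 (n + c * a) c)"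
        by (simp add: F_antipode lnr_smul[OF lnr_proj'])
      also have "\<dots> = smul (1/2) (\<Sum>l\<in>UNIV. smul (sg (c * a * m) * sg (l * m + (n + c * a) * m)) (bv (chi (l, a, c))))"
        by (simp add: piF_def pm.scale_sum_right del: smul_single)
      also have "\<dots> = smul (1/2) (\<Sum>l\<in>UNIV. smul (sg (l * m + n * m)) (bv (chi (l, a, c))))"
        by (simp only: ph)
      finally show ?thesis using True by (simp add: piF_def)
    next
      case False
      then show ?thesis by (auto simp: F_antipode lnr_smul[OF lnr_proj'] piF_def)
    qed
    ultimately show "antipode kCh (proj (F a m d b n c)) = proj (antipode D (F a m d b n c))" by simp
  qed (intro lnr_intros lnr_comp[OF lnr_proj'] lnr_proj')+
  fix v' assume v': "v' \<in> space D"
  show "proj (mul D v v') = mul kCh (proj v) (proj v')"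
  proof (rule F_ext[OF _ _ _ v])
    fix a m d b n c
    show "proj (mul D (F a m d b n c) v') = mul kCh (proj (F a m d b n c)) (proj v')"
    proof (rule F_ext[OF _ _ _ v'])
      fix a' m' d' b' n' c'
      show "proj (mul D (F a m d b n c) (F a' m' d' b' n' c')) = mul kCh (proj (F a m d b n c)) (proj (F a' m' d' b' n' c'))"
        unfolding proj_F by (rule piF_mul)
    qed (intro lnr_intros lnr_comp[OF lnr_proj'] lnr_proj')+
  qed (intro lnr_intros lnr_comp[OF lnr_proj'] lnr_proj')+
qed (use lnr_proj' proj_closed in auto)

text \<open>A linear section of the projection, whose image is \<open>D(H) e\<close> for the idempotent \<open>e = Bz 0\<close>.\<close>

definition sect :: "(('i \<times> 'i \<Rightarrow>\<^sub>0 'k) \<Rightarrow>\<^sub>0 'k) \<Rightarrow> ('i \<times> 'i \<Rightarrow>\<^sub>0 'k)"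
  where "sect = lin (\<lambda>g. case the_inv chi g of (l, a, c) \<Rightarrow>
    smul (1/2) (\<Sum>m\<in>UNIV. \<Sum>n\<in>UNIV. smul (sg (l * m + n * m)) (F a m 0 0 n c)))"

lemma sect_chi: "sect (bv (chi (l, a, c))) = smul (1/2) (\<Sum>m\<in>UNIV. \<Sum>n\<in>UNIV. smul (sg (l * m + n * m)) (F a m 0 0 n c))"
  by (simp add: sect_def the_inv_f_f[OF inj_chi])

lemma lnr_sect: "lnr sect"
  unfolding sect_def by (rule lnr_lin)

lemma sect_closed: "sect v \<in> space D"
  unfolding sect_def lin_def by (intro vsp_sum vsp_intros) (auto split: prod.split intro!: vsp_intros vsp_sum F_closed simp del: dd.D_basis)

lemma proj_sect: "proj (sect (bv (chi l))) = bv (chi l)"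
proof -
  obtain l1 a c where l: "l = (l1, a, c)" by (metis prod.exhaust)
  show ?thesis
    unfolding l sect_chi lnr_smul[OF lnr_proj'] lnr_sum[OF lnr_proj'] proj_F
    by (cases l1; rule poly_mapping_eqI; simp only: lookup_smul lookup_sum;
        simp add: piF_def sum_bit lookup_add lookup_minus del: smul_single; simp add: field_simps)
qed

text \<open>Up to the section, the projection is multiplication by the idempotent
  \<open>Bz 0\<close>; this determines its kernel.\<close>

lemma sect_proj: "v \<in> space D \<Longrightarrow> sect (proj v) = mul D v (Bz 0)"
proof (rule F_ext[of "\<lambda>v. sect (proj v)" "\<lambda>v. mul D v (Bz 0)"])
  fix a m d b n c
  have "sect (proj (F a m d b n c)) = (if d = 0 \<and> b = 0 then smul (1/2) (\<Sum>l\<in>UNIV. smul (sg (l * m + n * m))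
      (smul (1/2) (\<Sum>m'\<in>UNIV. \<Sum>n'\<in>UNIV. smul (sg (l * m' + n' * m')) (F a m' 0 0 n' c)))) else 0)"
    unfolding proj_F piF_def sect_chi[symmetric] lnr_smul[OF lnr_sect, symmetric] lnr_sum[OF lnr_sect, symmetric]
    by (simp add: lnr_0[OF lnr_sect])
  then show "sect (proj (F a m d b n c)) = mul D (F a m d b n c) (Bz 0)"
    unfolding zero_prod_def F_Bz
    by (cases m; cases n; simp only:; intro poly_mapping_eqI; cases d; cases b; simp only: if_True if_False simp_thms lookup_smul lookup_sum;
        simp add: sum_bit lookup_add lookup_minus; simp add: field_simps)
qed (intro lnr_intros lnr_comp[OF lnr_sect] lnr_proj')+

text \<open>All the idempotents except \<open>Bz 0\<close> vanish in the quotient, and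
  \<open>Bz 0\<close> becomes the unit.\<close>

lemma proj_iota: "p \<in> space fCh \<Longrightarrow> proj (iota p) = smul (counit fCh p) (unt kCh)"
proof (rule fCh_ext[of "\<lambda>p. proj (iota p)" "\<lambda>p. smul (counit fCh p) (unt kCh)"])
  fix l :: "bit \<times> bit \<times> bit"
  obtain b d e where l: "l = (b, d, e)" by (metis prod.exhaust)
  show "proj (iota (bv (chi l))) = smul (counit fCh (bv (chi l))) (unt kCh)"
    unfolding iota_chi fCh Ch.kG_simps(3) Ch_simps l Bz_def prod.case lnr_smul[OF lnr_proj'] lnr_sum[OF lnr_proj'] proj_F
    by (cases b; cases d; cases e; rule poly_mapping_eqI; simp only: lookup_smul lookup_sum;
        simp add: piF_def sum_bit lookup_add lookup_minus zero_prod_def del: smul_single; simp add: field_simps)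
qed (intro lnr_intros lnr_comp[OF lnr_proj'] lnr_iota)+

text \<open>If \<open>proj v = 0\<close>, then \<open>v\<close> is annihilated by
  \<open>Bz 0\<close> and hence equals its product with \<open>unt D - Bz 0\<close>, the image of an
  element of counit zero. The other inclusion is multiplicativity of \<open>proj\<close> together
  with \<open>proj_iota\<close>.\<close>

lemma proj_kernel: "{v \<in> space D. proj v = 0} = augmentation_left_ideal D (iota ` space fCh)"
proof
  show "{v \<in> space D. proj v = 0} \<subseteq> augmentation_left_ideal D (iota ` space fCh)"
  proof
    fix v assume "v \<in> {v \<in> space D. proj v = 0}"
    then have v: "v \<in> space D" "proj v = 0" by auto
    then have "mul D v (Bz 0) = 0" using sect_proj[of v] lnr_0[OF lnr_sect] by simp
    then have "v = mul D v (unt D - Bz 0)" using rep.mul_unt(2)[OF v(1)] by (simp add: mul_linear)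
    moreover have "unt D - Bz 0 = iota (unt fCh - bv (chi 0))"
      using iota_hom by (simp add: hopf_hom_def lnr_diff[OF lnr_iota])
    moreover have "unt fCh - bv (chi 0) \<in> space fCh"
      by (intro vsp_intros Ch.fG_closed(1)[OF fin_Ch]) auto
    moreover have "counit D (unt D - Bz 0) = 0"
    proof -
      have "counit D (unt D - Bz 0) + counit D (Bz 0) = counit D (unt D)"
        by (simp add: lfn_add[OF lfn_comp(4), symmetric])
      then show ?thesis by (simp add: D_counit_unt Bz_counit)
    qed
    ultimately show "v \<in> augmentation_left_ideal D (iota ` space fCh)"
      unfolding augmentation_left_ideal_def using v(1) by (intro pm.span_base) blast
  qed
  show "augmentation_left_ideal D (iota ` space fCh) \<subseteq> {v \<in> space D. proj v = 0}"
    unfolding augmentation_left_ideal_def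
  proof (rule pm.span_minimal)
    show "pm.subspace {v \<in> space D. proj v = 0}"
      by (auto simp: pm.subspace_def lnr_0[OF lnr_proj'] lnr_add[OF lnr_proj'] lnr_smul[OF lnr_proj'])
    have "proj (mul D v (iota p)) = 0" if v: "v \<in> space D" and p: "p \<in> space fCh" and c: "counit D (iota p) = 0" for v p
    proof -
      have "proj (mul D v (iota p)) = mul kCh (proj v) (proj (iota p))"
        using proj_hom v iota_closed by (simp add: hopf_hom_def del: dd.D_basis)
      also have "counit fCh p = 0" using iota_hom p c by (simp add: hopf_hom_def del: basis_Ch)
      then have "proj (iota p) = 0" using proj_iota[OF p] by simp
      finally show ?thesis by (simp add: mul_linear)
    qed
    then show "{mul D v a |v a. v \<in> space D \<and> a \<in> iota ` space fCh \<and> counit D a = 0} \<subseteq> {v \<in> space D. proj v = 0}"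
      using D_mul_closed iota_closed by blast
  qed
qed

lemma proj_surj: "proj ` space D = space kCh"
proof
  show "proj ` space D \<subseteq> space kCh" using proj_closed by blast
  show "space kCh \<subseteq> proj ` space D"
  proof
    fix p assume p: "p \<in> space kCh"
    have "proj (sect p) = p"
      by (rule lnr_ext[OF lnr_comp[OF lnr_proj' lnr_sect] lnr_id p]) (auto simp: carrier_Ch proj_sect)
    then show "p \<in> proj ` space D" using sect_closed by (metis imageI)
  qed
qed

lemma extension: "hopf_extension fCh iota D proj kCh"
  unfolding hopf_extension_def
  using Ch.fG_hopf[OF fin_Ch] D_hopf Ch.kG_hopf[OF fin_Ch] iota_hom proj_hom iota_inj iota_normal proj_surj proj_kernel by blast

lemma extension_abelian_central:
  "abelian_extension fCh iota D proj kCh" "central_extension fCh iota D proj kCh"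
  unfolding abelian_extension_def central_extension_def
  using extension Ch.fG_commutative[OF fin_Ch] Ch.kG_cocommutative iota_central by blast+

end

lemma square_root: "\<exists>r. r * r = (a :: 'k::alg_closed_field)"
proof -
  have "\<exists>r. poly [:- a, 0, 1:] r = 0" by (rule alg_closed_imp_poly_has_root) simp
  then obtain r where "poly [:- a, 0, 1:] r = 0" by blast
  then have "r * r = a" by simp
  then show ?thesis by blast
qed

theorem theoremA1p1:
  fixes H :: "('i, 'k::{alg_closed_field, field_char_0}) hopf"
    and x y z :: "'i \<Rightarrow>\<^sub>0 'k"
  assumes "is_H8 H x y z"
  shows
    "let D = drinfeld_double H; G = group_likes (dual D) in
       (\<exists>\<iota> \<pi>. abelian_extension (function_algebra G) \<iota> D \<pi> (group_algebra G) \<and>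
               central_extension (function_algebra G) \<iota> D \<pi> (group_algebra G)) \<and>
       G \<cong> integer_mod_group 2 \<times>\<times> integer_mod_group 2 \<times>\<times> integer_mod_group 2 \<and>
       of_algebra_type D [(1, 8), (2, 14)] \<and>
       of_coalgebra_type D [(1, 16), (2, 8), (4, 1)]"
proof -
  \<comment> \<open>Algebraic closedness enters through these two successive square roots.\<close>
  obtain im w :: 'k where "im * im = -1" "w * w = im" using square_root by metis
  then interpret h8 im w H x y z
    using assms by unfold_locales
  show ?thesis
    unfolding Let_def using extension_abelian_central Ch_iso D_algebra_type D_coalgebra_type by blast
qed

end
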